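(* Let $n\geqslant 1$, $\alpha\in[0,1)$, $0<p,q\leqslant\infty$, $s\in\mathbb{R}$. Then the embedding $$M^{s,\alpha}_{p,q}(\mathbb{R}^n)\subset L^1(\mathbb{R}^n)$$ holds if and only if $1/p\geqslant 1$ and $$s\geqslant n\alpha(1/p-1)+(1-\alpha)B(1,q),$$ with strict inequality in the last condition when $q>1$.
   Context: Convention $1/\infty=0$. For $(p,q)\in(0,\infty]^2$, $B(p,q)=\max\{0,\ n(1-1/p-1/q),\ n(1/p-1/q)\}$. $X\subset Y$ for (quasi-)normed spaces denotes embedding: $X\subset Y$ as sets with $\|f\|_Y\leqslant C\|f\|_X$ for all $f\in X$. Fourier transform: $\mathscr{F}f(\xi)=\hat f(\xi)=\int_{\mathbb{R}^n}f(x)e^{-2\pi i x\cdot\xi}dx$. Write $\langle k\rangle=(1+|k|^2)^{1/2}$. $\alpha$-modulation space: for $\alpha\in[0,1)$, take suitable constants $c,C>0$ and Schwartz functions $\{\eta_k^\alpha\}_{k\in\mathbb{Z}^n}$ such that: $|\eta_k^\alpha(\xi)|\geqslant 1$ if $|\xi-\langle k\rangle^{\frac{\alpha}{1-\alpha}}k|<c\langle k\rangle^{\frac{\alpha}{1-\alpha}}$; $\operatorname{supp}\eta_k^\alpha\subset\{\xi:|\xi-\langle k\rangle^{\frac{\alpha}{1-\alpha}}k|<C\langle k\rangle^{\frac{\alpha}{1-\alpha}}\}$; $\sum_{k\in\mathbb{Z}^n}\eta_k^\alpha(\xi)=1$ for all $\xi\in\mathbb{R}^n$; and for every multi-index $\gamma$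 there is $C_{\gamma}$ with $|\partial^\gamma\eta_k^\alpha(\xi)|\leqslant C_{\gamma}\langle k\rangle^{-\frac{\alpha|\gamma|}{1-\alpha}}$ for all $\xi\in\mathbb{R}^n$, $k\in\mathbb{Z}^n$. Put $\Box_k^\alpha=\mathscr{F}^{-1}\eta_k^\alpha\mathscr{F}$. For $0<p,q\leqslant\infty$, $s\in\mathbb{R}$, $M^{s,\alpha}_{p,q}(\mathbb{R}^n)$ is the set of $f\in\mathscr{S}'(\mathbb{R}^n)$ with $\|f\|_{M^{s,\alpha}_{p,q}}=\big(\sum_{k\in\mathbb{Z}^n}\langle k\rangle^{\frac{sq}{1-\alpha}}\|\Box_k^\alpha f\|_{L^p}^q\big)^{1/q}<\infty$ (supremum over $k$ of $\langle k\rangle^{\frac{s}{1-\alpha}}\|\Box_k^\alpha f\|_{L^p}$ if $q=\infty$). Different choices of $\{\eta_k^\alpha\}$ give the same space with equivalent (quasi-)norms. *)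

theory Defs
  imports "HOL-Analysis.Analysis" "HOL-Probability.Essential_Supremum"
begin

section \<open>Schwartz functions and tempered distributions\<close>

text \<open>A finite list of coordinate directions plays the role of a multi-index \<open>\<gamma>\<close>; its length is
  \<open>|\<gamma>|\<close>. For smooth functions the order of the directions is irrelevant.\<close>

fun partial_deriv :: "'n::finite list \<Rightarrow> (real^'n \<Rightarrow> complex) \<Rightarrow> real^'n \<Rightarrow> complex" where
  "partial_deriv [] f = f"
| "partial_deriv (i # \<gamma>) f = (\<lambda>x. frechet_derivative (partial_deriv \<gamma> f) (at x) (axis i 1))"

definition smooth :: "(real^'n::finite \<Rightarrow> complex) \<Rightarrow> bool" where
  "smooth f \<longleftrightarrow> (\<forall>\<gamma> x. partial_deriv \<gamma> f differentiable (at x))"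

definition schwartz :: "(real^'n::finite \<Rightarrow> complex) set" where
  "schwartz = {f. smooth f \<and>
     (\<forall>N \<gamma>. bounded (range (\<lambda>x. (1 + norm x) ^ N *\<^sub>R partial_deriv \<gamma> f x)))}"

definition schwartz_seminorm :: "nat \<Rightarrow> (real^'n::finite \<Rightarrow> complex) \<Rightarrow> real" where
  "schwartz_seminorm N f =
     (\<Sum>\<gamma> | length \<gamma> \<le> N. SUP x. (1 + norm x) ^ N * norm (partial_deriv \<gamma> f x))"

text \<open>A tempered distribution is a functional on the Schwartz space, made a total HOL function in
  the usual extensional way (\<^const>\<open>undefined\<close> outside \<^const>\<open>schwartz\<close>), so that HOL equality is
  equality in the dual of the Schwartz space. Continuity is expressed through the seminorms, which
  are increasing in \<open>N\<close>.\<close>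

type_synonym 'n distr = "(real^'n \<Rightarrow> complex) \<Rightarrow> complex"

definition tempered :: "'n::finite distr set" where
  "tempered = {u \<in> extensional schwartz.
     (\<forall>\<phi>\<in>schwartz. \<forall>\<psi>\<in>schwartz. u (\<lambda>x. \<phi> x + \<psi> x) = u \<phi> + u \<psi>) \<and>
     (\<forall>c. \<forall>\<phi>\<in>schwartz. u (\<lambda>x. c * \<phi> x) = c * u \<phi>) \<and>
     (\<exists>N C. \<forall>\<phi>\<in>schwartz. norm (u \<phi>) \<le> C * schwartz_seminorm N \<phi>)}"

definition regular_distr :: "(real^'n::finite \<Rightarrow> complex) \<Rightarrow> 'n distr" where
  "regular_distr g = (\<lambda>\<phi>\<in>schwartz. LINT x|lborel. g x * \<phi> x)"

definition represents :: "(real^'n::finite \<Rightarrow> complex) \<Rightarrow> 'n distr \<Rightarrow> bool" where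
  "represents g u \<longleftrightarrow> g \<in> borel_measurable lborel \<and>
     (\<forall>\<phi>\<in>schwartz. integrable lborel (\<lambda>x. g x * \<phi> x)) \<and> u = regular_distr g"

section \<open>Fourier transform\<close>

definition fourier :: "(real^'n::finite \<Rightarrow> complex) \<Rightarrow> real^'n \<Rightarrow> complex" where
  "fourier f \<xi> = (LINT x|lborel. f x * exp (- (2 * pi * \<i> * complex_of_real (x \<bullet> \<xi>))))"

definition inv_fourier :: "(real^'n::finite \<Rightarrow> complex) \<Rightarrow> real^'n \<Rightarrow> complex" where
  "inv_fourier f x = (LINT \<xi>|lborel. f \<xi> * exp (2 * pi * \<i> * complex_of_real (x \<bullet> \<xi>)))"

definition fourier_distr :: "'n::finite distr \<Rightarrow> 'n distr" where
  "fourier_distr u = (\<lambda>\<phi>\<in>schwartz. u (fourier \<phi>))"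

definition inv_fourier_distr :: "'n::finite distr \<Rightarrow> 'n distr" where
  "inv_fourier_distr u = (\<lambda>\<phi>\<in>schwartz. u (inv_fourier \<phi>))"

definition mult_distr :: "(real^'n::finite \<Rightarrow> complex) \<Rightarrow> 'n distr \<Rightarrow> 'n distr" where
  "mult_distr \<eta> u = (\<lambda>\<phi>\<in>schwartz. u (\<lambda>\<xi>. \<eta> \<xi> * \<phi> \<xi>))"

definition fourier_mult :: "(real^'n::finite \<Rightarrow> complex) \<Rightarrow> 'n distr \<Rightarrow> 'n distr" where
  "fourier_mult \<eta> u = inv_fourier_distr (mult_distr \<eta> (fourier_distr u))"

section \<open>Lebesgue quasi-norms\<close>

text \<open>Exponents \<open>p \<in> (0,\<infinity>]\<close> are of type \<^typ>\<open>ennreal\<close>; \<open>recip p\<close> is the real number \<open>1/p\<close>,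
  with \<open>1/\<infinity> = 0\<close>.\<close>

definition recip :: "ennreal \<Rightarrow> real" where
  "recip p = enn2real (1 / p)"

text \<open>Only used for positive real exponents, whence \<open>\<infinity>\<^sup>a = \<infinity>\<close>.\<close>

definition epowr :: "ennreal \<Rightarrow> real \<Rightarrow> ennreal" where
  "epowr x a = (if x = \<infinity> then \<infinity> else ennreal (enn2real x powr a))"

definition Lp_norm :: "ennreal \<Rightarrow> (real^'n::finite \<Rightarrow> complex) \<Rightarrow> ennreal" where
  "Lp_norm p f =
     (if p = \<infinity> then esssup lborel (\<lambda>x. ennreal (norm (f x)))
      else epowr (\<integral>\<^sup>+x. epowr (ennreal (norm (f x))) (enn2real p) \<partial>lborel) (recip p))"

text \<open>The \<open>L\<^sup>p\<close> quasi-norm of a distribution: that of the function representing it, which is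
  unique up to null sets, and \<open>\<infinity>\<close> (the infimum of the empty set) if there is none.\<close>

definition distr_Lp_norm :: "ennreal \<Rightarrow> 'n::finite distr \<Rightarrow> ennreal" where
  "distr_Lp_norm p u = (INF g\<in>{g. represents g u}. Lp_norm p g)"

definition L1_space :: "'n::finite distr set" where
  "L1_space = regular_distr ` {g. integrable lborel g}"

section \<open>\<open>\<alpha>\<close>-modulation spaces\<close>

definition japanese :: "real^'n::finite \<Rightarrow> real" where
  "japanese x = sqrt (1 + (norm x)\<^sup>2)"

definition lattice_pt :: "int^'n::finite \<Rightarrow> real^'n" where
  "lattice_pt k = (\<chi> i. real_of_int (k $ i))"

definition alpha_radius :: "real \<Rightarrow> int^'n::finite \<Rightarrow> real" where
  "alpha_radius \<alpha> k = japanese (lattice_pt k) powr (\<alpha> / (1 - \<alpha>))"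

definition alpha_center :: "real \<Rightarrow> int^'n::finite \<Rightarrow> real^'n" where
  "alpha_center \<alpha> k = alpha_radius \<alpha> k *\<^sub>R lattice_pt k"

definition alpha_decomposition ::
    "real \<Rightarrow> (int^'n::finite \<Rightarrow> real^'n \<Rightarrow> complex) \<Rightarrow> bool" where
  "alpha_decomposition \<alpha> \<eta> \<longleftrightarrow>
     (\<forall>k. \<eta> k \<in> schwartz) \<and>
     (\<exists>c>0. \<exists>C>0. \<forall>k.
        (\<forall>\<xi>. norm (\<xi> - alpha_center \<alpha> k) < c * alpha_radius \<alpha> k \<longrightarrow> norm (\<eta> k \<xi>) \<ge> 1) \<and>
        closure {\<xi>. \<eta> k \<xi> \<noteq> 0} \<subseteq> {\<xi>. norm (\<xi> - alpha_center \<alpha> k) < C * alpha_radius \<alpha> k}) \<and>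
     (\<forall>\<xi>. ((\<lambda>k. \<eta> k \<xi>) has_sum 1) UNIV) \<and>
     (\<forall>\<gamma>. \<exists>C. \<forall>k \<xi>. norm (partial_deriv \<gamma> (\<eta> k) \<xi>)
        \<le> C * japanese (lattice_pt k) powr (- (\<alpha> * real (length \<gamma>) / (1 - \<alpha>))))"

definition modulation_norm ::
    "(int^'n::finite \<Rightarrow> real^'n \<Rightarrow> complex) \<Rightarrow> real \<Rightarrow> real \<Rightarrow> ennreal \<Rightarrow> ennreal \<Rightarrow> 'n distr \<Rightarrow> ennreal"
  where
  "modulation_norm \<eta> s \<alpha> p q u =
     (if q = \<infinity> then
        (SUP k. ennreal (japanese (lattice_pt k) powr (s / (1 - \<alpha>)))
                  * distr_Lp_norm p (fourier_mult (\<eta> k) u))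
      else
        epowr (\<Sum>\<^sub>\<infinity>k. ennreal (japanese (lattice_pt k) powr (s * enn2real q / (1 - \<alpha>)))
                  * epowr (distr_Lp_norm p (fourier_mult (\<eta> k) u)) (enn2real q)) (recip q))"

definition modulation_space ::
    "(int^'n::finite \<Rightarrow> real^'n \<Rightarrow> complex) \<Rightarrow> real \<Rightarrow> real \<Rightarrow> ennreal \<Rightarrow> ennreal \<Rightarrow> 'n distr set"
  where
  "modulation_space \<eta> s \<alpha> p q = {u \<in> tempered. modulation_norm \<eta> s \<alpha> p q u < \<infinity>}"

section \<open>Embeddings and the critical index\<close>

definition embedded :: "'a set \<Rightarrow> ('a \<Rightarrow> ennreal) \<Rightarrow> 'a set \<Rightarrow> ('a \<Rightarrow> ennreal) \<Rightarrow> bool" where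
  "embedded X norm_X Y norm_Y \<longleftrightarrow>
     X \<subseteq> Y \<and> (\<exists>C::real. \<forall>f\<in>X. norm_Y f \<le> ennreal C * norm_X f)"

definition B_index :: "nat \<Rightarrow> ennreal \<Rightarrow> ennreal \<Rightarrow> real" where
  "B_index n p q =
     Max {0, real n * (1 - recip p - recip q), real n * (recip p - recip q)}"

end

theory Submission
  imports Defs "HOL-Probability.Characteristic_Functions" "HOL-Probability.Sinc_Integral"
begin

text \<open>
  Write \<open>n\<close> for the dimension, \<open>r\<^sub>k\<close> for the radius of the \<open>k\<close>-th cell of the \<open>\<alpha>\<close>-covering, and
  \<open>\<Box>\<^sub>k u\<close> for \<open>fourier_mult (\<eta> k) u\<close>. The statement reduces to a weighted embedding of sequence spaces.

  \<^bold>\<open>Sufficiency.\<close> For \<open>p \<le> 1\<close> a function with spectrum in a ball of radius comparable to \<open>r\<^sub>k\<close>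
  satisfies Bernstein's inequality \<open>\<parallel>g\<parallel>\<^sub>1 \<le> C r\<^sub>k\<^bsup>n(1/p - 1)\<^esup> \<parallel>g\<parallel>\<^sub>p\<close> (lemma \<open>bernstein\<close>). Since \<open>r\<^sub>k\<close>
  is a power of \<open>\<langle>k\<rangle>\<close>, the sum of the \<open>L\<^sup>1\<close> norms of the pieces is at most a constant times
  \<open>\<Sum>\<^sub>k w\<^sub>k c\<^sub>k\<close>, where the modulation norm is the \<open>\<ell>\<^sup>q\<close> norm of \<open>c\<close> and
  \<open>w\<^sub>k = \<langle>k\<rangle>\<^bsup>- \<delta>/(1 - \<alpha>)\<^esup>\<close> with \<open>\<delta> = s - n \<alpha> (1/p - 1)\<close>. For \<open>q \<le> 1\<close> one needs \<open>w\<close> bounded, that is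
  \<open>\<delta> \<ge> 0\<close>; for \<open>q > 1\<close> one needs \<open>w \<in> \<ell>\<^bsup>q'\<^esup>\<close>, and a lattice sum \<open>\<Sum>\<^sub>k \<langle>k\<rangle>\<^bsup>-t\<^esup>\<close> converges only for
  \<open>t > n\<close>, whence the strict inequality. Finally \<open>u\<close> is the sum of its pieces
  (\<open>has_sum_fourier_mult\<close>), so it is represented by the \<open>L\<^sup>1\<close> sum of their representatives.

  \<^bold>\<open>Necessity.\<close> Dilating a single bump towards frequency zero forces \<open>p \<le> 1\<close>
  (\<open>necessary_p_le_1\<close>). For the condition on \<open>s\<close>, place one bump of size \<open>r\<^sub>k\<close> in each cell \<open>k\<close> of a
  sparse sublattice and translate the corresponding functions far apart in space. Each piece
  \<open>\<Box>\<^sub>l\<close> then sees at most one bump, so the modulation norm is an \<open>\<ell>\<^sup>q\<close> norm; and in \<open>L\<^sup>1\<close> at most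
  half of the mass cancels, so the norm is comparable to the sum of the coefficients. This gives
  the sequence inequality \<open>\<Sum>\<^sub>k a\<^sub>k \<le> C \<parallel>a / w\<parallel>\<^sub>q\<close> (\<open>embedding_imp_sequence_inequality\<close>), which
  is tested on a single coefficient for \<open>q \<le> 1\<close> and on the extremal sequence \<open>a = w\<^bsup>q'\<^esup>\<close> of
  Hoelder's inequality for \<open>q > 1\<close>.

  The geometry of the covering enters through one inequality (\<open>alpha_center_separation\<close>): centres of
  cells \<open>k, l\<close> are at distance at least \<open>(r\<^sub>k + r\<^sub>l) |k - l| / 2\<close>, so cells meet only if the indices are
  at bounded distance. The partition itself supplies all smooth cutoffs that are needed: finite sums
  of the \<open>\<eta> k\<close> equal one on large balls, and \<open>\<eta> 0\<close> yields a mollifier and the bumps.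
\<close>


section \<open>Derivatives of smooth functions\<close>

lemma partial_deriv_append:
  "partial_deriv (\<gamma> @ \<delta>) f = partial_deriv \<gamma> (partial_deriv \<delta> f)"
  by (induction \<gamma>) auto

lemma smooth_partial_deriv: "smooth f \<Longrightarrow> smooth (partial_deriv \<gamma> f)"
  unfolding smooth_def by (metis partial_deriv_append)

lemma smooth_differentiable: "smooth f \<Longrightarrow> f differentiable (at x)"
  unfolding smooth_def using partial_deriv.simps(1) by metis

lemma smooth_imp_continuous_on:
  assumes "smooth f" shows "continuous_on A f"
  by (meson assms continuous_at_imp_continuous_on differentiable_imp_continuous_within
      smooth_differentiable)

lemma smooth_measurable:
  assumes "smooth f" shows "f \<in> borel_measurable borel"
  by (intro borel_measurable_continuous_onI smooth_imp_continuous_on assms)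

lemma partial_deriv_eqI:
  assumes "\<And>x. (f has_derivative D x) (at x)"
  shows "partial_deriv [i] f = (\<lambda>x. D x (axis i 1))"
  using frechet_derivative_at[OF assms] by auto

lemma smooth_has_derivative:
  "smooth f \<Longrightarrow> (partial_deriv \<gamma> f has_derivative frechet_derivative (partial_deriv \<gamma> f) (at x)) (at x)"
  by (metis frechet_derivative_works smooth_def)

lemma partial_deriv_add:
  assumes "smooth f" "smooth g"
  shows "partial_deriv \<gamma> (\<lambda>x. f x + g x) = (\<lambda>x. partial_deriv \<gamma> f x + partial_deriv \<gamma> g x)"
proof (induction \<gamma>)
  case (Cons i \<gamma>)
  have "((\<lambda>x. partial_deriv \<gamma> f x + partial_deriv \<gamma> g x) has_derivative
      (\<lambda>h. frechet_derivative (partial_deriv \<gamma> f) (at x) h + frechet_derivative (partial_deriv \<gamma> g) (at x) h)) (at x)" for x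
    by (intro has_derivative_add smooth_has_derivative assms)
  from frechet_derivative_at[OF this, symmetric]
  show ?case by (simp add: Cons)
qed simp

lemma smooth_add:
  assumes "smooth f" "smooth g" shows "smooth (\<lambda>x. f x + g x)"
  unfolding smooth_def partial_deriv_add[OF assms]
  using assms unfolding smooth_def by (auto intro: differentiable_add)

lemma partial_deriv_cmul:
  assumes "smooth f"
  shows "partial_deriv \<gamma> (\<lambda>x. c * f x) = (\<lambda>x. c * partial_deriv \<gamma> f x)"
proof (induction \<gamma>)
  case (Cons i \<gamma>)
  have "((\<lambda>x. c * partial_deriv \<gamma> f x) has_derivative
      (\<lambda>h. c * frechet_derivative (partial_deriv \<gamma> f) (at x) h)) (at x)" for x
    by (intro has_derivative_mult_right smooth_has_derivative assms)
  from frechet_derivative_at[OF this, symmetric]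
  show ?case by (simp add: Cons)
qed simp

lemma smooth_cmul:
  assumes "smooth f" shows "smooth (\<lambda>x. c * f x)"
  unfolding smooth_def partial_deriv_cmul[OF assms]
  using assms unfolding smooth_def by (auto intro: differentiable_mult)

lemma partial_deriv_const:
  "partial_deriv (\<gamma> @ [i]) (\<lambda>x::real^'n::finite. c) = (\<lambda>x. 0)"
proof -
  have *: "partial_deriv [i] (\<lambda>x::real^'n. c) = (\<lambda>x. 0)" for i::'n and c
    by (subst partial_deriv_eqI) (auto intro: has_derivative_const)
  have "partial_deriv \<gamma> (\<lambda>x::real^'n. 0) = (\<lambda>x. 0)" for \<gamma>
  proof (induction \<gamma>)
    case (Cons i \<gamma>)
    then show ?case using *[of i 0] by simp
  qed simp
  then show ?thesis by (simp only: partial_deriv_append *)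
qed

lemma smooth_const: "smooth (\<lambda>x. c)"
  unfolding smooth_def
proof (intro allI)
  fix \<gamma> :: "'a list" and x
  show "partial_deriv \<gamma> (\<lambda>x. c) differentiable at x"
    by (cases \<gamma> rule: rev_cases) (auto simp: partial_deriv_const)
qed

lemma partial_deriv_mult_single:
  assumes "smooth f" "smooth g"
  shows "partial_deriv [i] (\<lambda>x. f x * g x) = (\<lambda>x. f x * partial_deriv [i] g x + partial_deriv [i] f x * g x)"
  by (subst partial_deriv_eqI[OF has_derivative_mult[OF smooth_has_derivative[OF assms(1), of "[]", simplified] smooth_has_derivative[OF assms(2), of "[]", simplified]]]) simp

lemma smooth_mult:
  assumes "smooth f" "smooth g" shows "smooth (\<lambda>x. f x * g x)"
proof -
  have "length \<gamma> \<le> m \<Longrightarrow> smooth f \<Longrightarrow> smooth g \<Longrightarrow> partial_deriv \<gamma> (\<lambda>x. f x * g x) differentiable (at x)"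
    for \<gamma> :: "'a list" and f g x m
  proof (induction m arbitrary: f g \<gamma> x)
    case 0
    then show ?case by (simp add: differentiable_mult smooth_differentiable)
  next
    case (Suc m)
    show ?case
    proof (cases \<gamma> rule: rev_cases)
      case Nil
      then show ?thesis using Suc.prems(2,3) by (simp add: differentiable_mult smooth_differentiable)
    next
      case (snoc \<delta> i)
      let ?F = "\<lambda>x. f x * partial_deriv [i] g x" and ?G = "\<lambda>x. partial_deriv [i] f x * g x"
      have sm: "smooth (partial_deriv [i] f)" "smooth (partial_deriv [i] g)"
        using Suc.prems smooth_partial_deriv by blast+
      have d: "partial_deriv \<delta>' ?F differentiable (at x)" "partial_deriv \<delta>' ?G differentiable (at x)"
        if "length \<delta>' \<le> m" for \<delta>' x
        using Suc.IH[OF that] Suc.prems sm by blast+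
      have eq: "partial_deriv \<delta>' (\<lambda>x. ?F x + ?G x) = (\<lambda>x. partial_deriv \<delta>' ?F x + partial_deriv \<delta>' ?G x)"
        if "length \<delta>' \<le> m" for \<delta>'
        using that
      proof (induction \<delta>')
        case (Cons j \<delta>')
        have "((\<lambda>x. partial_deriv \<delta>' ?F x + partial_deriv \<delta>' ?G x) has_derivative
           (\<lambda>h. frechet_derivative (partial_deriv \<delta>' ?F) (at x) h + frechet_derivative (partial_deriv \<delta>' ?G) (at x) h)) (at x)" for x
          using d[of \<delta>'] Cons.prems by (intro has_derivative_add) (auto simp: frechet_derivative_works)
        from frechet_derivative_at[OF this, symmetric]
        show ?case using Cons by simp
      qed simp
      have "length \<delta> \<le> m" using snoc Suc.prems by simp
      then show ?thesis
        unfolding snoc partial_deriv_append partial_deriv_mult_single[OF Suc.prems(2,3)]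
        by (simp only: eq) (intro differentiable_add d)
    qed
  qed
  then show ?thesis using assms unfolding smooth_def by blast
qed

text \<open>Peeling off the innermost derivative splits a product rule of order \<open>m + 1\<close> into two
  product rules of order \<open>m\<close>; iterating this gives the binomial bound without writing down the
  Leibniz formula.\<close>

lemma partial_deriv_mult_snoc:
  assumes "smooth f" "smooth g"
  shows "partial_deriv (\<gamma> @ [i]) (\<lambda>x. f x * g x) = (\<lambda>x. partial_deriv \<gamma> (\<lambda>x. f x * partial_deriv [i] g x) x
      + partial_deriv \<gamma> (\<lambda>x. partial_deriv [i] f x * g x) x)"
  unfolding partial_deriv_append partial_deriv_mult_single[OF assms]
  using assms by (intro partial_deriv_add smooth_mult smooth_partial_deriv)

lemma partial_deriv_mult_bound:
  assumes "smooth f" "smooth g"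
    and "\<And>\<delta>. length \<delta> \<le> length \<gamma> \<Longrightarrow> norm (partial_deriv \<delta> f x) \<le> A"
    and "\<And>\<delta>. length \<delta> \<le> length \<gamma> \<Longrightarrow> norm (partial_deriv \<delta> g x) \<le> B"
  shows "norm (partial_deriv \<gamma> (\<lambda>x. f x * g x) x) \<le> 2 ^ length \<gamma> * A * B"
  using assms
proof (induction \<gamma> arbitrary: f g rule: rev_induct)
  case Nil
  have "norm (f x) \<le> A" "norm (g x) \<le> B" using Nil(3,4)[of "[]"] by auto
  then show ?case by (auto simp: norm_mult intro!: mult_mono order_trans[OF norm_ge_zero])
next
  case (snoc i \<gamma>)
  have 1: "norm (partial_deriv \<gamma> (\<lambda>x. f x * partial_deriv [i] g x) x) \<le> 2 ^ length \<gamma> * A * B"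
  proof (rule snoc.IH)
    show "norm (partial_deriv \<delta> (partial_deriv [i] g) x) \<le> B" if "length \<delta> \<le> length \<gamma>" for \<delta>
      using snoc.prems(4)[of "\<delta> @ [i]"] that by (simp add: partial_deriv_append)
  qed (use snoc.prems smooth_partial_deriv[where \<gamma> = "[i]"] in \<open>simp_all del: partial_deriv.simps\<close>)
  have 2: "norm (partial_deriv \<gamma> (\<lambda>x. partial_deriv [i] f x * g x) x) \<le> 2 ^ length \<gamma> * A * B"
  proof (rule snoc.IH)
    show "norm (partial_deriv \<delta> (partial_deriv [i] f) x) \<le> A" if "length \<delta> \<le> length \<gamma>" for \<delta>
      using snoc.prems(3)[of "\<delta> @ [i]"] that by (simp add: partial_deriv_append)
  qed (use snoc.prems smooth_partial_deriv[where \<gamma> = "[i]"] in \<open>simp_all del: partial_deriv.simps\<close>)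
  show ?case unfolding partial_deriv_mult_snoc[OF snoc.prems(1,2)]
    using order_trans[OF norm_triangle_ineq add_mono[OF 1 2]] by (simp add: algebra_simps)
qed

lemma partial_deriv_affine:
  assumes "smooth f"
  shows "partial_deriv \<gamma> (\<lambda>x. f (c + t *\<^sub>R x)) = (\<lambda>x. complex_of_real (t ^ length \<gamma>) * partial_deriv \<gamma> f (c + t *\<^sub>R x))"
proof (induction \<gamma>)
  case (Cons i \<gamma>)
  have "((\<lambda>x. complex_of_real (t ^ length \<gamma>) * partial_deriv \<gamma> f (c + t *\<^sub>R x)) has_derivative
      (\<lambda>h. complex_of_real (t ^ length \<gamma>) * frechet_derivative (partial_deriv \<gamma> f) (at (c + t *\<^sub>R x)) (t *\<^sub>R h))) (at x)" for x
    by (intro has_derivative_mult_right has_derivative_compose[OF _ smooth_has_derivative[OF assms], of "\<lambda>x. c + t *\<^sub>R x"])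
       (auto intro!: derivative_eq_intros)
  from frechet_derivative_at[OF this, symmetric]
  have "partial_deriv (i # \<gamma>) (\<lambda>x. f (c + t *\<^sub>R x)) = (\<lambda>x. complex_of_real (t ^ length \<gamma>) * 
     frechet_derivative (partial_deriv \<gamma> f) (at (c + t *\<^sub>R x)) (t *\<^sub>R axis i 1))"
    by (simp add: Cons)
  moreover have "frechet_derivative (partial_deriv \<gamma> f) (at y) (t *\<^sub>R axis i 1) = t *\<^sub>R partial_deriv (i # \<gamma>) f y" for y
    using linear_cmul[OF has_derivative_linear[OF smooth_has_derivative[OF assms]]] by simp
  ultimately show ?case by (auto simp: fun_eq_iff scaleR_conv_of_real)
qed simp

lemma smooth_affine:
  assumes "smooth f" shows "smooth (\<lambda>x. f (c + t *\<^sub>R x))"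
  unfolding smooth_def partial_deriv_affine[OF assms]
proof (intro allI differentiable_mult differentiable_const)
  fix \<gamma> x
  have "(\<lambda>x. partial_deriv \<gamma> f (c + t *\<^sub>R x)) differentiable at x"
  proof -
    have "((\<lambda>x. c + t *\<^sub>R x) has_derivative (\<lambda>h. t *\<^sub>R h)) (at x)"
      by (auto intro!: derivative_eq_intros)
    from has_derivative_compose[OF this smooth_has_derivative[OF assms]]
    show ?thesis unfolding differentiable_def by blast
  qed
  then show "(\<lambda>x. partial_deriv \<gamma> f (c + t *\<^sub>R x)) differentiable at x" .
qed

text \<open>As a function of \<open>x\<close> this is the character of frequency \<open>y\<close>, the common kernel of \<open>fourier\<close> and
  \<open>inv_fourier\<close>.\<close>

definition wave :: "real^'n::finite \<Rightarrow> real^'n \<Rightarrow> complex" where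
  "wave y x = exp (2 * pi * \<i> * complex_of_real (x \<bullet> y))"

lemma has_derivative_wave:
  "(wave y has_derivative (\<lambda>h. wave y x * (2 * pi * \<i> * complex_of_real (h \<bullet> y)))) (at x)"
proof -
  have 1: "((\<lambda>x. 2 * pi * \<i> * complex_of_real (x \<bullet> y)) has_derivative (\<lambda>h. 2 * pi * \<i> * complex_of_real (h \<bullet> y))) (at x)"
    by (intro has_derivative_mult_right bounded_linear.has_derivative[OF bounded_linear_of_real]
        bounded_linear.has_derivative[OF bounded_linear_inner_left] has_derivative_ident)
  show ?thesis unfolding wave_def
    using has_derivative_compose[OF 1 DERIV_exp[unfolded has_field_derivative_def]] .
qed

lemma partial_deriv_wave:
  "partial_deriv \<gamma> (wave y) = (\<lambda>x. (\<Prod>i\<leftarrow>\<gamma>. 2 * pi * \<i> * complex_of_real (y $ i)) * wave y x)"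
proof (induction \<gamma>)
  case (Cons i \<gamma>)
  have "((\<lambda>x. (\<Prod>i\<leftarrow>\<gamma>. 2 * pi * \<i> * complex_of_real (y $ i)) * wave y x) has_derivative
    (\<lambda>h. (\<Prod>i\<leftarrow>\<gamma>. 2 * pi * \<i> * complex_of_real (y $ i)) * (wave y x * (2 * pi * \<i> * complex_of_real (h \<bullet> y))))) (at x)" for x
    by (intro has_derivative_mult_right has_derivative_wave)
  from frechet_derivative_at[OF this, symmetric]
  show ?case unfolding partial_deriv.simps Cons by (auto simp: inner_axis' algebra_simps)
qed simp

lemma smooth_wave: "smooth (wave y)"
  unfolding smooth_def partial_deriv_wave
proof (intro allI differentiable_mult differentiable_const)
  show "wave y differentiable at x" for x
    using has_derivative_wave unfolding differentiable_def by blast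
qed

lemma norm_wave [simp]: "norm (wave y x) = 1"
  by (simp add: wave_def norm_exp_eq_Re)

lemma norm_partial_deriv_wave_le:
  "norm (partial_deriv \<gamma> (wave y) x) \<le> (1 + 2 * pi * norm y) ^ length \<gamma>"
proof -
  have "norm (\<Prod>i\<leftarrow>\<gamma>. 2 * pi * \<i> * complex_of_real (y $ i)) \<le> (1 + 2 * pi * norm y) ^ length \<gamma>"
  proof (induction \<gamma>)
    case (Cons i \<gamma>)
    have "norm (2 * pi * \<i> * complex_of_real (y $ i)) \<le> 1 + 2 * pi * norm y"
      using component_le_norm_cart[of y i] by (simp add: norm_mult add_increasing)
    with Cons show ?case by (simp only: list.map prod_list.Cons norm_mult[of "_ * _" "prod_list _"] length_Cons power_Suc)
      (intro mult_mono, auto)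
  qed simp
  then show ?thesis by (simp add: partial_deriv_wave norm_mult)
qed

lemma has_derivative_coord: "((\<lambda>x::real^'n::finite. complex_of_real (x $ i)) has_derivative (\<lambda>h. complex_of_real (h $ i))) (at x)"
  by (intro bounded_linear.has_derivative[OF bounded_linear_of_real]
      bounded_linear.has_derivative[OF bounded_linear_vec_nth] has_derivative_ident)

lemma partial_deriv_coord:
  fixes \<gamma> :: "'n::finite list"
  shows "partial_deriv (\<gamma> @ [j]) (\<lambda>x. complex_of_real (x $ i)) = 
   partial_deriv \<gamma> (\<lambda>x. complex_of_real (axis j 1 $ i))"
  unfolding partial_deriv_append using partial_deriv_eqI[OF has_derivative_coord] by metis

lemma smooth_coord: "smooth (\<lambda>x. complex_of_real (x $ i))"
  unfolding smooth_def
proof (intro allI)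
  fix \<gamma> :: "'a list" and x
  show "partial_deriv \<gamma> (\<lambda>x. complex_of_real (x $ i)) differentiable at x"
  proof (cases \<gamma> rule: rev_cases)
    case Nil
    then show ?thesis using has_derivative_coord by (auto simp: differentiable_def)
  next
    case (snoc \<delta> j)
    then show ?thesis unfolding snoc partial_deriv_coord using smooth_const by (auto simp: smooth_def)
  qed
qed

lemma norm_partial_deriv_coord_le:
  "norm (partial_deriv \<gamma> (\<lambda>x. complex_of_real (x $ i)) x) \<le> 1 + norm x"
proof (cases \<gamma> rule: rev_cases)
  case Nil
  then show ?thesis using component_le_norm_cart[of x i] by simp
next
  case g: (snoc \<delta> j)
  show ?thesis
  proof (cases \<delta> rule: rev_cases)
    case Nil
    then show ?thesis using g by (simp only: partial_deriv_coord) (simp add: axis_def)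
  next
    case (snoc \<delta>' k)
    then show ?thesis using g by (simp only: partial_deriv_coord partial_deriv_const) simp
  qed
qed

section \<open>Schwartz seminorm bounds\<close>

text \<open>Continuity statements are phrased through pointwise bounds instead of suprema; finitely many
  lists \<open>\<gamma>\<close> of length at most \<open>N\<close> make this equivalent to bounds on the seminorms.\<close>

definition schwartz_bound :: "nat \<Rightarrow> real \<Rightarrow> (real^'n::finite \<Rightarrow> complex) \<Rightarrow> bool" where
  "schwartz_bound N B f \<longleftrightarrow>
     (\<forall>\<gamma> x. length \<gamma> \<le> N \<longrightarrow> (1 + norm x) ^ N * norm (partial_deriv \<gamma> f x) \<le> B)"

definition growth_bound :: "nat \<Rightarrow> nat \<Rightarrow> real \<Rightarrow> (real^'n::finite \<Rightarrow> complex) \<Rightarrow> bool" where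
  "growth_bound N d A m \<longleftrightarrow>
     (\<forall>\<gamma> x. length \<gamma> \<le> N \<longrightarrow> norm (partial_deriv \<gamma> m x) \<le> A * (1 + norm x) ^ d)"

lemma finite_lists_le: "finite {\<gamma>::'n::finite list. length \<gamma> \<le> N}"
  using finite_lists_length_le[of "UNIV::'n set" N] by simp

lemma schwartz_smooth: "f \<in> schwartz \<Longrightarrow> smooth f"
  by (simp add: schwartz_def)

lemma schwartz_bound_mono:
  assumes "schwartz_bound M B f" "N \<le> M" "B \<le> B'"
  shows "schwartz_bound N B' f"
  unfolding schwartz_bound_def
proof (intro allI impI)
  fix \<gamma> :: "'a list" and x assume "length \<gamma> \<le> N"
  have "(1 + norm x) ^ N * norm (partial_deriv \<gamma> f x) \<le> (1 + norm x) ^ M * norm (partial_deriv \<gamma> f x)"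
    using assms by (intro mult_right_mono power_increasing) auto
  also have "\<dots> \<le> B" using assms \<open>length \<gamma> \<le> N\<close> by (auto simp: schwartz_bound_def)
  finally show "(1 + norm x) ^ N * norm (partial_deriv \<gamma> f x) \<le> B'" using assms by simp
qed

lemma schwartz_bound_nonneg: "schwartz_bound N B f \<Longrightarrow> 0 \<le> B"
proof -
  assume "schwartz_bound N B f"
  then have "(1 + norm (0::real^'a)) ^ N * norm (partial_deriv [] f 0) \<le> B"
    unfolding schwartz_bound_def by (metis list.size(3) le0)
  then show "0 \<le> B" by (rule order_trans[rotated]) simp
qed

lemma schwartz_bound_pointwise:
  assumes "schwartz_bound N B f" "length \<gamma> \<le> N"
  shows "norm (partial_deriv \<gamma> f x) \<le> B / (1 + norm x) ^ N"
proof -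
  have "0 < (1 + norm x) ^ N" by (simp add: add_pos_nonneg)
  with assms show ?thesis by (auto simp: schwartz_bound_def pos_le_divide_eq mult.commute)
qed

text \<open>The bounds for different orders \<open>\<gamma>\<close> have to be combined into one constant, which is possible since
  only finitely many lists have length at most \<open>N\<close>.\<close>

lemma schwartz_iff_bounds: "f \<in> schwartz \<longleftrightarrow> smooth f \<and> (\<forall>N. \<exists>B. schwartz_bound N B f)"
proof (intro iffI conjI allI)
  fix N assume f: "f \<in> schwartz"
  have "\<exists>B. \<forall>x. (1 + norm x) ^ N * norm (partial_deriv \<gamma> f x) \<le> B" for \<gamma>
  proof -
    have "bounded (range (\<lambda>x. (1 + norm x) ^ N *\<^sub>R partial_deriv \<gamma> f x))"
      using f by (simp add: schwartz_def)
    then show ?thesis by (simp add: bounded_iff)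
  qed
  then obtain b where b: "\<And>\<gamma> x. (1 + norm x) ^ N * norm (partial_deriv \<gamma> f x) \<le> b \<gamma>" by metis
  have "b \<gamma> \<le> (\<Sum>\<gamma>\<in>{\<gamma>. length \<gamma> \<le> N}. \<bar>b \<gamma>\<bar>)" if "length \<gamma> \<le> N" for \<gamma>
    using member_le_sum[of \<gamma> "{\<gamma>. length \<gamma> \<le> N}" "\<lambda>\<gamma>. \<bar>b \<gamma>\<bar>"] finite_lists_le that by force
  then have "schwartz_bound N (\<Sum>\<gamma>\<in>{\<gamma>. length \<gamma> \<le> N}. \<bar>b \<gamma>\<bar>) f"
    unfolding schwartz_bound_def by (intro allI impI order_trans[OF b])
  then show "\<exists>B. schwartz_bound N B f" ..
next
  assume f: "smooth f \<and> (\<forall>N. \<exists>B. schwartz_bound N B f)"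
  have "\<exists>B. \<forall>x. norm ((1 + norm x) ^ N *\<^sub>R partial_deriv \<gamma> f x) \<le> B" for N \<gamma>
  proof -
    obtain B where "schwartz_bound (max N (length \<gamma>)) B f" using f by blast
    then have B: "(1 + norm x) ^ (max N (length \<gamma>)) * norm (partial_deriv \<gamma> f x) \<le> B" for x
      by (auto simp: schwartz_bound_def)
    have "(1 + norm x) ^ N * norm (partial_deriv \<gamma> f x) \<le> B" for x
      by (rule order_trans[OF _ B[of x]]) (intro mult_right_mono power_increasing, auto)
    then show ?thesis by auto
  qed
  then show "f \<in> schwartz" using f by (auto simp: schwartz_def bounded_iff)
qed (simp add: schwartz_def)

lemma schwartz_obtain_bound:
  assumes "f \<in> schwartz" obtains B where "schwartz_bound N B f"
  using assms schwartz_iff_bounds by blast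

lemma schwartz_bounded: 
  assumes "f \<in> schwartz" obtains A where "0 < A" "\<And>x. norm (f x) \<le> A"
proof -
  obtain A where "schwartz_bound 0 A f" using schwartz_obtain_bound[OF assms] .
  from schwartz_bound_pointwise[OF this, of "[]"] have "norm (f y) \<le> max A 1" for y by (simp add: le_max_iff_disj)
  then show ?thesis by (intro that[of "max A 1"]) auto
qed

lemma schwartz_seminorm_le:
  fixes f :: "real^'n::finite \<Rightarrow> complex"
  assumes "schwartz_bound N B f"
  shows "schwartz_seminorm N f \<le> real (card {\<gamma>::'n list. length \<gamma> \<le> N}) * B"
proof -
  have "schwartz_seminorm N f \<le> (\<Sum>\<gamma>\<in>{\<gamma>::'n list. length \<gamma> \<le> N}. B)"
    unfolding schwartz_seminorm_def using assms
    by (intro sum_mono cSUP_least) (auto simp: schwartz_bound_def)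
  then show ?thesis by simp
qed

lemma tempered_obtain_bound:
  assumes "u \<in> tempered"
  obtains N C where "C \<ge> 0" "\<And>\<phi> B. \<phi> \<in> schwartz \<Longrightarrow> schwartz_bound N B \<phi> \<Longrightarrow> norm (u \<phi>) \<le> C * B"
proof -
  from assms obtain N C where *: "\<And>\<phi>. \<phi> \<in> schwartz \<Longrightarrow> norm (u \<phi>) \<le> C * schwartz_seminorm N \<phi>"
    unfolding tempered_def by blast
  let ?D = "\<bar>C\<bar> * real (card {\<gamma>::'a list. length \<gamma> \<le> N})"
  have "norm (u \<phi>) \<le> ?D * B" if "\<phi> \<in> schwartz" "schwartz_bound N B \<phi>" for \<phi> B
  proof -
    have nn: "schwartz_seminorm N \<phi> \<ge> 0"
      unfolding schwartz_seminorm_def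
    proof (intro sum_nonneg)
      fix \<gamma> :: "'a list" assume g: "\<gamma> \<in> {\<gamma>. length \<gamma> \<le> N}"
      have "0 \<le> (1 + norm (0::real^'a)) ^ N * norm (partial_deriv \<gamma> \<phi> 0)" by simp
      also have "\<dots> \<le> (SUP x. (1 + norm x) ^ N * norm (partial_deriv \<gamma> \<phi> x))"
        using that(2) g by (intro cSUP_upper) (auto simp: schwartz_bound_def bdd_above_def)
      finally show "0 \<le> (SUP x. (1 + norm x) ^ N * norm (partial_deriv \<gamma> \<phi> x))" .
    qed
    have "norm (u \<phi>) \<le> \<bar>C\<bar> * schwartz_seminorm N \<phi>"
      using *[OF that(1)] nn mult_right_mono[of C "\<bar>C\<bar>" "schwartz_seminorm N \<phi>"] by linarith
    also have "\<dots> \<le> \<bar>C\<bar> * (real (card {\<gamma>::'a list. length \<gamma> \<le> N}) * B)"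
      by (intro mult_left_mono schwartz_seminorm_le that) auto
    finally show ?thesis by (simp add: mult.assoc)
  qed
  then show ?thesis using that[of ?D N] by auto
qed

lemma schwartz_bound_le_seminorm:
  assumes "f \<in> schwartz" shows "schwartz_bound N (schwartz_seminorm N f) f"
  unfolding schwartz_bound_def
proof (intro allI impI)
  fix \<gamma> :: "'a list" and x assume l: "length \<gamma> \<le> N"
  obtain B where B: "schwartz_bound N B f" using schwartz_obtain_bound[OF assms] .
  let ?S = "\<lambda>\<gamma>. SUP x. (1 + norm x) ^ N * norm (partial_deriv \<gamma> f x)"
  have up: "(1 + norm x) ^ N * norm (partial_deriv \<delta> f x) \<le> ?S \<delta>" if "length \<delta> \<le> N" for \<delta> x
    using that B by (intro cSUP_upper) (auto simp: schwartz_bound_def bdd_above_def)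
  have "0 \<le> ?S \<delta>" if "length \<delta> \<le> N" for \<delta>
    using up[OF that, of 0] by (rule order_trans[rotated]) simp
  then have "?S \<gamma> \<le> schwartz_seminorm N f"
    unfolding schwartz_seminorm_def
    by (intro member_le_sum[of \<gamma> "{\<gamma>. length \<gamma> \<le> N}" ?S]) (auto simp: l finite_lists_le)
  with up[OF l, of x] show "(1 + norm x) ^ N * norm (partial_deriv \<gamma> f x) \<le> schwartz_seminorm N f" by linarith
qed

lemma tempered_add: "\<lbrakk>u \<in> tempered; \<phi> \<in> schwartz; \<psi> \<in> schwartz\<rbrakk> \<Longrightarrow> u (\<lambda>x. \<phi> x + \<psi> x) = u \<phi> + u \<psi>"
  and tempered_cmul: "\<lbrakk>u \<in> tempered; \<phi> \<in> schwartz\<rbrakk> \<Longrightarrow> u (\<lambda>x. c * \<phi> x) = c * u \<phi>"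
  and tempered_extensional: "u \<in> tempered \<Longrightarrow> u \<in> extensional schwartz"
  by (auto simp: tempered_def)

lemma schwartz_bound_add:
  assumes "smooth f" "smooth g" "schwartz_bound N B f" "schwartz_bound N B' g"
  shows "schwartz_bound N (B + B') (\<lambda>x. f x + g x)"
  unfolding schwartz_bound_def partial_deriv_add[OF assms(1,2)]
proof (intro allI impI)
  fix \<gamma> :: "'a list" and x assume l: "length \<gamma> \<le> N"
  have "(1 + norm x) ^ N * norm (partial_deriv \<gamma> f x + partial_deriv \<gamma> g x)
     \<le> (1 + norm x) ^ N * (norm (partial_deriv \<gamma> f x) + norm (partial_deriv \<gamma> g x))"
    by (intro mult_left_mono norm_triangle_ineq) auto
  also have "\<dots> \<le> B + B'" using assms(3,4) l by (auto simp: schwartz_bound_def distrib_left intro!: add_mono)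
  finally show "(1 + norm x) ^ N * norm (partial_deriv \<gamma> f x + partial_deriv \<gamma> g x) \<le> B + B'" .
qed

text \<open>A multiplier of polynomial growth of degree \<open>d\<close> is paid for with \<open>d\<close> powers of decay. The constant
  depends on the multiplier only through its growth bound; this uniformity is what all later
  estimates over families of multipliers rely on.\<close>

lemma schwartz_bound_mult:
  assumes "smooth m" "smooth f" "growth_bound N d A m" "schwartz_bound (N + d) B f"
  shows "schwartz_bound N (2 ^ N * A * B) (\<lambda>x. m x * f x)"
  unfolding schwartz_bound_def
proof (intro allI impI)
  fix \<gamma> :: "'a list" and x :: "real^'a" assume l: "length \<gamma> \<le> N"
  have pos: "0 < (1 + norm x) ^ k" for k by (simp add: add_pos_nonneg)
  have A: "0 \<le> A"
  proof -
    have "norm (partial_deriv \<gamma> m x) \<le> A * (1 + norm x) ^ d" using assms(3) l by (simp add: growth_bound_def)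
    then have "0 \<le> A * (1 + norm x) ^ d" by (rule order_trans[OF norm_ge_zero])
    then show ?thesis using pos[of d] by (simp add: zero_le_mult_iff)
  qed
  have B: "0 \<le> B" using assms(4) schwartz_bound_nonneg by blast
  have "norm (partial_deriv \<gamma> (\<lambda>x. m x * f x) x) \<le> 2 ^ length \<gamma> * (A * (1 + norm x) ^ d) * (B / (1 + norm x) ^ (N + d))"
  proof (intro partial_deriv_mult_bound assms(1,2))
    fix \<delta> :: "'a list" assume \<delta>: "length \<delta> \<le> length \<gamma>"
    show "norm (partial_deriv \<delta> m x) \<le> A * (1 + norm x) ^ d"
      using assms(3) \<delta> l by (simp add: growth_bound_def)
    show "norm (partial_deriv \<delta> f x) \<le> B / (1 + norm x) ^ (N + d)"
      using schwartz_bound_pointwise[OF assms(4)] \<delta> l by simp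
  qed
  also have "\<dots> \<le> 2 ^ N * (A * (1 + norm x) ^ d) * (B / (1 + norm x) ^ (N + d))"
    using A B l by (intro mult_right_mono power_increasing mult_nonneg_nonneg divide_nonneg_nonneg) simp_all
  also have "\<dots> = 2 ^ N * A * B / (1 + norm x) ^ N"
  proof -
    have "2 ^ N * (A * a) * (B / (b * a)) = 2 ^ N * A * B / b" if "a > 0" for a b :: real
      using that by simp
    from this[OF pos[of d]] show ?thesis by (simp add: power_add)
  qed
  finally show "(1 + norm x) ^ N * norm (partial_deriv \<gamma> (\<lambda>x. m x * f x) x) \<le> 2 ^ N * A * B"
    using pos[of N] by (simp add: pos_le_divide_eq mult.commute)
qed

lemma schwartz_bound_partial_deriv:
  assumes "schwartz_bound (N + length \<delta>) B f"
  shows "schwartz_bound N B (partial_deriv \<delta> f)"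
  unfolding schwartz_bound_def partial_deriv_append[symmetric]
proof (intro allI impI)
  fix \<gamma> :: "'a list" and x :: "real^'a" assume l: "length \<gamma> \<le> N"
  have "(1 + norm x) ^ N * norm (partial_deriv (\<gamma> @ \<delta>) f x) \<le> (1 + norm x) ^ (N + length \<delta>) * norm (partial_deriv (\<gamma> @ \<delta>) f x)"
    by (intro mult_right_mono power_increasing) auto
  also have "\<dots> \<le> B" using assms l by (auto simp: schwartz_bound_def)
  finally show "(1 + norm x) ^ N * norm (partial_deriv (\<gamma> @ \<delta>) f x) \<le> B" .
qed

lemma schwartz_partial_deriv: "f \<in> schwartz \<Longrightarrow> partial_deriv \<delta> f \<in> schwartz"
  unfolding schwartz_iff_bounds
  by (intro conjI allI smooth_partial_deriv) (blast intro: schwartz_bound_partial_deriv)+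

lemma schwartz_multI:
  assumes "smooth m" "\<And>N. \<exists>d A. growth_bound N d A m" "f \<in> schwartz"
  shows "(\<lambda>x. m x * f x) \<in> schwartz"
  unfolding schwartz_iff_bounds
proof (intro conjI allI)
  show "smooth (\<lambda>x. m x * f x)" using assms schwartz_smooth smooth_mult by blast
  fix N
  obtain d A where 1: "growth_bound N d A m" using assms(2) by blast
  obtain B where "schwartz_bound (N + d) B f" using schwartz_obtain_bound[OF assms(3)] .
  then show "\<exists>B. schwartz_bound N B (\<lambda>x. m x * f x)" using schwartz_bound_mult[OF assms(1) schwartz_smooth[OF assms(3)] 1] by blast
qed

lemma schwartz_growth_bound:
  assumes "f \<in> schwartz" shows "\<exists>A. growth_bound N 0 A f"
proof -
  obtain B where B: "schwartz_bound N B f" using schwartz_obtain_bound[OF assms] .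
  have "norm (partial_deriv \<gamma> f x) \<le> B" if "length \<gamma> \<le> N" for \<gamma> x
  proof -
    have "1 * norm (partial_deriv \<gamma> f x) \<le> (1 + norm x) ^ N * norm (partial_deriv \<gamma> f x)"
      by (intro mult_right_mono one_le_power) auto
    also have "\<dots> \<le> B" using B that by (auto simp: schwartz_bound_def)
    finally show ?thesis by simp
  qed
  then show ?thesis by (auto simp: growth_bound_def)
qed

lemma schwartz_mult: "f \<in> schwartz \<Longrightarrow> g \<in> schwartz \<Longrightarrow> (\<lambda>x. f x * g x) \<in> schwartz"
  by (rule schwartz_multI[OF schwartz_smooth]) (blast intro: schwartz_growth_bound)+

lemma growth_bound_coord: "growth_bound N 1 1 (\<lambda>x. complex_of_real (x $ i))"
  by (simp add: growth_bound_def norm_partial_deriv_coord_le)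

lemma growth_bound_wave: "growth_bound N 0 ((1 + 2 * pi * norm y) ^ N) (wave y)"
  unfolding growth_bound_def
proof (intro allI impI)
  fix \<gamma> :: "'a list" and x assume "length \<gamma> \<le> N"
  then show "norm (partial_deriv \<gamma> (wave y) x) \<le> (1 + 2 * pi * norm y) ^ N * (1 + norm x) ^ 0"
    using order_trans[OF norm_partial_deriv_wave_le power_increasing[of "length \<gamma>" N]] by simp
qed

lemma growth_bound_const: "growth_bound N 0 (norm c) (\<lambda>x. c)"
  unfolding growth_bound_def
proof (intro allI impI)
  fix \<gamma> :: "'a list" and x
  show "norm (partial_deriv \<gamma> (\<lambda>x. c) x) \<le> norm c * (1 + norm x) ^ 0"
    by (cases \<gamma> rule: rev_cases) (auto simp: partial_deriv_const)
qed

lemma schwartz_wave_mult: "f \<in> schwartz \<Longrightarrow> (\<lambda>x. wave y x * f x) \<in> schwartz"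
  by (rule schwartz_multI[OF smooth_wave]) (blast intro: growth_bound_wave)+

lemma schwartz_coord_mult: "f \<in> schwartz \<Longrightarrow> (\<lambda>x. complex_of_real (x $ i) * f x) \<in> schwartz"
  by (rule schwartz_multI[OF smooth_coord]) (blast intro: growth_bound_coord)+

lemma schwartz_cmul: "f \<in> schwartz \<Longrightarrow> (\<lambda>x. c * f x) \<in> schwartz"
  by (rule schwartz_multI[OF smooth_const]) (blast intro: growth_bound_const)+

lemma schwartz_add: 
  assumes "f \<in> schwartz" "g \<in> schwartz" shows "(\<lambda>x. f x + g x) \<in> schwartz"
  unfolding schwartz_iff_bounds
proof (intro conjI allI smooth_add schwartz_smooth assms)
  fix N
  obtain B B' where "schwartz_bound N B f" "schwartz_bound N B' g"
    using schwartz_obtain_bound assms by metis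
  from schwartz_bound_add[OF assms[THEN schwartz_smooth] this]
  show "\<exists>B. schwartz_bound N B (\<lambda>x. f x + g x)" ..
qed

lemma schwartz_zero: "(\<lambda>x. 0) \<in> schwartz"
  unfolding schwartz_iff_bounds
proof (intro conjI allI smooth_const)
  fix N
  have "partial_deriv \<gamma> (\<lambda>x::real^'a. 0) = (\<lambda>x. 0)" for \<gamma>
    by (cases \<gamma> rule: rev_cases) (simp_all only: partial_deriv_const partial_deriv.simps)
  then show "\<exists>B. schwartz_bound N B (\<lambda>x::real^'a. 0)" by (auto simp: schwartz_bound_def)
qed

lemma schwartz_sum: "finite I \<Longrightarrow> (\<And>i. i \<in> I \<Longrightarrow> f i \<in> schwartz) \<Longrightarrow> (\<lambda>x. \<Sum>i\<in>I. f i x) \<in> schwartz"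
  by (induction I rule: finite_induct) (auto intro: schwartz_zero schwartz_add)

lemma one_add_norm_add_le: 
  fixes x y :: "'a::real_normed_vector"
  shows "1 + norm (x + y) \<le> (1 + norm x) * (1 + norm y)"
proof -
  have "0 \<le> norm x * norm y" by simp
  then show ?thesis using norm_triangle_ineq[of x y] unfolding distrib_left distrib_right by linarith
qed

lemma schwartz_bound_affine:
  assumes "smooth f" "schwartz_bound N B f" "t \<noteq> 0"
  shows "schwartz_bound N ((1 + \<bar>t\<bar>) ^ N * (1 + 1 / \<bar>t\<bar>) ^ N * (1 + norm c) ^ N * B) (\<lambda>x. f (c + t *\<^sub>R x))"
  unfolding schwartz_bound_def partial_deriv_affine[OF assms(1)]
proof (intro allI impI)
  fix \<gamma> :: "'a list" and x :: "real^'a" assume l: "length \<gamma> \<le> N"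
  let ?y = "c + t *\<^sub>R x"
  have x: "x = (1/t) *\<^sub>R (- c + ?y)" using assms(3) by simp
  have "1 + norm x \<le> (1 + 1 / \<bar>t\<bar>) * (1 + norm (- c + ?y))"
    by (subst x) (simp add: algebra_simps)
  also have "\<dots> \<le> (1 + 1 / \<bar>t\<bar>) * ((1 + norm c) * (1 + norm ?y))"
    using one_add_norm_add_le[of "-c" ?y] by (intro mult_left_mono) auto
  finally have 1: "(1 + norm x) ^ N \<le> (1 + 1 / \<bar>t\<bar>) ^ N * (1 + norm c) ^ N * (1 + norm ?y) ^ N"
    using power_mono[of "1 + norm x" "(1 + 1 / \<bar>t\<bar>) * ((1 + norm c) * (1 + norm ?y))" N] by (simp add: power_mult_distrib mult.assoc)
  have 2: "\<bar>t ^ length \<gamma>\<bar> \<le> (1 + \<bar>t\<bar>) ^ N"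
    using order_trans[OF power_mono[of "\<bar>t\<bar>" "1 + \<bar>t\<bar>" "length \<gamma>"] power_increasing[OF l, of "1 + \<bar>t\<bar>"]]
    by (simp add: power_abs)
  have "(1 + norm x) ^ N * norm (complex_of_real (t ^ length \<gamma>) * partial_deriv \<gamma> f ?y)
     = (1 + norm x) ^ N * (\<bar>t ^ length \<gamma>\<bar> * norm (partial_deriv \<gamma> f ?y))" by (simp add: norm_mult norm_power power_abs)
  also have "\<dots> \<le> ((1 + 1 / \<bar>t\<bar>) ^ N * (1 + norm c) ^ N * (1 + norm ?y) ^ N) * ((1 + \<bar>t\<bar>) ^ N * norm (partial_deriv \<gamma> f ?y))"
    by (intro mult_mono 1 2 order_refl) (auto intro!: mult_nonneg_nonneg)
  also have "\<dots> = (1 + \<bar>t\<bar>) ^ N * (1 + 1 / \<bar>t\<bar>) ^ N * (1 + norm c) ^ N * ((1 + norm ?y) ^ N * norm (partial_deriv \<gamma> f ?y))"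
    by (simp add: algebra_simps)
  also have "\<dots> \<le> (1 + \<bar>t\<bar>) ^ N * (1 + 1 / \<bar>t\<bar>) ^ N * (1 + norm c) ^ N * B"
    using assms(2) l by (intro mult_left_mono) (auto simp: schwartz_bound_def)
  finally show "(1 + norm x) ^ N * norm (complex_of_real (t ^ length \<gamma>) * partial_deriv \<gamma> f ?y)
      \<le> (1 + \<bar>t\<bar>) ^ N * (1 + 1 / \<bar>t\<bar>) ^ N * (1 + norm c) ^ N * B" .
qed

lemma schwartz_affine: 
  assumes "f \<in> schwartz" "t \<noteq> 0" shows "(\<lambda>x. f (c + t *\<^sub>R x)) \<in> schwartz"
  unfolding schwartz_iff_bounds
proof (intro conjI allI smooth_affine schwartz_smooth assms)
  fix N
  obtain B where "schwartz_bound N B f" using schwartz_obtain_bound assms by metis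
  from schwartz_bound_affine[OF assms(1)[THEN schwartz_smooth] this assms(2)]
  show "\<exists>B. schwartz_bound N B (\<lambda>x. f (c + t *\<^sub>R x))" ..
qed

section \<open>Integration on Euclidean space\<close>

lemma
  fixes f :: "'n::finite \<Rightarrow> real \<Rightarrow> 'b::{real_normed_field,banach,second_countable_topology}"
  assumes f: "\<And>i. integrable lborel (f i)"
  shows integrable_lborel_prod_coord: "integrable lborel (\<lambda>x::real^'n. \<Prod>i\<in>UNIV. f i (x $ i))"
    and integral_lborel_prod_coord: "(LINT x|(lborel :: (real^'n) measure). (\<Prod>i\<in>UNIV. f i (x $ i))) = (\<Prod>i\<in>UNIV. integral\<^sup>L lborel (f i))"
proof -
  interpret product_sigma_finite "\<lambda>b::real^'n. lborel :: real measure" ..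
  define F where "F b = f (THE i. b = axis i (1::real))" for b :: "real^'n"
  have F: "F (axis i 1) = f i" for i
    unfolding F_def by (metis (mono_tags, lifting) axis_eq_axis the_equality zero_neq_one)
  have intF: "integrable lborel (F b)" for b unfolding F_def by (rule f)
  have Basis: "(Basis :: (real^'n) set) = (\<lambda>i. axis i 1) ` UNIV"
    by (auto simp: Basis_vec_def)
  have inj: "inj (\<lambda>i::'n. axis i (1::real))" by (auto simp: inj_def axis_eq_axis)
  have comp: "(\<Sum>b\<in>Basis. g b *\<^sub>R b) $ i = g (axis i 1)" for g :: "real^'n \<Rightarrow> real" and i
  proof -
    have "(\<Sum>b\<in>Basis. g b *\<^sub>R b) $ i = (\<Sum>b\<in>Basis. g b *\<^sub>R b) \<bullet> axis i 1"
      by (simp add: inner_axis)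
    also have "\<dots> = g (axis i 1)" by (rule inner_sum_left_Basis) (simp add: Basis)
    finally show ?thesis .
  qed
  have prodeq: "(\<Prod>i\<in>UNIV. f i ((\<Sum>b\<in>Basis. g b *\<^sub>R b) $ i)) = (\<Prod>b\<in>Basis. F b (g b))" for g :: "real^'n \<Rightarrow> real"
    unfolding comp unfolding Basis by (subst prod.reindex[OF inj]) (simp add: F)
  have [measurable]: "f i \<in> borel_measurable borel" for i using borel_measurable_integrable[OF f[of i]] by simp
  have coord[measurable]: "(\<lambda>x::real^'n. x $ i) \<in> borel_measurable borel" for i
    by (intro borel_measurable_continuous_onI continuous_intros)
  have meas: "(\<lambda>x::real^'n. \<Prod>i\<in>UNIV. f i (x $ i)) \<in> borel_measurable borel" by measurable
  have meas2: "(\<lambda>g. \<Sum>b\<in>Basis. g b *\<^sub>R (b::real^'n)) \<in> measurable (\<Pi>\<^sub>M b\<in>Basis. lborel) borel" by measurable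
  show "integrable lborel (\<lambda>x::real^'n. \<Prod>i\<in>UNIV. f i (x $ i))"
    unfolding lborel_eq[where 'a="real^'n"] integrable_distr_eq[OF meas2 meas] prodeq
    by (rule product_integrable_prod) (auto intro: intF)
  show "(LINT x|(lborel :: (real^'n) measure). (\<Prod>i\<in>UNIV. f i (x $ i))) = (\<Prod>i\<in>UNIV. integral\<^sup>L lborel (f i))"
    unfolding lborel_eq[where 'a="real^'n"] integral_distr[OF meas2 meas] prodeq
    by (subst product_integral_prod) (auto intro: intF simp: Basis prod.reindex[OF inj] F)
qed

lemma borel_measurable_vec_nth [measurable]: "(\<lambda>x::real^'n::finite. x $ i) \<in> borel_measurable borel"
  by (intro borel_measurable_continuous_onI continuous_intros)

text \<open>The integrable weight of reference: the exponent \<open>2 n\<close> allows a comparison with the product of the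
  one-dimensional functions \<open>1 / (1 + x\<^sub>i\<^sup>2)\<close>.\<close>

definition weight :: "real^'n::finite \<Rightarrow> real" where
  "weight x = 1 / (1 + norm x) ^ (2 * CARD('n))"

lemma weight_nonneg [simp]: "0 \<le> weight x"
  by (simp add: weight_def)

lemma integrable_weight: "integrable lborel (weight :: real^'n::finite \<Rightarrow> real)"
proof (rule Bochner_Integration.integrable_bound)
  have "integrable lborel (\<lambda>x::real. inverse (1 + x^2))"
    using integrable_inverse_1_plus_square by (simp add: set_integrable_def)
  then show "integrable lborel (\<lambda>x::real^'n. \<Prod>i\<in>UNIV. inverse (1 + (x $ i)^2))"
    by (rule integrable_lborel_prod_coord)
  show "weight \<in> borel_measurable (lborel :: (real^'n) measure)"
    unfolding weight_def by measurable
  show "AE x in lborel. norm (weight (x::real^'n)) \<le> norm (\<Prod>i\<in>UNIV. inverse (1 + (x $ i)^2))"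
  proof (intro AE_I2)
    fix x :: "real^'n"
    have "(\<Prod>i\<in>(UNIV::'n set). inverse ((1 + norm x)^2)) \<le> (\<Prod>i\<in>UNIV. inverse (1 + (x $ i)^2))"
    proof (intro prod_mono conjI le_imp_inverse_le)
      fix i
      have "(x $ i)\<^sup>2 \<le> (norm x)\<^sup>2" using component_le_norm_cart[of x i] by (metis norm_ge_zero abs_le_square_iff abs_of_nonneg)
      then have "(x $ i)\<^sup>2 \<le> (norm x)\<^sup>2 + 2 * norm x" using norm_ge_zero[of x] by linarith
      then show "1 + (x $ i)\<^sup>2 \<le> (1 + norm x)\<^sup>2" by (simp add: power2_sum)
    qed (auto simp: add_pos_nonneg)
    also have "(\<Prod>i\<in>(UNIV::'n set). inverse ((1 + norm x)^2)) = weight x"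
      by (simp add: weight_def power_mult divide_inverse power_inverse)
    finally show "norm (weight x) \<le> norm (\<Prod>i\<in>UNIV. inverse (1 + (x $ i)^2))"
      by (auto simp: abs_of_nonneg prod_nonneg)
  qed
qed

lemma lborel_integral_mono:
  fixes f g :: "'a::euclidean_space \<Rightarrow> real"
  assumes "integrable lborel f" "integrable lborel g" "\<And>x. f x \<le> g x"
  shows "integral\<^sup>L lborel f \<le> integral\<^sup>L lborel g"
  using assms by (intro integral_mono_AE) auto

lemma lborel_norm_integral_le:
  fixes f :: "'a::euclidean_space \<Rightarrow> 'b::{banach,second_countable_topology}"
  assumes "integrable lborel f" "integrable lborel g" "\<And>x. norm (f x) \<le> g x"
  shows "norm (integral\<^sup>L lborel f) \<le> integral\<^sup>L lborel g"
  using assms by (intro order_trans[OF integral_norm_bound lborel_integral_mono]) auto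

lemma schwartz_measurable [measurable_dest]: "f \<in> schwartz \<Longrightarrow> f \<in> borel_measurable borel"
  by (simp add: schwartz_smooth smooth_measurable)

lemma schwartz_integrable_power:
  fixes f :: "real^'n::finite \<Rightarrow> complex"
  assumes "f \<in> schwartz"
  shows "integrable lborel (\<lambda>x. (1 + norm x) ^ k * norm (f x))"
proof -
  obtain B where B: "schwartz_bound (k + 2 * CARD('n)) B f" using schwartz_obtain_bound[OF assms] .
  show ?thesis
  proof (rule Bochner_Integration.integrable_bound)
    show "integrable lborel (\<lambda>x::real^'n. B * weight x)" by (intro integrable_mult_right integrable_weight)
    show "(\<lambda>x. (1 + norm x) ^ k * norm (f x)) \<in> borel_measurable lborel"
      using schwartz_measurable[OF assms] by measurable
    show "AE x in lborel. norm ((1 + norm x) ^ k * norm (f x)) \<le> norm (B * weight x)"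
    proof (intro AE_I2)
      fix x :: "real^'n"
      have "norm (f x) \<le> B / (1 + norm x) ^ (k + 2 * CARD('n))"
        using schwartz_bound_pointwise[OF B, of "[]"] by simp
      then have "(1 + norm x) ^ k * norm (f x) \<le> (1 + norm x) ^ k * (B / (1 + norm x) ^ (k + 2 * CARD('n)))"
        by (intro mult_left_mono) auto
      also have "\<dots> = B * weight x"
      proof -
        have "0 < (1 + norm x) ^ k" by (simp add: add_pos_nonneg)
        then show ?thesis by (simp only: power_add weight_def) simp
      qed
      finally show "norm ((1 + norm x) ^ k * norm (f x)) \<le> norm (B * weight x)" by simp
    qed
  qed
qed

lemma schwartz_integrable: 
  assumes "f \<in> schwartz" shows "integrable lborel f"
  by (rule Bochner_Integration.integrable_bound[OF schwartz_integrable_power[OF assms, of 0]])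
    (use schwartz_measurable[OF assms] in auto)

lemma schwartz_bound_integral:
  fixes f :: "real^'n::finite \<Rightarrow> complex"
  assumes "f \<in> schwartz" "schwartz_bound (2 * CARD('n)) B f"
  shows "(LINT x|lborel. norm (f x)) \<le> B * integral\<^sup>L lborel (weight :: real^'n \<Rightarrow> real)"
proof -
  have "(LINT x|lborel. norm (f x)) \<le> (LINT x|lborel. B * weight (x :: real^'n))"
  proof (rule lborel_integral_mono)
    show "integrable lborel (\<lambda>x. norm (f x))" by (intro integrable_norm schwartz_integrable assms)
    show "integrable lborel (\<lambda>x::real^'n. B * weight x)" by (intro integrable_mult_right integrable_weight)
    show "norm (f x) \<le> B * weight x" for x
      using schwartz_bound_pointwise[OF assms(2), of "[]" x] by (simp add: weight_def)
  qed
  then show ?thesis by simp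
qed

lemma
  fixes f :: "'a::euclidean_space \<Rightarrow> 'b::{banach,second_countable_topology}"
  assumes "t \<noteq> 0"
  shows integrable_affine_iff: "integrable lborel (\<lambda>x. f (c + t *\<^sub>R x)) \<longleftrightarrow> integrable lborel f"
    and integral_affine: "integral\<^sup>L lborel f = \<bar>t\<bar> ^ DIM('a) *\<^sub>R (LINT x|lborel. f (c + t *\<^sub>R x))"
proof -
  have T: "(\<lambda>x. c + t *\<^sub>R x) \<in> measurable lborel (borel :: 'a measure)" by simp
  have imp: "integrable lborel (\<lambda>x. f (c + t *\<^sub>R x)) \<and> integral\<^sup>L lborel f = \<bar>t\<bar> ^ DIM('a) *\<^sub>R (LINT x|lborel. f (c + t *\<^sub>R x))"
    if f: "integrable lborel f" and t: "t \<noteq> 0" for f :: "'a \<Rightarrow> 'b" and c t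
  proof -
    have [measurable]: "f \<in> borel_measurable borel" using f by auto
    have f': "integrable (density (distr lborel borel (\<lambda>x. c + t *\<^sub>R x)) (\<lambda>_. ennreal (\<bar>t\<bar>^DIM('a)))) f"
      using f lborel_affine[OF t, of c] by simp
    have "integrable (distr lborel borel (\<lambda>x. c + t *\<^sub>R x)) (\<lambda>x. (\<bar>t\<bar>^DIM('a)) *\<^sub>R f x)"
      using f' by (subst (asm) integrable_density) auto
    then have 1: "integrable lborel (\<lambda>x. (\<bar>t\<bar>^DIM('a)) *\<^sub>R f (c + t *\<^sub>R x))"
      by (subst (asm) integrable_distr_eq) auto
    have "integral\<^sup>L lborel f = integral\<^sup>L (density (distr lborel borel (\<lambda>x. c + t *\<^sub>R x)) (\<lambda>_. ennreal (\<bar>t\<bar>^DIM('a)))) f"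
      using lborel_affine[OF t, of c] by simp
    also have "\<dots> = (LINT x|lborel. (\<bar>t\<bar>^DIM('a)) *\<^sub>R f (c + t *\<^sub>R x))"
      by (subst integral_density) (auto simp: integral_distr)
    finally show ?thesis
      using integrable_scaleR_right[OF 1, of "1 / \<bar>t\<bar>^DIM('a)"] t by simp
  qed
  show iff: "integrable lborel (\<lambda>x. f (c + t *\<^sub>R x)) \<longleftrightarrow> integrable lborel f"
  proof
    assume "integrable lborel (\<lambda>x. f (c + t *\<^sub>R x))"
    from conjunct1[OF imp[OF this, of "1/t" "- (1/t) *\<^sub>R c"]] assms
    show "integrable lborel f" by (simp add: algebra_simps)
  qed (use imp assms in blast)
  show "integral\<^sup>L lborel f = \<bar>t\<bar> ^ DIM('a) *\<^sub>R (LINT x|lborel. f (c + t *\<^sub>R x))"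
  proof (cases "integrable lborel f")
    case True
    then show ?thesis using imp assms by blast
  next
    case False
    then show ?thesis using iff by (simp add: not_integrable_integral_eq)
  qed
qed

lemma nn_integral_affine:
  fixes f :: "'a::euclidean_space \<Rightarrow> ennreal"
  assumes "t \<noteq> 0" and [measurable]: "f \<in> borel_measurable borel"
  shows "integral\<^sup>N lborel f = ennreal (\<bar>t\<bar> ^ DIM('a)) * (\<integral>\<^sup>+x. f (c + t *\<^sub>R x) \<partial>lborel)"
proof -
  have "integral\<^sup>N lborel f = integral\<^sup>N (density (distr lborel borel (\<lambda>x. c + t *\<^sub>R x)) (\<lambda>_. ennreal (\<bar>t\<bar>^DIM('a)))) f"
    using lborel_affine[OF assms(1), of c] by simp
  also have "\<dots> = (\<integral>\<^sup>+x. ennreal (\<bar>t\<bar>^DIM('a)) * f (c + t *\<^sub>R x) \<partial>lborel)"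
    by (subst nn_integral_density) (auto simp: nn_integral_distr)
  finally show ?thesis by (subst (asm) nn_integral_cmult) auto
qed

lemma fubini_lborel:
  fixes f :: "'a::euclidean_space \<Rightarrow> 'b::euclidean_space \<Rightarrow> 'c::{banach,second_countable_topology}"
  assumes meas: "(\<lambda>(x,y). f x y) \<in> borel_measurable (borel \<Otimes>\<^sub>M borel)"
    and fin: "(\<integral>\<^sup>+x. \<integral>\<^sup>+y. ennreal (norm (f x y)) \<partial>lborel \<partial>lborel) < \<infinity>"
  shows "(LINT x|lborel. LINT y|lborel. f x y) = (LINT y|lborel. LINT x|lborel. f x y)"
proof -
  have m: "(\<lambda>(x,y). f x y) \<in> borel_measurable (lborel \<Otimes>\<^sub>M lborel)"
    using meas by (simp cong: measurable_cong_sets add: sets_pair_measure_cong[OF sets_lborel sets_lborel])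
  have "integrable (lborel \<Otimes>\<^sub>M lborel) (\<lambda>(x,y). f x y)"
  proof (rule integrableI_bounded[OF m])
    have "(\<integral>\<^sup>+z. ennreal (norm (case z of (x,y) \<Rightarrow> f x y)) \<partial>(lborel \<Otimes>\<^sub>M lborel)) =
       (\<integral>\<^sup>+x. \<integral>\<^sup>+y. ennreal (norm (f x y)) \<partial>lborel \<partial>lborel)"
      using m by (subst lborel.nn_integral_fst[symmetric]) (auto simp: split_def)
    then show "(\<integral>\<^sup>+z. ennreal (norm (case z of (x,y) \<Rightarrow> f x y)) \<partial>(lborel \<Otimes>\<^sub>M lborel)) < \<infinity>"
      using fin by simp
  qed
  from lborel_pair.Fubini_integral[OF this] show ?thesis by simp
qed

lemma fubini_bounded_kernel:
  fixes f :: "'a::euclidean_space \<Rightarrow> complex" and g :: "'b::euclidean_space \<Rightarrow> complex"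
  assumes f: "integrable lborel f" and g: "integrable lborel g"
    and k: "(\<lambda>(x,y). k x y) \<in> borel_measurable (borel \<Otimes>\<^sub>M borel)" "\<And>x y. norm (k x y) \<le> 1"
  shows "(LINT x|lborel. LINT y|lborel. f x * g y * k x y) = (LINT y|lborel. LINT x|lborel. f x * g y * k x y)"
proof (rule fubini_lborel)
  have [measurable]: "f \<in> borel_measurable borel" "g \<in> borel_measurable borel" using f g by auto
  show "(\<lambda>(x, y). f x * g y * k x y) \<in> borel_measurable (borel \<Otimes>\<^sub>M borel)"
    using k(1) by (auto simp: split_def)
  have "(\<integral>\<^sup>+x. \<integral>\<^sup>+y. ennreal (norm (f x * g y * k x y)) \<partial>lborel \<partial>lborel)
     \<le> (\<integral>\<^sup>+x. \<integral>\<^sup>+y. ennreal (norm (f x)) * ennreal (norm (g y)) \<partial>lborel \<partial>lborel)"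
    using k(2) by (intro nn_integral_mono) (auto simp: norm_mult ennreal_mult[symmetric] intro!: ennreal_leI mult_left_le)
  also have "\<dots> = (\<integral>\<^sup>+x. ennreal (norm (f x)) \<partial>lborel) * (\<integral>\<^sup>+y. ennreal (norm (g y)) \<partial>lborel)"
    by (simp add: nn_integral_cmult nn_integral_multc)
  also have "\<dots> < \<infinity>" using f g by (simp add: integrable_iff_bounded ennreal_mult_less_top)
  finally show "(\<integral>\<^sup>+x. \<integral>\<^sup>+y. ennreal (norm (f x * g y * k x y)) \<partial>lborel \<partial>lborel) < \<infinity>" .
qed

section \<open>The Fourier transform on Schwartz functions\<close>

lemma wave_neg_swap: "wave y (- x) = wave (- y) x"
  and wave_commute: "wave y x = wave x y"
  and wave_add: "wave (y + z) x = wave y x * wave z x" and wave_add_right: "wave y (x + z) = wave y x * wave y z"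
  and wave_zero [simp]: "wave 0 x = 1" "wave y 0 = 1"
  and wave_scaleR: "wave y (t *\<^sub>R x) = wave (t *\<^sub>R y) x"
  unfolding wave_def
  by (simp_all add: inner_commute exp_add[symmetric] inner_add algebra_simps)

lemma wave_measurable [measurable]:
  assumes "f \<in> measurable M borel" "g \<in> measurable M borel"
  shows "(\<lambda>z. wave (f z) (g z)) \<in> borel_measurable M"
  using assms unfolding wave_def by measurable

lemma fourier_wave: "fourier f \<xi> = (LINT x|lborel. f x * wave (- \<xi>) x)"
  by (simp add: fourier_def wave_def)

lemma inv_fourier_wave: "inv_fourier f x = (LINT \<xi>|lborel. f \<xi> * wave x \<xi>)"
  by (simp add: inv_fourier_def wave_def inner_commute)

lemma inv_fourier_eq: "inv_fourier f x = fourier f (- x)"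
  by (simp add: fourier_wave inv_fourier_wave)

lemma inv_fourier_reflect: "inv_fourier f x = fourier (\<lambda>y. f (- y)) x"
proof -
  have "fourier (\<lambda>y. f (- y)) x = (LINT y|lborel. f (- y) * wave x (- y))"
    by (simp add: fourier_wave wave_neg_swap)
  also have "\<dots> = (LINT y|lborel. f y * wave x y)"
    using integral_affine[of "-1" "\<lambda>y. f y * wave x y" 0] by simp
  finally show ?thesis by (simp add: inv_fourier_wave)
qed

lemma integrable_mult_wave: 
  assumes "integrable lborel f" shows "integrable lborel (\<lambda>x. f x * wave y x)"
proof -
  have [measurable]: "f \<in> borel_measurable borel" using assms by auto
  show ?thesis by (rule Bochner_Integration.integrable_bound[OF assms]) (auto simp: norm_mult)
qed

lemma norm_fourier_le:
  assumes "integrable lborel f" shows "norm (fourier f \<xi>) \<le> (LINT x|lborel. norm (f x))"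
  unfolding fourier_wave using integral_norm_bound[of lborel "\<lambda>x. f x * wave (-\<xi>) x"] by (simp add: norm_mult)

text \<open>Both sides are the double integral of \<open>f x * g y\<close> against the symmetric kernel.\<close>

lemma fourier_multiplication_formula:
  assumes f: "integrable lborel f" and g: "integrable lborel g"
  shows "(LINT x|lborel. f x * fourier g x) = (LINT x|lborel. fourier f x * g x)"
proof -
  have "(LINT x|lborel. f x * fourier g x) = (LINT x|lborel. LINT y|lborel. f x * g y * wave (- x) y)"
    unfolding fourier_wave by (simp only: integral_mult_right_zero mult.assoc)
  also have "\<dots> = (LINT y|lborel. LINT x|lborel. f x * g y * wave (- x) y)"
    by (rule fubini_bounded_kernel[OF f g]) auto
  also have "\<dots> = (LINT y|lborel. LINT x|lborel. (f x * wave (- y) x) * g y)"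
  proof -
    have "wave (- x) y = wave (- y) x" for x y :: "real^'a"
      using wave_commute[of "-x" y] wave_neg_swap[of y x] by simp
    then show ?thesis by (simp add: mult_ac)
  qed
  also have "\<dots> = (LINT x|lborel. fourier f x * g x)"
    unfolding fourier_wave by (simp only: integral_mult_left_zero)
  finally show ?thesis .
qed

text \<open>The second-order Taylor bound for the exponential makes the remainder quadratic in \<open>h\<close> after
  integration against \<open>|x|\<^sup>2 |f x|\<close>.\<close>

lemma fourier_has_derivative:
  fixes f :: "real^'n::finite \<Rightarrow> complex"
  assumes f: "f \<in> schwartz"
  shows "(fourier f has_derivative (\<lambda>h. LINT x|lborel. - (2 * pi * \<i> * complex_of_real (x \<bullet> h)) * f x * wave (- \<xi>) x)) (at \<xi>)"
    (is "(_ has_derivative ?L) _")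
proof -
  have [measurable]: "f \<in> borel_measurable borel" using schwartz_measurable[OF f] .
  have intx: "integrable lborel (\<lambda>x. - (2 * pi * \<i> * complex_of_real (x \<bullet> h)) * f x * wave (- \<xi>) x)" for h
  proof (rule Bochner_Integration.integrable_bound)
    show "integrable lborel (\<lambda>x. 2 * pi * norm h * ((1 + norm x) ^ 1 * norm (f x)))"
      by (intro integrable_mult_right schwartz_integrable_power f)
    show "AE x in lborel. norm (- (2 * pi * \<i> * complex_of_real (x \<bullet> h)) * f x * wave (- \<xi>) x)
       \<le> norm (2 * pi * norm h * ((1 + norm x) ^ 1 * norm (f x)))"
    proof (intro AE_I2)
      fix x
      have "\<bar>x \<bullet> h\<bar> \<le> norm h * (1 + norm x)"
        using order_trans[OF Cauchy_Schwarz_ineq2[of x h]] by (simp add: algebra_simps)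
      then have "\<bar>x \<bullet> h\<bar> * norm (f x) \<le> norm h * (1 + norm x) * norm (f x)" by (intro mult_right_mono) auto
      then show "norm (- (2 * pi * \<i> * complex_of_real (x \<bullet> h)) * f x * wave (- \<xi>) x)
       \<le> norm (2 * pi * norm h * ((1 + norm x) ^ 1 * norm (f x)))"
        by (simp add: norm_mult abs_mult mult.assoc)
    qed
  qed measurable
  define K where "K = (LINT x|lborel. (2 * pi)\<^sup>2 * ((1 + norm x)\<^sup>2 * norm (f x)))"
  have K_int: "integrable lborel (\<lambda>x. (2 * pi)\<^sup>2 * ((1 + norm x)\<^sup>2 * norm (f x)))"
    by (intro integrable_mult_right schwartz_integrable_power f)
  have "linear ?L"
  proof (rule linearI)
    fix a b :: "real^'n" and r :: real
    show "?L (a + b) = ?L a + ?L b"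
      by (subst Bochner_Integration.integral_add[symmetric, OF intx intx]) (simp add: inner_add_right algebra_simps)
    show "?L (r *\<^sub>R a) = r *\<^sub>R ?L a"
      by (subst integral_scaleR_right[symmetric]) (simp add: scaleR_conv_of_real[where 'a=complex] algebra_simps)
  qed
  then have bl: "bounded_linear ?L" by (rule linear_conv_bounded_linear[THEN iffD1])
  have rem: "norm (fourier f (\<xi> + h) - fourier f \<xi> - ?L h) \<le> K * (norm h)\<^sup>2" for h
  proof -
    have "fourier f (\<xi> + h) - fourier f \<xi> - ?L h =
      (LINT x|lborel. f x * wave (- (\<xi> + h)) x - f x * wave (- \<xi>) x - - (2 * pi * \<i> * complex_of_real (x \<bullet> h)) * f x * wave (- \<xi>) x)"
      unfolding fourier_wave
      by (subst Bochner_Integration.integral_diff, intro Bochner_Integration.integrable_diff integrable_mult_wave schwartz_integrable f, rule intx)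
         (subst Bochner_Integration.integral_diff, intro integrable_mult_wave schwartz_integrable f, intro integrable_mult_wave schwartz_integrable f, rule refl)
    also have "norm \<dots> \<le> (LINT x|lborel. (norm h)\<^sup>2 * ((2 * pi)\<^sup>2 * ((1 + norm x)\<^sup>2 * norm (f x))))"
    proof (rule lborel_norm_integral_le)
      show "integrable lborel (\<lambda>x. f x * wave (- (\<xi> + h)) x - f x * wave (- \<xi>) x - - (2 * pi * \<i> * complex_of_real (x \<bullet> h)) * f x * wave (- \<xi>) x)"
        by (intro Bochner_Integration.integrable_diff intx integrable_mult_wave schwartz_integrable f)
      show "integrable lborel (\<lambda>x. (norm h)\<^sup>2 * ((2 * pi)\<^sup>2 * ((1 + norm x)\<^sup>2 * norm (f x))))"
        by (intro integrable_mult_right[OF K_int])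
      fix x :: "real^'n"
      define \<theta> where "\<theta> = - (2 * pi * (x \<bullet> h))"
      have w: "wave (- (\<xi> + h)) x = wave (- \<xi>) x * exp (\<i> * complex_of_real \<theta>)"
        by (simp add: wave_def exp_add[symmetric] inner_add_right \<theta>_def algebra_simps)
      have "f x * wave (- (\<xi> + h)) x - f x * wave (- \<xi>) x - - (2 * pi * \<i> * complex_of_real (x \<bullet> h)) * f x * wave (- \<xi>) x
        = f x * wave (- \<xi>) x * (exp (\<i> * complex_of_real \<theta>) - (\<Sum>k\<le>1. (\<i> * complex_of_real \<theta>) ^ k / fact k))"
        unfolding w \<theta>_def by (simp add: algebra_simps)
      also have "norm \<dots> \<le> norm (f x) * \<theta>\<^sup>2"
      proof -
        have "norm (exp (\<i> * complex_of_real \<theta>) - (\<Sum>k\<le>1. (\<i> * complex_of_real \<theta>) ^ k / fact k)) \<le> \<bar>\<theta>\<bar> ^ Suc 1 / fact (Suc 1)"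
          by (rule iexp_approx1)
        also have "\<dots> \<le> \<theta>\<^sup>2" by (simp add: power2_eq_square fact_numeral)
        finally show ?thesis by (simp add: norm_mult mult_left_mono)
      qed
      also have "\<dots> \<le> norm (f x) * (2 * pi * (norm h * (1 + norm x)))\<^sup>2"
      proof (intro mult_left_mono)
        have "\<bar>x \<bullet> h\<bar> \<le> norm h * (1 + norm x)"
        using order_trans[OF Cauchy_Schwarz_ineq2[of x h]] by (simp add: algebra_simps)
        then have "\<bar>\<theta>\<bar> \<le> 2 * pi * (norm h * (1 + norm x))" by (simp add: \<theta>_def abs_mult)
        then show "\<theta>\<^sup>2 \<le> (2 * pi * (norm h * (1 + norm x)))\<^sup>2" by (metis abs_ge_zero power2_abs power_mono)
      qed simp
      also have "\<dots> = (norm h)\<^sup>2 * ((2 * pi)\<^sup>2 * ((1 + norm x)\<^sup>2 * norm (f x)))" by (simp add: power_mult_distrib)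
      finally show "norm (f x * wave (- (\<xi> + h)) x - f x * wave (- \<xi>) x - - (2 * pi * \<i> * complex_of_real (x \<bullet> h)) * f x * wave (- \<xi>) x)
         \<le> (norm h)\<^sup>2 * ((2 * pi)\<^sup>2 * ((1 + norm x)\<^sup>2 * norm (f x)))" .
    qed
    also have "\<dots> = K * (norm h)\<^sup>2" unfolding K_def by (subst integral_mult_right_zero) simp
    finally show ?thesis .
  qed
  have "((\<lambda>h. norm (fourier f (\<xi> + h) - fourier f \<xi> - ?L h) / norm h) \<longlongrightarrow> 0) (at 0)"
  proof (rule tendsto_sandwich)
    show "\<forall>\<^sub>F h in at 0. 0 \<le> norm (fourier f (\<xi> + h) - fourier f \<xi> - ?L h) / norm h" by simp
    show "\<forall>\<^sub>F h in at 0. norm (fourier f (\<xi> + h) - fourier f \<xi> - ?L h) / norm h \<le> K * norm h"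
    proof (rule always_eventually, rule allI)
      fix h :: "real^'n" 
      show "norm (fourier f (\<xi> + h) - fourier f \<xi> - ?L h) / norm h \<le> K * norm h"
        using rem[of h] by (cases "h = 0") (auto simp: divide_le_eq power2_eq_square mult.assoc)
    qed
    show "((\<lambda>h::real^'n. K * norm h) \<longlongrightarrow> 0) (at 0)" by (auto intro!: tendsto_eq_intros)
  qed simp
  then show ?thesis using bl by (simp add: has_derivative_at)
qed

lemma fourier_partial_deriv_single:
  assumes "f \<in> schwartz"
  shows "partial_deriv [i] (fourier f) = fourier (\<lambda>x. (- (2 * pi * \<i>)) * (complex_of_real (x $ i) * f x))"
  unfolding partial_deriv_eqI[OF fourier_has_derivative[OF assms]]
  by (auto simp: fourier_wave inner_axis algebra_simps)

lemma has_vector_derivative_quotient_tendsto: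
  assumes "(f has_vector_derivative D) (at (0::real))"
  shows "((\<lambda>h. (f h - f 0) /\<^sub>R h) \<longlongrightarrow> D) (at 0)"
proof -
  have "((\<lambda>h. norm (f (0 + h) - f 0 - h *\<^sub>R D) / norm h) \<longlongrightarrow> 0) (at 0)"
    by (rule assms[unfolded has_vector_derivative_def has_derivative_at, THEN conjunct2])
  moreover have "\<forall>\<^sub>F h in at 0. norm (f (0 + h) - f 0 - h *\<^sub>R D) / norm h = norm ((f h - f 0) /\<^sub>R h - D)"
    unfolding eventually_at_filter
  proof (rule always_eventually, intro allI impI)
    fix h :: real assume "h \<noteq> 0"
    then have eq: "(f h - f 0) /\<^sub>R h - D = inverse h *\<^sub>R (f (0 + h) - f 0 - h *\<^sub>R D)"
      by (simp add: scaleR_diff_right)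
    show "norm (f (0 + h) - f 0 - h *\<^sub>R D) / norm h = norm ((f h - f 0) /\<^sub>R h - D)"
      unfolding eq norm_scaleR by (simp add: divide_inverse abs_inverse mult.commute)
  qed
  ultimately have "((\<lambda>h. norm ((f h - f 0) /\<^sub>R h - D)) \<longlongrightarrow> 0) (at 0)"
    by (rule Lim_transform_eventually)
  then show ?thesis by (rule LIM_zero_cancel[OF tendsto_norm_zero_cancel])
qed

text \<open>The difference quotients in direction \<open>i\<close> have integral zero by translation invariance, and they
  are dominated by the decay of the derivative on a unit neighbourhood.\<close>

lemma integral_partial_deriv_eq_0:
  fixes f :: "real^'n::finite \<Rightarrow> complex"
  assumes f: "f \<in> schwartz"
  shows "(LINT x|lborel. partial_deriv [i] f x) = 0"
proof -
  define e where "e = axis i (1::real)"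
  have ne: "norm e = 1" by (simp add: e_def)
  define t where "t m = 1 / real (Suc m)" for m
  have t: "0 < t m" "t m \<le> 1" for m by (auto simp: t_def)
  have t0: "t \<longlonglongrightarrow> 0" unfolding t_def using LIMSEQ_inverse_real_of_nat by (simp add: inverse_eq_divide)
  define q where "q m x = (1 / t m) *\<^sub>R (f (x + t m *\<^sub>R e) - f x)" for m x
  obtain B where B: "schwartz_bound (2 * CARD('n)) B (partial_deriv [i] f)"
    using schwartz_obtain_bound[OF schwartz_partial_deriv[OF f]] .
  have B0: "0 \<le> B" using schwartz_bound_nonneg[OF B] .
  have [measurable]: "f \<in> borel_measurable borel" "partial_deriv [i] f \<in> borel_measurable borel"
    using schwartz_measurable f schwartz_partial_deriv by blast+
  have vd: "((\<lambda>s. f (x + s *\<^sub>R e)) has_vector_derivative partial_deriv [i] f (x + s *\<^sub>R e)) (at s)" for x s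
  proof -
    have 1: "((\<lambda>s. x + s *\<^sub>R e) has_derivative (\<lambda>h. h *\<^sub>R e)) (at s)" by (auto intro!: derivative_eq_intros)
    have "linear (frechet_derivative f (at (x + s *\<^sub>R e)))"
      using has_derivative_linear[OF smooth_has_derivative[OF schwartz_smooth[OF f], of "[]"]] by simp
    then show ?thesis
      unfolding has_vector_derivative_def
      using has_derivative_compose[OF 1 smooth_has_derivative[OF schwartz_smooth[OF f], of "[]", simplified]]
      by (simp add: linear_cmul e_def)
  qed
  have int_f: "integrable lborel f" using schwartz_integrable[OF f] .
  have int_fs: "integrable lborel (\<lambda>x. f (x + c))" and eq_fs: "(LINT x|lborel. f (x + c)) = (LINT x|lborel. f x)" for c
    using integrable_affine_iff[of 1 f c] integral_affine[of 1 f c] int_f by (auto simp: add.commute)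
  have zero: "(LINT x|lborel. q m x) = 0" for m
    unfolding q_def by (subst integral_scaleR_right) (simp add: Bochner_Integration.integral_diff[OF int_fs int_f] eq_fs)
  have "(\<lambda>m. LINT x|lborel. q m x) \<longlonglongrightarrow> (LINT x|lborel. partial_deriv [i] f x)"
  proof (rule integral_dominated_convergence)
    show "integrable lborel (\<lambda>x. B * 2 ^ (2 * CARD('n)) * weight (x::real^'n))"
      by (intro integrable_mult_right integrable_weight)
    show "AE x in lborel. (\<lambda>m. q m x) \<longlonglongrightarrow> partial_deriv [i] f x"
    proof (intro AE_I2)
      fix x
      have "((\<lambda>s. f (x + s *\<^sub>R e)) has_vector_derivative partial_deriv [i] f x) (at 0)" using vd[of x 0] by simp
      then have "((\<lambda>s. (f (x + s *\<^sub>R e) - f x) /\<^sub>R s) \<longlongrightarrow> partial_deriv [i] f x) (at 0)"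
        by (rule has_vector_derivative_quotient_tendsto[where f="\<lambda>s. f (x + s *\<^sub>R e)", simplified])
      moreover have "filterlim t (at 0) sequentially"
        using t0 t(1) by (auto simp: filterlim_at less_imp_neq[symmetric])
      ultimately have "(\<lambda>m. (f (x + t m *\<^sub>R e) - f x) /\<^sub>R t m) \<longlonglongrightarrow> partial_deriv [i] f x"
        by (rule filterlim_compose)
      then show "(\<lambda>m. q m x) \<longlonglongrightarrow> partial_deriv [i] f x" by (simp add: q_def inverse_eq_divide)
    qed
    show "AE x in lborel. norm (q m x) \<le> B * 2 ^ (2 * CARD('n)) * weight x" for m
    proof (intro AE_I2)
      fix x :: "real^'n"
      have bd: "norm (partial_deriv [i] f (x + s *\<^sub>R e)) \<le> B * 2 ^ (2 * CARD('n)) * weight x" if "0 \<le> s" "s \<le> 1" for s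
      proof -
        let ?y = "x + s *\<^sub>R e"
        have "1 + norm x \<le> (1 + norm ?y) * (1 + norm (- (s *\<^sub>R e)))"
          using one_add_norm_add_le[of ?y "- (s *\<^sub>R e)"] by simp
        also have "\<dots> \<le> (1 + norm ?y) * 2" using that ne by (intro mult_left_mono) auto
        finally have le: "1 + norm x \<le> (1 + norm ?y) * 2" .
        have "(1 + norm x) ^ (2 * CARD('n)) \<le> (1 + norm ?y) ^ (2 * CARD('n)) * 2 ^ (2 * CARD('n))"
          unfolding power_mult_distrib[symmetric] by (intro power_mono le) auto
        then have "weight ?y \<le> 2 ^ (2 * CARD('n)) * weight x"
          by (simp add: weight_def divide_simps add_pos_nonneg zero_less_power mult.commute)
        then have "B * weight ?y \<le> B * 2 ^ (2 * CARD('n)) * weight x"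
          using B0 mult_left_mono[of "weight ?y" _ B] by (simp add: mult.assoc)
        moreover have "norm (partial_deriv [i] f ?y) \<le> B * weight ?y"
          using schwartz_bound_pointwise[OF B, of "[]"] by (simp add: weight_def)
        ultimately show ?thesis by linarith
      qed
      have "norm (f (x + t m *\<^sub>R e) - f (x + 0 *\<^sub>R e)) \<le> norm (t m - 0) * (B * 2 ^ (2 * CARD('n)) * weight x)"
      proof (subst mult.commute, rule differentiable_bound[where S="{0..t m}" and f'="\<lambda>s h. h *\<^sub>R partial_deriv [i] f (x + s *\<^sub>R e)" and f="\<lambda>s. f (x + s *\<^sub>R e)"])
        fix s assume s: "s \<in> {0..t m}"
        then have bs: "norm (partial_deriv [i] f (x + s *\<^sub>R e)) \<le> B * 2 ^ (2 * CARD('n)) * weight x" using bd[of s] t(2)[of m] by auto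
        show "onorm (\<lambda>h. h *\<^sub>R partial_deriv [i] f (x + s *\<^sub>R e)) \<le> B * 2 ^ (2 * CARD('n)) * weight x"
        proof (rule onorm_bound)
          show "0 \<le> B * 2 ^ (2 * CARD('n)) * weight x" using B0 by simp
          show "norm (h *\<^sub>R partial_deriv [i] f (x + s *\<^sub>R e)) \<le> B * 2 ^ (2 * CARD('n)) * weight x * norm h" for h
            using mult_left_mono[OF bs, of "norm h"] by (simp add: mult.commute del: partial_deriv.simps)
        qed
        show "((\<lambda>s. f (x + s *\<^sub>R e)) has_derivative (\<lambda>h. h *\<^sub>R partial_deriv [i] f (x + s *\<^sub>R e))) (at s within {0..t m})"
          using vd[of x s] unfolding has_vector_derivative_def by (rule has_derivative_at_withinI)
      qed (use t[of m] in auto)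
      then show "norm (q m x) \<le> B * 2 ^ (2 * CARD('n)) * weight x"
        using t(1)[of m] by (simp add: q_def divide_simps mult.commute)
    qed
  qed (simp_all add: q_def del: partial_deriv.simps)
  then show ?thesis using zero by (simp add: LIMSEQ_const_iff)
qed

text \<open>Integration by parts: the integral of the derivative of \<open>f x * wave (- \<xi>) x\<close> vanishes.\<close>

lemma fourier_of_partial_deriv:
  assumes f: "f \<in> schwartz"
  shows "fourier (partial_deriv [i] f) \<xi> = (2 * pi * \<i> * complex_of_real (\<xi> $ i)) * fourier f \<xi>"
proof -
  have s: "smooth f" "smooth (wave (- \<xi>))" using f schwartz_smooth smooth_wave by blast+
  have w: "partial_deriv [i] (wave (- \<xi>)) x = - (2 * pi * \<i> * complex_of_real (\<xi> $ i)) * wave (- \<xi>) x" for x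
    using partial_deriv_wave[of "[i]" "- \<xi>"] by simp
  have sch: "(\<lambda>x. f x * wave (- \<xi>) x) \<in> schwartz" using schwartz_wave_mult[OF f] by (simp add: mult.commute)
  have "0 = (LINT x|lborel. f x * partial_deriv [i] (wave (- \<xi>)) x + partial_deriv [i] f x * wave (- \<xi>) x)"
    using integral_partial_deriv_eq_0[OF sch, of i] unfolding partial_deriv_mult_single[OF s] by simp
  also have "\<dots> = (LINT x|lborel. - (2 * pi * \<i> * complex_of_real (\<xi> $ i)) * (f x * wave (- \<xi>) x) + partial_deriv [i] f x * wave (- \<xi>) x)"
    by (simp add: w algebra_simps del: partial_deriv.simps)
  also have "\<dots> = - (2 * pi * \<i> * complex_of_real (\<xi> $ i)) * fourier f \<xi> + fourier (partial_deriv [i] f) \<xi>"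
    unfolding fourier_wave
    by (subst Bochner_Integration.integral_add, intro integrable_mult_right integrable_mult_wave schwartz_integrable f,
        intro integrable_mult_wave schwartz_integrable schwartz_partial_deriv f, simp only: integral_mult_right_zero)
  finally show ?thesis by (simp add: algebra_simps del: partial_deriv.simps)
qed

lemma fourier_decay:
  "\<exists>C\<ge>0. \<forall>f\<in>schwartz. \<forall>B. schwartz_bound (k + 2 * CARD('n)) B f \<longrightarrow>
     (\<forall>\<xi>::real^'n::finite. (1 + norm \<xi>) ^ k * norm (fourier f \<xi>) \<le> C * B)"
proof (induction k)
  case 0
  let ?I = "integral\<^sup>L lborel (weight :: real^'n \<Rightarrow> real)"
  have "?I \<ge> 0" by (rule integral_nonneg_AE) simp
  moreover have "norm (fourier f \<xi>) \<le> ?I * B" if "f \<in> schwartz" "schwartz_bound (2 * CARD('n)) B f" for f B and \<xi> :: "real^'n"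
    using norm_fourier_le[OF schwartz_integrable[OF that(1)], of \<xi>] schwartz_bound_integral[OF that] by (simp add: mult.commute)
  ultimately show ?case by (intro exI[of _ ?I]) auto
next
  case (Suc k)
  then obtain C where C: "C \<ge> 0" "\<And>f B \<xi>::real^'n. f \<in> schwartz \<Longrightarrow> schwartz_bound (k + 2 * CARD('n)) B f \<Longrightarrow> 
     (1 + norm \<xi>) ^ k * norm (fourier f \<xi>) \<le> C * B" by blast
  have "(1 + norm \<xi>) ^ Suc k * norm (fourier f \<xi>) \<le> ((1 + real CARD('n)) * C) * B"
    if f: "f \<in> schwartz" and B: "schwartz_bound (Suc k + 2 * CARD('n)) B f" for f B and \<xi> :: "real^'n"
  proof -
    have 0: "(1 + norm \<xi>) ^ k * norm (fourier f \<xi>) \<le> C * B"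
      by (rule C(2)[OF f schwartz_bound_mono[OF B]]) auto
    have i: "(1 + norm \<xi>) ^ k * (\<bar>\<xi> $ i\<bar> * norm (fourier f \<xi>)) \<le> C * B" for i
    proof -
      have "1 * \<bar>\<xi> $ i\<bar> \<le> 2 * pi * \<bar>\<xi> $ i\<bar>" using pi_gt3 by (intro mult_right_mono) auto
      then have "\<bar>\<xi> $ i\<bar> * norm (fourier f \<xi>) \<le> 2 * pi * \<bar>\<xi> $ i\<bar> * norm (fourier f \<xi>)" by (intro mult_right_mono) auto
      also have "\<dots> = norm (fourier (partial_deriv [i] f) \<xi>)"
        unfolding fourier_of_partial_deriv[OF f] by (simp add: norm_mult)
      finally have "(1 + norm \<xi>) ^ k * (\<bar>\<xi> $ i\<bar> * norm (fourier f \<xi>)) \<le> (1 + norm \<xi>) ^ k * norm (fourier (partial_deriv [i] f) \<xi>)"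
        by (intro mult_left_mono) auto
      also have "\<dots> \<le> C * B"
        by (rule C(2)[OF schwartz_partial_deriv[OF f] schwartz_bound_partial_deriv]) (use B in simp)
      finally show ?thesis .
    qed
    have "(1 + norm \<xi>) ^ Suc k * norm (fourier f \<xi>) = (1 + norm \<xi>) ^ k * ((1 + norm \<xi>) * norm (fourier f \<xi>))" by simp
    also have "\<dots> \<le> (1 + norm \<xi>) ^ k * ((1 + (\<Sum>i\<in>UNIV. \<bar>\<xi> $ i\<bar>)) * norm (fourier f \<xi>))"
      using norm_le_l1_cart[of \<xi>] by (intro mult_left_mono mult_right_mono) auto
    also have "\<dots> = (1 + norm \<xi>) ^ k * norm (fourier f \<xi>) + (\<Sum>i\<in>UNIV. (1 + norm \<xi>) ^ k * (\<bar>\<xi> $ i\<bar> * norm (fourier f \<xi>)))"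
      by (simp add: distrib_left distrib_right sum_distrib_left sum_distrib_right)
    also have "\<dots> \<le> C * B + (\<Sum>i\<in>(UNIV::'n set). C * B)" by (intro add_mono 0 sum_mono i)
    also have "\<dots> = ((1 + real CARD('n)) * C) * B" by (simp add: algebra_simps)
    finally show ?thesis .
  qed
  then show ?case using C(1) by (intro exI[of _ "(1 + real CARD('n)) * C"]) auto
qed

lemma partial_deriv_fourier_form:
  "\<exists>C\<ge>0. \<forall>\<gamma> f B. length \<gamma> = l \<longrightarrow> f \<in> schwartz \<longrightarrow> schwartz_bound (N + l) B f \<longrightarrow>
     (\<exists>g\<in>schwartz. schwartz_bound N (C * B) g \<and> partial_deriv \<gamma> (fourier f) = fourier (g :: real^'n::finite \<Rightarrow> complex))"
proof (induction l)
  case 0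
  then show ?case by (intro exI[of _ 1]) auto
next
  case (Suc l)
  then obtain C where C: "C \<ge> 0" "\<And>\<gamma> f B. length \<gamma> = l \<Longrightarrow> f \<in> schwartz \<Longrightarrow> schwartz_bound (N + l) B f \<Longrightarrow>
     (\<exists>g\<in>schwartz. schwartz_bound N (C * B) g \<and> partial_deriv \<gamma> (fourier f) = fourier (g :: real^'n \<Rightarrow> complex))" by blast
  let ?D = "2 ^ (N + l) * norm (- (2 * pi * \<i>)) * (2 ^ (N + l) * 1)"
  have "\<exists>g\<in>schwartz. schwartz_bound N (C * ?D * B) g \<and> partial_deriv \<gamma> (fourier f) = fourier g"
    if "length \<gamma> = Suc l" "f \<in> schwartz" "schwartz_bound (N + Suc l) B f" for \<gamma> B and f :: "real^'n \<Rightarrow> complex"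
  proof -
    obtain \<delta> i where g: "\<gamma> = \<delta> @ [i]" "length \<delta> = l" using \<open>length \<gamma> = Suc l\<close> by (metis length_Suc_conv_rev)
    let ?h = "\<lambda>x. (- (2 * pi * \<i>)) * (complex_of_real (x $ i) * f x)"
    have hs: "?h \<in> schwartz" by (intro schwartz_cmul schwartz_coord_mult that)
    have sm: "smooth f" using that schwartz_smooth by blast
    have "schwartz_bound (N + l) (2 ^ (N + l) * 1 * B) (\<lambda>x. complex_of_real (x $ i) * f x)"
      using schwartz_bound_mult[OF smooth_coord sm growth_bound_coord] that(3) by simp
    then have "schwartz_bound (N + l) (?D * B) ?h"
      using schwartz_bound_mult[OF smooth_const smooth_mult[OF smooth_coord sm] growth_bound_const, of "N + l" "2 ^ (N + l) * 1 * B" i "- (2 * pi * \<i>)"] 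
      by (simp add: mult.assoc)
    from C(2)[OF g(2) hs this] show ?thesis
      unfolding g partial_deriv_append fourier_partial_deriv_single[OF that(2)] by (simp add: mult.assoc)
  qed
  then show ?case using C(1) by (intro exI[of _ "C * ?D"]) auto
qed

text \<open>Continuity of the Fourier transform on the Schwartz space: derivatives of \<open>fourier f\<close> are
  Fourier transforms of polynomial multiples of \<open>f\<close>, and decay comes from integration by parts.\<close>

lemma fourier_schwartz_bound:
  "\<exists>M C. C \<ge> 0 \<and> (\<forall>f B. f \<in> schwartz \<longrightarrow> schwartz_bound M B f \<longrightarrow> schwartz_bound N (C * B) (fourier (f :: real^'n::finite \<Rightarrow> complex)))"
proof -
  let ?K = "N + 2 * CARD('n)"
  obtain C where C: "C \<ge> 0" "\<And>f B \<xi>::real^'n. f \<in> schwartz \<Longrightarrow> schwartz_bound ?K B f \<Longrightarrow> 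
     (1 + norm \<xi>) ^ N * norm (fourier f \<xi>) \<le> C * B" using fourier_decay[of N] by blast
  obtain D where D: "\<And>l. D l \<ge> 0" "\<And>l \<gamma> f B. length \<gamma> = l \<Longrightarrow> f \<in> schwartz \<Longrightarrow> schwartz_bound (?K + l) B f \<Longrightarrow>
     (\<exists>g\<in>schwartz. schwartz_bound ?K (D l * B) g \<and> partial_deriv \<gamma> (fourier f) = fourier (g :: real^'n \<Rightarrow> complex))"
    using partial_deriv_fourier_form[where N="?K" and 'n='n] by metis
  define D' where "D' = (\<Sum>l\<le>N. D l)"
  have D': "D l \<le> D'" if "l \<le> N" for l
    unfolding D'_def using that D(1) by (intro member_le_sum) auto
  have "schwartz_bound N (C * D' * B) (fourier f)" if f: "f \<in> schwartz" and B: "schwartz_bound (?K + N) B f" for B and f :: "real^'n \<Rightarrow> complex"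
    unfolding schwartz_bound_def
  proof (intro allI impI)
    fix \<gamma> :: "'n list" and x :: "real^'n" assume l: "length \<gamma> \<le> N"
    have "schwartz_bound (?K + length \<gamma>) B f" by (rule schwartz_bound_mono[OF B]) (use l in auto)
    from D(2)[OF refl f this] obtain g where g: "g \<in> schwartz" "schwartz_bound ?K (D (length \<gamma>) * B) g"
      "partial_deriv \<gamma> (fourier f) = fourier g" by blast
    have "(1 + norm x) ^ N * norm (partial_deriv \<gamma> (fourier f) x) \<le> C * (D (length \<gamma>) * B)"
      unfolding g(3) by (rule C(2)[OF g(1,2)])
    also have "\<dots> \<le> C * (D' * B)"
      using D'[OF l] C(1) schwartz_bound_nonneg[OF B] by (intro mult_left_mono mult_right_mono) auto
    finally show "(1 + norm x) ^ N * norm (partial_deriv \<gamma> (fourier f) x) \<le> C * D' * B" by (simp add: mult.assoc)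
  qed
  moreover have "C * D' \<ge> 0" using C(1) D(1) by (auto simp: D'_def intro!: mult_nonneg_nonneg sum_nonneg)
  ultimately show ?thesis by blast
qed

lemma schwartz_fourier:
  assumes f: "(f :: real^'n::finite \<Rightarrow> complex) \<in> schwartz" shows "fourier f \<in> schwartz"
  unfolding schwartz_iff_bounds
proof (intro conjI allI)
  show "smooth (fourier f)"
    unfolding smooth_def
  proof (intro allI)
    fix \<gamma> :: "'n list" and x
    obtain B where "schwartz_bound (0 + length \<gamma>) B f" using schwartz_obtain_bound[OF f] .
    moreover obtain C where "\<And>\<delta> f B. length \<delta> = length \<gamma> \<Longrightarrow> f \<in> schwartz \<Longrightarrow> schwartz_bound (0 + length \<gamma>) B f \<Longrightarrow>
     (\<exists>g\<in>schwartz. schwartz_bound 0 (C * B) g \<and> partial_deriv \<delta> (fourier f) = fourier (g :: real^'n \<Rightarrow> complex))"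
      using partial_deriv_fourier_form[of "length \<gamma>" 0] by blast
    ultimately obtain g where "g \<in> schwartz" "partial_deriv \<gamma> (fourier f) = fourier g"
      using f by blast
    then show "partial_deriv \<gamma> (fourier f) differentiable at x"
      using fourier_has_derivative[of g x] by (auto simp: differentiable_def)
  qed
  fix N
  obtain M C where "\<And>f B. f \<in> schwartz \<Longrightarrow> schwartz_bound M B f \<Longrightarrow> schwartz_bound N (C * B) (fourier (f :: real^'n \<Rightarrow> complex))"
    using fourier_schwartz_bound[of N] by blast
  moreover obtain B where "schwartz_bound M B f" using schwartz_obtain_bound[OF f] .
  ultimately show "\<exists>B. schwartz_bound N B (fourier f)" using f by blast
qed

lemma inv_fourier_eq_affine: "inv_fourier f = (\<lambda>x. fourier f (0 + (- 1) *\<^sub>R x))"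
  by (simp add: fun_eq_iff inv_fourier_eq)

lemma schwartz_inv_fourier: "f \<in> schwartz \<Longrightarrow> inv_fourier f \<in> schwartz"
  unfolding inv_fourier_eq_affine by (intro schwartz_affine schwartz_fourier) auto

lemma inv_fourier_schwartz_bound:
  "\<exists>M C. C \<ge> 0 \<and> (\<forall>f B. f \<in> schwartz \<longrightarrow> schwartz_bound M B f \<longrightarrow> schwartz_bound N (C * B) (inv_fourier (f :: real^'n::finite \<Rightarrow> complex)))"
proof -
  obtain M C where C: "C \<ge> 0" "\<And>f B. f \<in> schwartz \<Longrightarrow> schwartz_bound M B f \<Longrightarrow> schwartz_bound N (C * B) (fourier (f :: real^'n \<Rightarrow> complex))"
    using fourier_schwartz_bound[of N] by blast
  have "schwartz_bound N ((2 ^ N * 2 ^ N * C) * B) (inv_fourier f)" if "f \<in> schwartz" "schwartz_bound M B f" for B and f :: "real^'n \<Rightarrow> complex"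
    using schwartz_bound_affine[OF schwartz_smooth[OF schwartz_fourier[OF that(1)]] C(2)[OF that], of "-1" 0]
    unfolding inv_fourier_eq_affine by (simp add: mult.assoc)
  moreover have "2 ^ N * 2 ^ N * C \<ge> 0" using C by simp
  ultimately show ?thesis by blast
qed

section \<open>Fourier inversion\<close>

definition gaussian :: "real^'n::finite \<Rightarrow> complex" where
  "gaussian x = complex_of_real (exp (- pi * (norm x)\<^sup>2))"

lemma norm_gaussian_le: "norm (gaussian x) \<le> 1"
  by (simp add: gaussian_def)

lemma gaussian_prod: "gaussian x = (\<Prod>i\<in>UNIV. complex_of_real (exp (- pi * (x $ i)\<^sup>2)))"
proof -
  have "(norm x)\<^sup>2 = (\<Sum>i\<in>UNIV. (x $ i)\<^sup>2)"
    by (simp add: norm_vec_def L2_set_def sum_nonneg)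
  then have "exp (- pi * (norm x)\<^sup>2) = (\<Prod>i\<in>UNIV. exp (- pi * (x $ i)\<^sup>2))"
    by (simp add: exp_sum[symmetric] sum_distrib_left sum_negf)
  then show ?thesis by (simp add: gaussian_def)
qed

lemma gaussian_measurable [measurable]: "gaussian \<in> borel_measurable borel"
  unfolding gaussian_def by measurable

text \<open>The one-dimensional Gaussian integral is the characteristic function of the standard normal
  distribution after rescaling by \<open>sqrt (2 * pi)\<close>.\<close>

lemma
  shows integrable_gaussian_1d: "integrable lborel (\<lambda>x::real. complex_of_real (exp (- pi * x\<^sup>2)))"
    and gaussian_fourier_1d: "(LINT x|lborel. complex_of_real (exp (- pi * x\<^sup>2)) * exp (2 * pi * \<i> * complex_of_real (x * s))) = complex_of_real (exp (- pi * s\<^sup>2))"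
proof -
  let ?r = "sqrt (2 * pi)"
  have r: "?r > 0" "?r \<noteq> 0" "?r * ?r = 2 * pi" by auto
  have dens: "std_normal_density (0 + ?r * x) = exp (- pi * x\<^sup>2) / ?r" for x
    by (simp add: normal_density_def power_mult_distrib)
  have "integrable lborel (\<lambda>x. std_normal_density (0 + ?r * x))"
    using integrable_std_normal_moment[of 0] by (intro lborel_integrable_real_affine) (auto)
  then have "integrable lborel (\<lambda>x. exp (- pi * x\<^sup>2) / ?r * ?r)"
    unfolding dens by (rule integrable_mult_left)
  then have "integrable lborel (\<lambda>x. exp (- pi * x\<^sup>2))" using r by simp
  then show "integrable lborel (\<lambda>x::real. complex_of_real (exp (- pi * x\<^sup>2)))"
    by (rule integrable_of_real)
  have "complex_of_real (exp (- ((?r * s)\<^sup>2) / 2)) = char std_normal_distribution (?r * s)"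
    by (simp add: char_std_normal_distribution)
  also have "\<dots> = (LINT x|lborel. std_normal_density x *\<^sub>R exp (\<i> * complex_of_real (?r * s * x)))"
    unfolding char_def by (subst integral_density) (auto simp: normal_density_nonneg)
  also have "\<dots> = \<bar>?r\<bar> *\<^sub>R (LINT x|lborel. std_normal_density (0 + ?r * x) *\<^sub>R exp (\<i> * complex_of_real (?r * s * (0 + ?r * x))))"
    by (rule lborel_integral_real_affine[OF r(2)])
  also have "\<dots> = (LINT x|lborel. \<bar>?r\<bar> *\<^sub>R (std_normal_density (0 + ?r * x) *\<^sub>R exp (\<i> * complex_of_real (?r * s * (0 + ?r * x)))))"
    by (rule integral_scaleR_right[symmetric])
  also have "\<dots> = (LINT x|lborel. complex_of_real (exp (- pi * x\<^sup>2)) * exp (2 * pi * \<i> * complex_of_real (x * s)))"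
  proof (rule Bochner_Integration.integral_cong[OF refl])
    fix x :: real
    have e: "?r * s * (0 + ?r * x) = 2 * pi * (x * s)" using r(3) by (simp add: mult_ac)
    have "\<bar>?r\<bar> * (exp (- pi * x\<^sup>2) / ?r) = exp (- pi * x\<^sup>2)" using r(1) by simp
    then show "\<bar>?r\<bar> *\<^sub>R (std_normal_density (0 + ?r * x) *\<^sub>R exp (\<i> * complex_of_real (?r * s * (0 + ?r * x)))) =
       complex_of_real (exp (- pi * x\<^sup>2)) * exp (2 * pi * \<i> * complex_of_real (x * s))"
      unfolding e dens scaleR_scaleR by (simp add: scaleR_conv_of_real mult_ac)
  qed
  finally show "(LINT x|lborel. complex_of_real (exp (- pi * x\<^sup>2)) * exp (2 * pi * \<i> * complex_of_real (x * s))) = complex_of_real (exp (- pi * s\<^sup>2))"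
    by (simp add: power_mult_distrib)
qed

lemma integrable_gaussian: "integrable lborel (gaussian :: real^'n::finite \<Rightarrow> complex)"
  using integrable_lborel_prod_coord[where f="\<lambda>(i::'n) x. complex_of_real (exp (- pi * x\<^sup>2))", OF integrable_gaussian_1d]
  by (simp add: gaussian_prod[abs_def])

lemma gaussian_fourier: "(LINT \<xi>|lborel. gaussian \<xi> * wave x \<xi>) = gaussian (x :: real^'n::finite)"
proof -
  have w: "wave x \<xi> = (\<Prod>i\<in>UNIV. exp (2 * pi * \<i> * complex_of_real (\<xi> $ i * x $ i)))" for \<xi>
    by (simp add: wave_def inner_vec_def exp_sum[symmetric] sum_distrib_left)
  have int: "integrable lborel (\<lambda>t. complex_of_real (exp (- pi * t\<^sup>2)) * exp (2 * pi * \<i> * complex_of_real (t * s)))" for s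
    by (rule Bochner_Integration.integrable_bound[OF integrable_gaussian_1d]) (auto simp: norm_mult norm_exp_eq_Re)
  have "(LINT \<xi>|lborel. gaussian \<xi> * wave x \<xi>) =
    (LINT \<xi>|lborel. (\<Prod>i\<in>UNIV. complex_of_real (exp (- pi * (\<xi> $ i)\<^sup>2)) * exp (2 * pi * \<i> * complex_of_real (\<xi> $ i * x $ i))))"
    by (simp add: gaussian_prod w prod.distrib)
  also have "\<dots> = (\<Prod>i\<in>UNIV. complex_of_real (exp (- pi * (x $ i)\<^sup>2)))"
    by (subst integral_lborel_prod_coord[where f="\<lambda>i t. complex_of_real (exp (- pi * t\<^sup>2)) * exp (2 * pi * \<i> * complex_of_real (t * x $ i))"])
       (simp_all only: int gaussian_fourier_1d)
  finally show ?thesis by (simp add: gaussian_prod)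
qed

text \<open>Insert the factor \<open>gaussian (\<epsilon> \<xi>)\<close> into the inversion integral: by Fubini the regularised
  integral is the average of \<open>f (x + \<epsilon> z)\<close> against the Gaussian, which has mass one; then let
  \<open>\<epsilon>\<close> tend to zero on both sides.\<close>

theorem inv_fourier_fourier:
  fixes f :: "real^'n::finite \<Rightarrow> complex"
  assumes f: "f \<in> schwartz"
  shows "inv_fourier (fourier f) = f"
proof
  fix x
  define e where "e m = 1 / real (Suc m)" for m
  have e: "0 < e m" for m by (simp add: e_def)
  have e0: "e \<longlonglongrightarrow> 0" unfolding e_def using LIMSEQ_inverse_real_of_nat by (simp add: inverse_eq_divide)
  have [measurable]: "f \<in> borel_measurable borel" "fourier f \<in> borel_measurable borel"
    using schwartz_measurable f schwartz_fourier by blast+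
  have int_f: "integrable lborel f" "integrable lborel (fourier f)"
    using schwartz_integrable f schwartz_fourier by blast+
  have int_ge: "integrable lborel (\<lambda>\<xi>::real^'n. gaussian (e m *\<^sub>R \<xi>))" for m
    using integrable_affine_iff[of "e m" "gaussian :: real^'n \<Rightarrow> complex" 0] e[of m] integrable_gaussian[where 'n='n] by simp
  define J where "J m = (LINT \<xi>|lborel. fourier f \<xi> * wave x \<xi> * gaussian (e m *\<^sub>R \<xi>))" for m
  have gc: "isCont gaussian (y :: real^'n)" for y unfolding gaussian_def by (intro continuous_intros)
  have lim1: "J \<longlonglongrightarrow> (LINT \<xi>|lborel. fourier f \<xi> * wave x \<xi>)"
    unfolding J_def
  proof (rule integral_dominated_convergence)
    show "integrable lborel (\<lambda>\<xi>. norm (fourier f \<xi>))" using int_f by simp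
    show "AE \<xi> in lborel. (\<lambda>m. fourier f \<xi> * wave x \<xi> * gaussian (e m *\<^sub>R \<xi>)) \<longlonglongrightarrow> fourier f \<xi> * wave x \<xi>"
    proof (intro AE_I2)
      fix \<xi> :: "real^'n"
      have "(\<lambda>m. e m *\<^sub>R \<xi>) \<longlonglongrightarrow> 0 *\<^sub>R \<xi>" by (intro tendsto_intros e0)
      then have "(\<lambda>m. gaussian (e m *\<^sub>R \<xi>)) \<longlonglongrightarrow> gaussian (0 *\<^sub>R \<xi>)" by (rule isCont_tendsto_compose[OF gc])
      from tendsto_mult_left[OF this, of "fourier f \<xi> * wave x \<xi>"]
      show "(\<lambda>m. fourier f \<xi> * wave x \<xi> * gaussian (e m *\<^sub>R \<xi>)) \<longlonglongrightarrow> fourier f \<xi> * wave x \<xi>"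
        by (simp add: gaussian_def)
    qed
    show "AE \<xi> in lborel. norm (fourier f \<xi> * wave x \<xi> * gaussian (e m *\<^sub>R \<xi>)) \<le> norm (fourier f \<xi>)" for m
      by (intro AE_I2) (simp add: norm_mult mult_left_le norm_gaussian_le)
  qed measurable
  have Jeq: "J m = (LINT z|lborel. f (x + e m *\<^sub>R z) * gaussian z)" for m
  proof -
    have "J m = (LINT \<xi>|lborel. LINT y|lborel. f y * gaussian (e m *\<^sub>R \<xi>) * wave (x - y) \<xi>)"
    proof -
      have "fourier f \<xi> * wave x \<xi> * gaussian (e m *\<^sub>R \<xi>) = (LINT y|lborel. f y * gaussian (e m *\<^sub>R \<xi>) * wave (x - y) \<xi>)" for \<xi>
      proof -
        have "wave (x - y) \<xi> = wave (- \<xi>) y * wave x \<xi>" for y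
          using wave_add[of x "- y" \<xi>] wave_commute[of "-y" \<xi>] wave_neg_swap[of \<xi> y] by simp
        then have "(LINT y|lborel. f y * gaussian (e m *\<^sub>R \<xi>) * wave (x - y) \<xi>) = (LINT y|lborel. (f y * wave (- \<xi>) y) * (wave x \<xi> * gaussian (e m *\<^sub>R \<xi>)))"
          by (simp add: mult_ac)
        also have "\<dots> = fourier f \<xi> * (wave x \<xi> * gaussian (e m *\<^sub>R \<xi>))" unfolding fourier_wave by (rule integral_mult_left_zero)
        finally show ?thesis by simp
      qed
      then show ?thesis by (simp add: J_def)
    qed
    also have "\<dots> = (LINT y|lborel. LINT \<xi>|lborel. f y * gaussian (e m *\<^sub>R \<xi>) * wave (x - y) \<xi>)"
      by (rule fubini_bounded_kernel[OF int_f(1) int_ge, symmetric]) auto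
    also have "\<dots> = (LINT y|lborel. f y * ((1 / e m) ^ CARD('n) *\<^sub>R gaussian ((1 / e m) *\<^sub>R (x - y))))"
    proof -
      have "(LINT \<xi>|lborel. gaussian (e m *\<^sub>R \<xi>) * wave (x - y) \<xi>) = (1 / e m) ^ CARD('n) *\<^sub>R gaussian ((1 / e m) *\<^sub>R (x - y))" for y
        using integral_affine[of "1 / e m" "\<lambda>\<xi>. gaussian (e m *\<^sub>R \<xi>) * wave (x - y) \<xi>" 0] e[of m]
          gaussian_fourier[of "(1 / e m) *\<^sub>R (x - y)"] by (simp add: wave_scaleR)
      then show ?thesis by (simp only: mult.assoc integral_mult_right_zero)
    qed
    also have "\<dots> = \<bar>e m\<bar> ^ DIM(real^'n) *\<^sub>R (LINT z|lborel. f (x + e m *\<^sub>R z) * ((1 / e m) ^ CARD('n) *\<^sub>R gaussian ((1 / e m) *\<^sub>R (x - (x + e m *\<^sub>R z)))))"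
      using e[of m] by (intro integral_affine) auto
    also have "\<dots> = (LINT z|lborel. \<bar>e m\<bar> ^ DIM(real^'n) *\<^sub>R (f (x + e m *\<^sub>R z) * ((1 / e m) ^ CARD('n) *\<^sub>R gaussian ((1 / e m) *\<^sub>R (x - (x + e m *\<^sub>R z))))))"
      by (rule integral_scaleR_right[symmetric])
    also have "\<dots> = (LINT z|lborel. f (x + e m *\<^sub>R z) * gaussian z)"
    proof (rule Bochner_Integration.integral_cong[OF refl])
      fix z :: "real^'n"
      have 1: "gaussian ((1 / e m) *\<^sub>R (x - (x + e m *\<^sub>R z))) = gaussian z" using e[of m] by (simp add: gaussian_def)
      have 2: "\<bar>e m\<bar> ^ DIM(real^'n) * (1 / e m) ^ CARD('n) = 1" using e[of m] by (simp add: power_divide)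
      show "\<bar>e m\<bar> ^ DIM(real^'n) *\<^sub>R (f (x + e m *\<^sub>R z) * ((1 / e m) ^ CARD('n) *\<^sub>R gaussian ((1 / e m) *\<^sub>R (x - (x + e m *\<^sub>R z))))) = f (x + e m *\<^sub>R z) * gaussian z"
        unfolding 1 mult_scaleR_right scaleR_scaleR 2 by simp
    qed
    finally show ?thesis .
  qed
  obtain A where A: "\<And>y. norm (f y) \<le> A"
    by (rule schwartz_bounded[OF f]) blast
  have "J \<longlonglongrightarrow> (LINT z|lborel. f x * gaussian (z :: real^'n))"
    unfolding Jeq
  proof (rule integral_dominated_convergence)
    show "integrable lborel (\<lambda>z::real^'n. A * norm (gaussian z))" by (intro integrable_mult_right integrable_norm integrable_gaussian)
    show "AE z in lborel. (\<lambda>m. f (x + e m *\<^sub>R z) * gaussian z) \<longlonglongrightarrow> f x * gaussian z"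
    proof (intro AE_I2 tendsto_mult_right)
      fix z :: "real^'n"
      have c: "isCont f x" using smooth_imp_continuous_on[OF schwartz_smooth[OF f], of UNIV] by (simp add: continuous_on_eq_continuous_at)
      have "(\<lambda>m. x + e m *\<^sub>R z) \<longlonglongrightarrow> x + 0 *\<^sub>R z" by (intro tendsto_intros e0)
      then have "(\<lambda>m. x + e m *\<^sub>R z) \<longlonglongrightarrow> x" by simp
      then show "(\<lambda>m. f (x + e m *\<^sub>R z)) \<longlonglongrightarrow> f x" by (rule isCont_tendsto_compose[OF c])
    qed
    show "AE z in lborel. norm (f (x + e m *\<^sub>R z) * gaussian z) \<le> A * norm (gaussian z)" for m
      using A by (intro AE_I2) (simp add: norm_mult mult_right_mono)
  qed measurable
  moreover have "(LINT z|lborel. f x * gaussian (z :: real^'n)) = f x"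
    using gaussian_fourier[of "0::real^'n"] by (simp add: gaussian_def[of 0])
  ultimately show "inv_fourier (fourier f) x = f x"
    using lim1 LIMSEQ_unique unfolding inv_fourier_wave by metis
qed

theorem fourier_inv_fourier:
  fixes f :: "real^'n::finite \<Rightarrow> complex"
  assumes f: "f \<in> schwartz"
  shows "fourier (inv_fourier f) = f"
proof
  fix x
  have "fourier (inv_fourier f) x = inv_fourier (inv_fourier f) (- x)" by (simp add: inv_fourier_eq)
  also have "\<dots> = fourier (\<lambda>y. inv_fourier f (- y)) (- x)" by (rule inv_fourier_reflect)
  also have "\<dots> = inv_fourier (fourier f) x" by (simp add: inv_fourier_eq)
  finally show "fourier (inv_fourier f) x = f x" by (simp add: inv_fourier_fourier[OF f])
qed

section \<open>Lattice sums\<close>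

lemma sum_int_vec_box:
  fixes f :: "int \<Rightarrow> real"
  assumes "finite A"
  shows "finite {k :: int^'n::finite. \<forall>i. k $ i \<in> A}"
    and "(\<Sum>k\<in>{k :: int^'n. \<forall>i. k $ i \<in> A}. \<Prod>i\<in>UNIV. f (k $ i)) = (\<Sum>m\<in>A. f m) ^ CARD('n)"
proof -
  have bij: "bij_betw vec_lambda (PiE (UNIV :: 'n set) (\<lambda>_. A)) {k :: int^'n. \<forall>i. k $ i \<in> A}"
    by (rule bij_betwI[where g=vec_nth]) (auto simp: vec_eq_iff PiE_def extensional_def)
  have fin: "finite (PiE (UNIV :: 'n set) (\<lambda>_. A))" by (intro finite_PiE) (auto simp: assms)
  show "finite {k :: int^'n::finite. \<forall>i. k $ i \<in> A}" using bij_betw_finite[OF bij] fin by simp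
  have "(\<Sum>k\<in>{k :: int^'n. \<forall>i. k $ i \<in> A}. \<Prod>i\<in>UNIV. f (k $ i)) = (\<Sum>g\<in>PiE (UNIV :: 'n set) (\<lambda>_. A). \<Prod>i\<in>UNIV. f (g i))"
    using sum.reindex_bij_betw[OF bij, of "\<lambda>k. \<Prod>i\<in>UNIV. f (k $ i)"] by simp
  also have "\<dots> = (\<Prod>i\<in>(UNIV::'n set). \<Sum>m\<in>A. f m)"
    by (subst prod_sum_PiE) (auto simp: assms)
  also have "\<dots> = (\<Sum>m\<in>A. f m) ^ CARD('n)" by simp
  finally show "(\<Sum>k\<in>{k :: int^'n. \<forall>i. k $ i \<in> A}. \<Prod>i\<in>UNIV. f (k $ i)) = (\<Sum>m\<in>A. f m) ^ CARD('n)" .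
qed

lemma card_int_vec_box:
  assumes "finite A"
  shows "card {k :: int^'n::finite. \<forall>i. k $ i \<in> A} = card A ^ CARD('n)"
proof -
  have "real (card {k :: int^'n::finite. \<forall>i. k $ i \<in> A}) = real (card A) ^ CARD('n)"
    using sum_int_vec_box(2)[OF assms, of "\<lambda>_. 1", where 'n='n] by simp
  then show ?thesis by (metis of_nat_eq_iff of_nat_power)
qed

lemma abs_lattice_pt_le: "\<bar>real_of_int (k $ i)\<bar> \<le> norm (lattice_pt k)"
  using component_le_norm_cart[of "lattice_pt k" i] by (simp add: lattice_pt_def)

lemma lattice_ball_subset:
  "{k :: int^'n::finite. norm (lattice_pt k) \<le> R} \<subseteq> {k. \<forall>i. k $ i \<in> {-\<lfloor>R\<rfloor>..\<lfloor>R\<rfloor>}}"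
proof safe
  fix k :: "int^'n" and i assume "norm (lattice_pt k) \<le> R"
  then have "real_of_int \<bar>k $ i\<bar> \<le> R" using abs_lattice_pt_le[of k i] by simp
  then have "\<bar>k $ i\<bar> \<le> \<lfloor>R\<rfloor>" by (simp add: le_floor_iff)
  then show "k $ i \<in> {-\<lfloor>R\<rfloor>..\<lfloor>R\<rfloor>}" by auto
qed

lemma finite_lattice_ball: "finite {k :: int^'n::finite. norm (lattice_pt k) \<le> R}"
  by (rule finite_subset[OF lattice_ball_subset sum_int_vec_box(1)]) simp

lemma card_lattice_ball:
  assumes "0 \<le> R"
  shows "real (card {k :: int^'n::finite. norm (lattice_pt k) \<le> R}) \<le> (2 * R + 1) ^ CARD('n)"
proof -
  let ?A = "{-\<lfloor>R\<rfloor>..\<lfloor>R\<rfloor>}"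
  have "card {k :: int^'n::finite. norm (lattice_pt k) \<le> R} \<le> card ?A ^ CARD('n)"
    using card_mono[OF sum_int_vec_box(1) lattice_ball_subset[of R]]
    unfolding card_int_vec_box[OF finite_atLeastAtMost_int] by simp
  then have "real (card {k :: int^'n::finite. norm (lattice_pt k) \<le> R}) \<le> real (card ?A) ^ CARD('n)"
    by (metis of_nat_le_iff of_nat_power)
  also have "\<dots> \<le> (2 * R + 1) ^ CARD('n)"
  proof (intro power_mono)
    have "real_of_int \<lfloor>R\<rfloor> \<le> R" "0 \<le> \<lfloor>R\<rfloor>" using assms by auto
    then show "real (card ?A) \<le> 2 * R + 1" by simp
  qed simp
  finally show ?thesis .
qed

lemma japanese_ge_1: "1 \<le> japanese x" and japanese_pos: "0 < japanese x"
  and norm_le_japanese: "norm x \<le> japanese x" and japanese_le: "japanese x \<le> 1 + norm x"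
  unfolding japanese_def
proof -
  show "1 \<le> sqrt (1 + (norm x)\<^sup>2)" by simp
  then show "0 < sqrt (1 + (norm x)\<^sup>2)" by linarith
  show "norm x \<le> sqrt (1 + (norm x)\<^sup>2)" by (rule real_le_rsqrt) simp
  show "sqrt (1 + (norm x)\<^sup>2) \<le> 1 + norm x" by (rule real_le_lsqrt) (auto simp: power2_sum)
qed

text \<open>Peetre's inequality: brackets at points of bounded distance are comparable.\<close>

lemma japanese_le_mult: "japanese x \<le> (1 + norm (x - y)) * japanese y"
proof -
  have "japanese x \<le> japanese y + norm (x - y)"
  proof -
    have "norm x \<le> norm y + norm (x - y)" using norm_triangle_sub[of x y] by simp
    then have "(norm x)\<^sup>2 \<le> (norm y + norm (x - y))\<^sup>2" by (intro power_mono) auto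
    moreover have "2 * (norm y * norm (x - y)) \<le> 2 * (japanese y * norm (x - y))"
      using norm_le_japanese[of y] by (intro mult_left_mono mult_right_mono) auto
    moreover have "(japanese y)\<^sup>2 = 1 + (norm y)\<^sup>2" by (simp add: japanese_def add_nonneg_nonneg)
    ultimately have "1 + (norm x)\<^sup>2 \<le> (japanese y + norm (x - y))\<^sup>2" by (simp add: power2_sum mult.assoc)
    then show ?thesis unfolding japanese_def[of x] using japanese_pos[of y] by (intro real_le_lsqrt) auto
  qed
  also have "\<dots> \<le> japanese y + norm (x - y) * japanese y"
    using japanese_ge_1[of y] mult_left_mono[of 1 "japanese y" "norm (x - y)"] by simp
  finally show ?thesis by (simp add: algebra_simps)
qed

abbreviation jap :: "int^'n::finite \<Rightarrow> real" where "jap k \<equiv> japanese (lattice_pt k)"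

text \<open>Convergence follows by comparison with the product of one-dimensional series, since
  \<open>(\<Prod>i. 1 + \<bar>k $ i\<bar>) \<le> (2 * jap k) ^ n\<close>.\<close>

lemma lattice_sum_converges:
  assumes t: "real CARD('n) < t"
  shows "\<exists>K. \<forall>F. finite F \<longrightarrow> (\<Sum>k\<in>F. jap (k :: int^'n::finite) powr (- t)) \<le> K"
proof -
  define u where "u = t / real CARD('n)"
  have n: "real CARD('n) > 0" by simp
  have u: "u > 1" using t n by (simp add: u_def)
  have tu: "t = real CARD('n) * u" using n by (simp add: u_def)
  define f where "f m = (1 + real_of_int \<bar>m\<bar>) powr (- u)" for m :: int
  define Z where "Z = (\<Sum>j. real (Suc j) powr (- u))"
  have sm: "summable (\<lambda>j. real (Suc j) powr (- u))"
    using u by (subst summable_Suc_iff) (simp add: summable_real_powr_iff)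
  have fsum: "(\<Sum>m\<in>{-int N..int N}. f m) \<le> 2 * Z" for N
  proof -
    have p: "(\<Sum>m\<in>int ` {..N}. f m) \<le> Z"
    proof -
      have "(\<Sum>m\<in>int ` {..N}. f m) = (\<Sum>j\<le>N. real (Suc j) powr (- u))"
        by (subst sum.reindex) (auto simp: f_def add.commute)
      also have "\<dots> \<le> Z" unfolding Z_def by (rule sum_le_suminf[OF sm]) auto
      finally show ?thesis .
    qed
    have n: "(\<Sum>m\<in>uminus ` int ` {..N}. f m) = (\<Sum>m\<in>int ` {..N}. f m)"
      by (subst sum.reindex) (auto simp: f_def)
    have sub: "{-int N..int N} \<subseteq> int ` {..N} \<union> uminus ` int ` {..N}"
    proof
      fix m assume m: "m \<in> {-int N..int N}"
      show "m \<in> int ` {..N} \<union> uminus ` int ` {..N}"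
      proof (cases "0 \<le> m")
        case True then have "m = int (nat m)" "nat m \<le> N" using m by auto
        then show ?thesis by blast
      next
        case False then have "m = - int (nat (- m))" "nat (- m) \<le> N" using m by auto
        then show ?thesis by blast
      qed
    qed
    have "(\<Sum>m\<in>{-int N..int N}. f m) \<le> (\<Sum>m\<in>int ` {..N} \<union> uminus ` int ` {..N}. f m)"
      by (rule sum_mono2[OF _ sub]) (auto simp: f_def)
    also have "\<dots> \<le> (\<Sum>m\<in>int ` {..N}. f m) + (\<Sum>m\<in>uminus ` int ` {..N}. f m)"
      by (subst sum.union_inter[symmetric]) (auto intro!: sum_nonneg simp: f_def)
    finally show ?thesis using p n by simp
  qed
  have summand: "jap k powr (- t) \<le> 2 powr t * (\<Prod>i\<in>UNIV. f (k $ i))" for k :: "int^'n"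
  proof -
    have "(\<Prod>i\<in>UNIV. 1 + real_of_int \<bar>k $ i\<bar>) \<le> (\<Prod>i\<in>(UNIV::'n set). 2 * jap k)"
    proof (intro prod_mono conjI)
      fix i show "1 + real_of_int \<bar>k $ i\<bar> \<le> 2 * jap k"
        using abs_lattice_pt_le[of k i] norm_le_japanese[of "lattice_pt k"] japanese_ge_1[of "lattice_pt k"] by simp
    qed auto
    then have le: "(\<Prod>i\<in>UNIV. 1 + real_of_int \<bar>k $ i\<bar>) \<le> (2 * jap k) ^ CARD('n)" by simp
    have pos: "0 < (\<Prod>i\<in>UNIV. 1 + real_of_int \<bar>k $ i\<bar>)" by (intro prod_pos) auto
    have "(2 * jap k) powr (- t) = ((2 * jap k) ^ CARD('n)) powr (- u)"
    proof -
      have "x powr (- t) = (x ^ CARD('n)) powr (- u)" if "0 < x" for x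
        using that by (simp add: powr_realpow[symmetric] powr_powr tu)
      then show ?thesis using japanese_pos[of "lattice_pt k"] by simp
    qed
    also have "\<dots> \<le> (\<Prod>i\<in>UNIV. 1 + real_of_int \<bar>k $ i\<bar>) powr (- u)"
      using u by (intro powr_mono2' le pos) auto
    also have "\<dots> = (\<Prod>i\<in>UNIV. f (k $ i))"
      unfolding f_def by (rule prod_powr_distrib)
    finally have "2 powr t * ((2 * jap k) powr (- t)) \<le> 2 powr t * (\<Prod>i\<in>UNIV. f (k $ i))"
      by (intro mult_left_mono) auto
    moreover have "2 powr t * ((2 * jap k) powr (- t)) = jap k powr (- t)"
      using japanese_pos[of "lattice_pt k"] by (simp add: powr_mult powr_minus)
    ultimately show ?thesis by simp
  qed
  have "(\<Sum>k\<in>F. jap k powr (- t)) \<le> 2 powr t * (2 * Z) ^ CARD('n)" if F: "finite F" for F :: "(int^'n) set"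
  proof -
    obtain N :: nat where N: "\<And>k i. k \<in> F \<Longrightarrow> \<bar>k $ i\<bar> \<le> int N"
    proof -
      let ?S = "\<Sum>k\<in>F. \<Sum>i\<in>UNIV. \<bar>k $ i\<bar>"
      have "\<bar>k $ i\<bar> \<le> int (nat ?S)" if "k \<in> F" for k i
      proof -
        have "\<bar>k $ i\<bar> \<le> (\<Sum>i\<in>UNIV. \<bar>k $ i\<bar>)" by (rule member_le_sum) auto
        also have "\<dots> \<le> ?S" using that F by (intro member_le_sum[of k F "\<lambda>k. \<Sum>i\<in>UNIV. \<bar>k $ i\<bar>"]) (auto intro: sum_nonneg)
        finally have "\<bar>k $ i\<bar> \<le> ?S" .
        then show ?thesis using abs_ge_zero[of "k $ i"] by linarith
      qed
      then show ?thesis by (rule that)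
    qed
    let ?Q = "{k :: int^'n. \<forall>i. k $ i \<in> {-int N..int N}}"
    have sub: "F \<subseteq> ?Q"
    proof (intro subsetI CollectI allI)
      fix k i assume "k \<in> F"
      then show "k $ i \<in> {-int N..int N}" using N[of k i] unfolding abs_le_iff atLeastAtMost_iff by linarith
    qed
    have "(\<Sum>k\<in>F. jap k powr (- t)) \<le> (\<Sum>k\<in>?Q. jap k powr (- t))"
      by (intro sum_mono2 sub sum_int_vec_box(1)) auto
    also have "\<dots> \<le> (\<Sum>k\<in>?Q. 2 powr t * (\<Prod>i\<in>UNIV. f (k $ i)))" by (intro sum_mono summand)
    also have "\<dots> = 2 powr t * (\<Sum>m\<in>{-int N..int N}. f m) ^ CARD('n)"
      by (subst sum_int_vec_box(2)[symmetric]) (auto simp: sum_distrib_left)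
    also have "\<dots> \<le> 2 powr t * (2 * Z) ^ CARD('n)"
      using fsum[of N] by (intro mult_left_mono power_mono) (auto intro: sum_nonneg simp: f_def)
    finally show ?thesis .
  qed
  then show ?thesis by blast
qed

text \<open>The dyadic cubes \<open>[2\<^sup>j, 2\<^bsup>j + 1\<^esup>)\<^sup>n\<close> each contribute at least a fixed amount to the critical sum.\<close>

lemma lattice_sum_diverges:
  fixes D :: int
  assumes t: "t \<le> real CARD('n)" and D: "1 \<le> D"
  shows "\<exists>G. finite G \<and> K \<le> (\<Sum>k\<in>G. jap (\<chi> i. D * k $ i :: int^'n::finite) powr (- t))"
proof -
  let ?n = "CARD('n)"
  define c where "c = (real_of_int D * (2 * real ?n + 1)) powr (- real ?n)"
  have c: "c > 0" using D by (simp add: c_def add_nonneg_pos)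
  define Q where "Q j = {k :: int^'n. \<forall>i. k $ i \<in> {2^j..<2^(Suc j)}}" for j :: nat
  have finQ: "finite (Q j)" for j unfolding Q_def by (rule sum_int_vec_box) simp
  have cardQ: "card (Q j) = (2 ^ j) ^ ?n" for j
  proof -
    have "card {(2::int)^j..<2^(Suc j)} = 2 ^ j" by (simp add: nat_power_eq)
    then show ?thesis unfolding Q_def by (simp only: card_int_vec_box[OF finite_atLeastLessThan_int])
  qed
  have summand: "c * (2 powr (- real ?n)) ^ j \<le> jap (\<chi> i. D * k $ i :: int^'n) powr (- t)" if "k \<in> Q j" for j k
  proof -
    let ?Dk = "\<chi> i. D * k $ i :: int^'n"
    have comp: "\<bar>lattice_pt ?Dk $ i\<bar> \<le> real_of_int D * (2 * 2 ^ j)" for i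
    proof -
      have "k $ i \<in> {2^j..<2^(Suc j)}" using that by (simp add: Q_def)
      then have "2 ^ j \<le> k $ i" "k $ i \<le> 2 * 2 ^ j" by auto
      then have "\<bar>k $ i\<bar> \<le> 2 * 2 ^ j" using zero_le_power[of "2::int" j] by linarith
      then have "\<bar>D * k $ i\<bar> \<le> D * (2 * 2 ^ j)" using D by (simp add: abs_mult)
      then have "real_of_int \<bar>D * k $ i\<bar> \<le> real_of_int (D * (2 * 2 ^ j))" by (simp only: of_int_le_iff)
      then show ?thesis by (simp add: lattice_pt_def)
    qed
    have "jap ?Dk \<le> 1 + norm (lattice_pt ?Dk)" by (rule japanese_le)
    also have "norm (lattice_pt ?Dk) \<le> (\<Sum>i\<in>UNIV. \<bar>lattice_pt ?Dk $ i\<bar>)" by (rule norm_le_l1_cart)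
    also have "\<dots> \<le> (\<Sum>i\<in>(UNIV::'n set). real_of_int D * (2 * 2 ^ j))" by (intro sum_mono comp)
    also have "\<dots> = real ?n * (real_of_int D * (2 * 2 ^ j))" by simp
    finally have "jap ?Dk \<le> 1 + real ?n * (real_of_int D * (2 * 2 ^ j))" by simp
    moreover have "1 \<le> real_of_int D * 2 ^ j"
    proof -
      have "1 * 1 \<le> real_of_int D * 2 ^ j" using D by (intro mult_mono) auto
      then show ?thesis by simp
    qed
    ultimately have J: "jap ?Dk \<le> (real_of_int D * (2 * real ?n + 1)) * 2 ^ j" by (simp add: algebra_simps)
    have "c * (2 powr (- real ?n)) ^ j = ((real_of_int D * (2 * real ?n + 1)) * 2 ^ j) powr (- real ?n)"
    proof -
      have "(2 powr (- real ?n)) ^ j = (2 ^ j) powr (- real ?n)"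
        by (simp add: powr_realpow[symmetric] powr_powr mult.commute)
      then show ?thesis unfolding c_def using D by (subst powr_mult) (auto simp: add_nonneg_nonneg)
    qed
    also have "\<dots> \<le> jap ?Dk powr (- real ?n)"
      using J japanese_pos by (intro powr_mono2') auto
    also have "\<dots> \<le> jap ?Dk powr (- t)" using t japanese_ge_1 by (intro powr_mono) auto
    finally show ?thesis .
  qed
  have shell: "c \<le> (\<Sum>k\<in>Q j. jap (\<chi> i. D * k $ i :: int^'n) powr (- t))" for j
  proof -
    have "c = (\<Sum>k\<in>Q j. c * (2 powr (- real ?n)) ^ j)"
    proof -
      have "real (card (Q j)) * (2 powr (- real ?n)) ^ j = 1"
        by (simp add: cardQ powr_minus powr_realpow power_inverse power_mult[symmetric] mult.commute[of ?n])
      then show ?thesis by simp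
    qed
    also have "\<dots> \<le> (\<Sum>k\<in>Q j. jap (\<chi> i. D * k $ i :: int^'n) powr (- t))" by (intro sum_mono summand)
    finally show ?thesis .
  qed
  have disj: "Q i \<inter> Q j = {}" if "i \<noteq> j" for i j
  proof -
    have *: "Q i \<inter> Q j = {}" if "i < j" for i j
    proof (rule ccontr)
      assume "Q i \<inter> Q j \<noteq> {}"
      then obtain k where k: "k \<in> Q i" "k \<in> Q j" by blast
      have "k $ undefined < 2 ^ Suc i" "2 ^ j \<le> k $ undefined" using k unfolding Q_def by force+
      moreover have "(2::int) ^ Suc i \<le> 2 ^ j" using that by (intro power_increasing) auto
      ultimately show False by linarith
    qed
    show ?thesis using *[of i j] *[of j i] that by (metis inf_commute linorder_neqE_nat)
  qed
  obtain J :: nat where J: "K \<le> real J * c" using reals_Archimedean3[OF c] by (metis less_imp_le)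
  have "K \<le> (\<Sum>j<J. c)" using J by simp
  also have "\<dots> \<le> (\<Sum>j<J. \<Sum>k\<in>Q j. jap (\<chi> i. D * k $ i :: int^'n) powr (- t))" by (intro sum_mono shell)
  also have "\<dots> = (\<Sum>k\<in>(\<Union>j<J. Q j). jap (\<chi> i. D * k $ i :: int^'n) powr (- t))"
    using disj finQ by (subst sum.UNION_disjoint) auto
  finally show ?thesis using finQ by (intro exI[of _ "\<Union>j<J. Q j"]) auto
qed

lemma lattice_unbounded: "\<exists>k :: int^'n::finite. R \<le> jap k"
proof -
  have "R \<le> real_of_int \<lceil>R\<rceil>" by simp
  also have "\<dots> \<le> jap (\<chi> i. \<lceil>R\<rceil> :: int^'n)"
    using abs_lattice_pt_le[of "\<chi> i. \<lceil>R\<rceil> :: int^'n" undefined] norm_le_japanese[of "lattice_pt (\<chi> i. \<lceil>R\<rceil> :: int^'n)"]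
    by simp
  finally show ?thesis by blast
qed

section \<open>Geometry of the \<open>\<alpha>\<close>-covering\<close>

lemma alpha_radius_ge_1: "0 \<le> \<alpha> \<Longrightarrow> \<alpha> < 1 \<Longrightarrow> 1 \<le> alpha_radius \<alpha> k"
  unfolding alpha_radius_def by (intro ge_one_powr_ge_zero japanese_ge_1) auto

lemma alpha_radius_mono:
  assumes "0 \<le> \<alpha>" "\<alpha> < 1" "norm (lattice_pt k) \<le> norm (lattice_pt l)"
  shows "alpha_radius \<alpha> k \<le> alpha_radius \<alpha> l"
  unfolding alpha_radius_def
proof (intro powr_mono2)
  show "jap k \<le> jap l" unfolding japanese_def using assms by (simp add: power_mono)
qed (use assms japanese_pos[of "lattice_pt k"] in auto)

text \<open>With \<open>A, B\<close> the radii at \<open>x, y\<close>, the identity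
  \<open>(A x - B y) \<bullet> (x - y) = (A + B) / 2 * |x - y|\<^sup>2 + (A - B) / 2 * (|x|\<^sup>2 - |y|\<^sup>2)\<close>
  and monotonicity of the radius in \<open>|x|\<close> show that the centres are spread out at the scale
  of the radii.\<close>

lemma alpha_center_separation:
  assumes "0 \<le> \<alpha>" "\<alpha> < 1"
  shows "(alpha_radius \<alpha> k + alpha_radius \<alpha> l) / 2 * norm (lattice_pt k - lattice_pt l)
     \<le> norm (alpha_center \<alpha> k - alpha_center \<alpha> l)"
proof (cases "lattice_pt k = lattice_pt l")
  case False
  define x y A B where "x = lattice_pt k" and "y = lattice_pt l" and "A = alpha_radius \<alpha> k" and "B = alpha_radius \<alpha> l"
  have "0 \<le> (A - B) * ((norm x)\<^sup>2 - (norm y)\<^sup>2)"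
  proof (cases "norm x \<le> norm y")
    case True
    then have "A \<le> B" "(norm x)\<^sup>2 \<le> (norm y)\<^sup>2"
      using alpha_radius_mono[OF assms, of k l] by (auto simp: x_def y_def A_def B_def power_mono)
    then show ?thesis by (intro mult_nonpos_nonpos) auto
  next
    case False
    then have "B \<le> A" "(norm y)\<^sup>2 \<le> (norm x)\<^sup>2"
      using alpha_radius_mono[OF assms, of l k] by (auto simp: x_def y_def A_def B_def power_mono)
    then show ?thesis by (intro mult_nonneg_nonneg) auto
  qed
  moreover have "(A *\<^sub>R x - B *\<^sub>R y) \<bullet> (x - y) = (A + B) / 2 * (norm (x - y))\<^sup>2 + (A - B) * ((norm x)\<^sup>2 - (norm y)\<^sup>2) / 2"
    unfolding power2_norm_eq_inner by (simp add: inner_diff_left inner_diff_right inner_commute[of y x] field_simps)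
  ultimately have "(A + B) / 2 * (norm (x - y))\<^sup>2 \<le> (A *\<^sub>R x - B *\<^sub>R y) \<bullet> (x - y)" by linarith
  also have "\<dots> \<le> norm (A *\<^sub>R x - B *\<^sub>R y) * norm (x - y)" by (rule norm_cauchy_schwarz)
  finally have "((A + B) / 2 * norm (x - y)) * norm (x - y) \<le> norm (A *\<^sub>R x - B *\<^sub>R y) * norm (x - y)"
    by (simp add: power2_eq_square mult.assoc)
  then have "(A + B) / 2 * norm (x - y) \<le> norm (A *\<^sub>R x - B *\<^sub>R y)"
    using False by (simp add: x_def y_def)
  then show ?thesis by (simp add: x_def y_def A_def B_def alpha_center_def)
qed simp

lemma alpha_center_near_imp_lattice_near:
  assumes "0 \<le> \<alpha>" "\<alpha> < 1" "norm (alpha_center \<alpha> k - alpha_center \<alpha> l) \<le> C * (alpha_radius \<alpha> k + alpha_radius \<alpha> l)"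
  shows "norm (lattice_pt k - lattice_pt l) \<le> 2 * C"
proof -
  have "0 < alpha_radius \<alpha> k + alpha_radius \<alpha> l"
    using alpha_radius_ge_1[OF assms(1,2), of k] alpha_radius_ge_1[OF assms(1,2), of l] by linarith
  moreover have "(alpha_radius \<alpha> k + alpha_radius \<alpha> l) * (norm (lattice_pt k - lattice_pt l) / 2) \<le> (alpha_radius \<alpha> k + alpha_radius \<alpha> l) * C"
    using alpha_center_separation[OF assms(1,2), of k l] assms(3) by (simp add: mult.commute)
  ultimately have "norm (lattice_pt k - lattice_pt l) / 2 \<le> C" by (simp only: mult_le_cancel_left_pos)
  then show ?thesis by simp
qed

lemma alpha_radius_le_mult:
  assumes "0 \<le> \<alpha>" "\<alpha> < 1" "norm (lattice_pt k - lattice_pt l) \<le> R"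
  shows "alpha_radius \<alpha> k \<le> (1 + R) powr (\<alpha> / (1 - \<alpha>)) * alpha_radius \<alpha> l"
proof -
  have R: "0 \<le> R" using assms(3) norm_ge_zero order_trans by blast
  have "jap k \<le> (1 + R) * jap l"
    using japanese_le_mult[of "lattice_pt k" "lattice_pt l"] assms(3) japanese_pos[of "lattice_pt l"]
    by (smt (verit) mult_right_mono)
  then have "jap k powr (\<alpha> / (1 - \<alpha>)) \<le> ((1 + R) * jap l) powr (\<alpha> / (1 - \<alpha>))"
    using assms japanese_pos[of "lattice_pt k"] by (intro powr_mono2) auto
  then show ?thesis unfolding alpha_radius_def using R japanese_pos[of "lattice_pt l"] by (subst (asm) powr_mult) auto
qed

lemma lattice_pt_diff: "lattice_pt k - lattice_pt l = lattice_pt (k - l)"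
  by (simp add: lattice_pt_def vec_eq_iff)

lemma finite_lattice_near: "finite {l :: int^'n::finite. norm (lattice_pt k - lattice_pt l) \<le> R}"
proof -
  have "{l. norm (lattice_pt k - lattice_pt l) \<le> R} = (\<lambda>d. k - d) ` {d. norm (lattice_pt d) \<le> R}"
    unfolding lattice_pt_diff by (force simp: image_iff intro!: exI[of _ "k - _"])
  then show ?thesis by (simp add: finite_lattice_ball)
qed

lemma card_lattice_near: "card {l. norm (lattice_pt k - lattice_pt l) \<le> R} \<le> card {d :: int^'n::finite. norm (lattice_pt d) \<le> R}"
  for k :: "int^'n"
proof -
  have "{l. norm (lattice_pt k - lattice_pt l) \<le> R} \<subseteq> (\<lambda>d. k - d) ` {d. norm (lattice_pt d) \<le> R}"
    unfolding lattice_pt_diff by (force simp: image_iff intro!: exI[of _ "k - _"])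
  then show ?thesis by (rule surj_card_le[OF finite_lattice_ball])
qed

section \<open>Summing the pieces of a tempered distribution\<close>

lemma partial_deriv_support:
  fixes f :: "real^'n::finite \<Rightarrow> complex"
  assumes "x \<notin> closure {y. f y \<noteq> 0}"
  shows "partial_deriv \<gamma> f x = 0"
proof -
  have "\<forall>x\<in>- closure {y. f y \<noteq> 0}. partial_deriv \<gamma> f x = 0"
  proof (induction \<gamma>)
    case Nil
    then show ?case using closure_subset[of "{y. f y \<noteq> 0}"] by auto
  next
    case (Cons i \<gamma>)
    show ?case
    proof
      fix x assume x: "x \<in> - closure {y. f y \<noteq> 0}"
      have "((\<lambda>_. 0) has_derivative (\<lambda>_. 0)) (at x)" by simp
      then have "(partial_deriv \<gamma> f has_derivative (\<lambda>_. 0)) (at x)"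
        by (rule has_derivative_transform_within_open[of _ _ _ _ "- closure {y. f y \<noteq> 0}"]) (use Cons x in auto)
      from frechet_derivative_at[OF this, symmetric]
      show "partial_deriv (i # \<gamma>) f x = 0" by simp
    qed
  qed
  then show ?thesis using assms by auto
qed

lemma partial_deriv_sum:
  fixes f :: "'i \<Rightarrow> real^'n::finite \<Rightarrow> complex"
  assumes "finite F" "\<And>k. k \<in> F \<Longrightarrow> smooth (f k)"
  shows "smooth (\<lambda>x. \<Sum>k\<in>F. f k x) \<and> partial_deriv \<gamma> (\<lambda>x. \<Sum>k\<in>F. f k x) = (\<lambda>x. \<Sum>k\<in>F. partial_deriv \<gamma> (f k) x)"
  using assms
proof (induction F rule: finite_induct)
  case empty
  have "partial_deriv \<gamma> (\<lambda>x::real^'n. 0) = (\<lambda>x. 0)"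
    by (cases \<gamma> rule: rev_cases) (simp_all only: partial_deriv_const partial_deriv.simps)
  then show ?case using smooth_const by simp
next
  case (insert k F)
  then show ?case using partial_deriv_add[of "f k" "\<lambda>x. \<Sum>k\<in>F. f k x" \<gamma>] smooth_add[of "f k" "\<lambda>x. \<Sum>k\<in>F. f k x"] by simp
qed

lemma fourier_add: 
  assumes "integrable lborel f" "integrable lborel g"
  shows "fourier (\<lambda>x. f x + g x) = (\<lambda>\<xi>. fourier f \<xi> + fourier g \<xi>)"
  unfolding fourier_wave using assms
  by (simp add: distrib_right Bochner_Integration.integral_add integrable_mult_wave)

lemma fourier_cmul: "fourier (\<lambda>x. c * f x) = (\<lambda>\<xi>. c * fourier f \<xi>)"
  unfolding fourier_wave by (simp add: mult.assoc)

lemma tempered_zero: 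
  assumes "u \<in> tempered" shows "u (\<lambda>x. 0) = 0"
proof -
  have "u (\<lambda>x. 0 * 0) = 0 * u (\<lambda>x. 0)" by (rule tempered_cmul[OF assms schwartz_zero])
  then show ?thesis by (simp only: mult_zero_left)
qed

lemma tempered_fourier_sum:
  fixes u :: "'n::finite distr"
  assumes u: "u \<in> tempered" and "finite I" "\<And>i. i \<in> I \<Longrightarrow> f i \<in> schwartz"
  shows "u (fourier (\<lambda>x. \<Sum>i\<in>I. f i x)) = (\<Sum>i\<in>I. u (fourier (f i)))"
  using assms(2,3)
proof (induction I rule: finite_induct)
  case empty
  have "fourier (\<lambda>x::real^'n. 0) = (\<lambda>\<xi>. 0)" by (simp add: fourier_wave fun_eq_iff)
  then show ?case using tempered_zero[OF u] by simp
next
  case (insert i I)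
  have s: "f i \<in> schwartz" "(\<lambda>x. \<Sum>i\<in>I. f i x) \<in> schwartz" using insert by (auto intro: schwartz_sum)
  have "fourier (\<lambda>x. \<Sum>i\<in>insert i I. f i x) = (\<lambda>\<xi>. fourier (f i) \<xi> + fourier (\<lambda>x. \<Sum>i\<in>I. f i x) \<xi>)"
    using insert s by (simp add: fourier_add schwartz_integrable)
  then show ?case using insert s tempered_add[OF u schwartz_fourier[OF s(1)] schwartz_fourier[OF s(2)]] by simp
qed

lemma fourier_mult_apply:
  assumes "\<eta> \<in> schwartz" "\<phi> \<in> schwartz"
  shows "fourier_mult \<eta> u \<phi> = u (fourier (\<lambda>\<xi>. \<eta> \<xi> * inv_fourier \<phi> \<xi>))"
  using assms by (simp add: fourier_mult_def inv_fourier_distr_def mult_distr_def fourier_distr_def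
      schwartz_inv_fourier schwartz_mult)

locale alpha_partition =
  fixes \<eta> :: "int^'n::finite \<Rightarrow> real^'n \<Rightarrow> complex" and \<alpha> :: real
  assumes alpha_nonneg: "0 \<le> \<alpha>" and alpha_less_1: "\<alpha> < 1" and decomp: "alpha_decomposition \<alpha> \<eta>"
begin

abbreviation rad :: "int^'n \<Rightarrow> real" where "rad \<equiv> alpha_radius \<alpha>"
abbreviation cen :: "int^'n \<Rightarrow> real^'n" where "cen \<equiv> alpha_center \<alpha>"

text \<open>The constant \<open>C\<close> in the support condition, fixed once so that it can be named.\<close>

definition supp_const :: real where
  "supp_const = (SOME C. 0 < C \<and> (\<forall>k. closure {\<xi>. \<eta> k \<xi> \<noteq> 0} \<subseteq> {\<xi>. norm (\<xi> - cen k) < C * rad k}))"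

lemma supp_const: "0 < supp_const" "x \<in> closure {\<xi>. \<eta> k \<xi> \<noteq> 0} \<Longrightarrow> norm (x - cen k) < supp_const * rad k"
proof -
  have "\<exists>C. 0 < C \<and> (\<forall>k. closure {\<xi>. \<eta> k \<xi> \<noteq> 0} \<subseteq> {\<xi>. norm (\<xi> - cen k) < C * rad k})"
    using decomp unfolding alpha_decomposition_def by blast
  from someI_ex[OF this]
  show "0 < supp_const" "x \<in> closure {\<xi>. \<eta> k \<xi> \<noteq> 0} \<Longrightarrow> norm (x - cen k) < supp_const * rad k"
    unfolding supp_const_def by blast+
qed

lemma eta_support: "\<eta> k x \<noteq> 0 \<Longrightarrow> norm (x - cen k) < supp_const * rad k"
  using supp_const(2)[of x k] closure_subset[of "{\<xi>. \<eta> k \<xi> \<noteq> 0}"] by auto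

lemma eta_schwartz: "\<eta> k \<in> schwartz"
  using decomp by (simp add: alpha_decomposition_def)

lemma eta_has_sum: "((\<lambda>k. \<eta> k \<xi>) has_sum 1) UNIV"
  using decomp by (simp add: alpha_decomposition_def)

lemma rad_ge_1: "1 \<le> rad k"
  using alpha_radius_ge_1[OF alpha_nonneg alpha_less_1] .

lemma rad_pos: "0 < rad k" using rad_ge_1[of k] by linarith

lemma rad_zero: "rad 0 = 1" and cen_zero: "cen 0 = 0"
proof -
  have 0: "lattice_pt (0 :: int^'n) = 0" by (simp add: lattice_pt_def vec_eq_iff)
  show "rad 0 = 1" "cen 0 = 0" by (simp_all add: alpha_radius_def alpha_center_def 0 japanese_def)
qed

lemma eta_zero_nonzero: "\<eta> 0 0 \<noteq> 0"
proof -
  obtain c where "c > 0" "\<And>\<xi>. norm (\<xi> - cen 0) < c * rad 0 \<Longrightarrow> norm (\<eta> 0 \<xi>) \<ge> 1"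
    using decomp unfolding alpha_decomposition_def by meson
  then have "norm (\<eta> 0 0) \<ge> 1" by (simp add: rad_zero cen_zero)
  then show ?thesis by auto
qed

lemma eta_zero_support: "\<eta> 0 x \<noteq> 0 \<Longrightarrow> norm x < supp_const"
  using eta_support[of 0 x] by (simp add: rad_zero cen_zero)

lemma eta_partial_deriv_bound:
  "\<exists>A\<ge>0. \<forall>k \<gamma> \<xi>. length \<gamma> \<le> N \<longrightarrow> rad k ^ length \<gamma> * norm (partial_deriv \<gamma> (\<eta> k) \<xi>) \<le> A"
proof -
  have "\<forall>\<gamma>. \<exists>C. \<forall>k \<xi>. norm (partial_deriv \<gamma> (\<eta> k) \<xi>) \<le> C * jap k powr (- (\<alpha> * real (length \<gamma>) / (1 - \<alpha>)))"
    using decomp by (simp add: alpha_decomposition_def)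
  then obtain C where C: "\<And>\<gamma> k \<xi>. norm (partial_deriv \<gamma> (\<eta> k) \<xi>) \<le> C \<gamma> * jap k powr (- (\<alpha> * real (length \<gamma>) / (1 - \<alpha>)))"
    by metis
  define A where "A = (\<Sum>\<gamma>\<in>{\<gamma>::'n list. length \<gamma> \<le> N}. \<bar>C \<gamma>\<bar>)"
  have "rad k ^ length \<gamma> * norm (partial_deriv \<gamma> (\<eta> k) \<xi>) \<le> A" if "length \<gamma> \<le> N" for k \<gamma> \<xi>
  proof -
    have e: "rad k ^ length \<gamma> = jap k powr (\<alpha> * real (length \<gamma>) / (1 - \<alpha>))"
      using japanese_pos[of "lattice_pt k"] 
      by (simp add: alpha_radius_def powr_realpow[symmetric] powr_powr)
    have "rad k ^ length \<gamma> * norm (partial_deriv \<gamma> (\<eta> k) \<xi>) \<le> rad k ^ length \<gamma> * (C \<gamma> * jap k powr (- (\<alpha> * real (length \<gamma>) / (1 - \<alpha>))))"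
      using rad_pos[of k] by (intro mult_left_mono C) auto
    also have "\<dots> = C \<gamma>" unfolding e using japanese_pos[of "lattice_pt k"] by (simp add: powr_minus)
    also have "\<dots> \<le> A" unfolding A_def
      using member_le_sum[of \<gamma> "{\<gamma>. length \<gamma> \<le> N}" "\<lambda>\<gamma>. \<bar>C \<gamma>\<bar>"] finite_lists_le that by force
    finally show ?thesis .
  qed
  moreover have "0 \<le> A" unfolding A_def by (rule sum_nonneg) simp
  ultimately show ?thesis by blast
qed

lemma eta_index_bound:
  assumes "x \<in> closure {\<xi>. \<eta> k \<xi> \<noteq> 0}"
  shows "norm (lattice_pt k) \<le> norm x + supp_const"
proof -
  have "rad k * norm (lattice_pt k) = norm (cen k)" using rad_pos[of k] by (simp add: alpha_center_def)
  also have "\<dots> \<le> norm x + norm (x - cen k)" using norm_triangle_ineq4[of x "x - cen k"] by simp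
  also have "\<dots> \<le> norm x + supp_const * rad k" using supp_const(2)[OF assms] by simp
  also have "\<dots> \<le> rad k * (norm x + supp_const)"
    using mult_right_mono[OF rad_ge_1[of k] norm_ge_zero[of x]] by (simp add: algebra_simps)
  finally show ?thesis using rad_pos[of k] by simp
qed

text \<open>The function \<open>1 - (\<Sum>k\<in>F. \<eta> k)\<close>, written as a sum with a scalar multiple so that the rules for
  derivatives of sums and scalar multiples apply.\<close>

definition remainder :: "(int^'n) set \<Rightarrow> real^'n \<Rightarrow> complex" where
  "remainder F \<xi> = 1 + (- 1) * (\<Sum>k\<in>F. \<eta> k \<xi>)"

lemma smooth_remainder: "finite F \<Longrightarrow> smooth (remainder F)"
  unfolding remainder_def[abs_def]
  by (intro smooth_add smooth_const smooth_cmul schwartz_smooth[OF schwartz_sum] eta_schwartz)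

text \<open>Only the polynomially many indices with \<open>|k| \<le> |x| + supp_const\<close> contribute at \<open>x\<close>, so the bound
  does not depend on the finite set \<open>F\<close>.\<close>

lemma remainder_growth:
  "\<exists>A. \<forall>F. finite F \<longrightarrow> growth_bound N (CARD('n)) A (remainder F)"
proof -
  obtain A where A: "A \<ge> 0" "\<And>k \<gamma> \<xi>. length \<gamma> \<le> N \<Longrightarrow> rad k ^ length \<gamma> * norm (partial_deriv \<gamma> (\<eta> k) \<xi>) \<le> A"
    using eta_partial_deriv_bound by blast
  let ?c = "2 * supp_const + 2"
  have "norm (partial_deriv \<gamma> (remainder F) x) \<le> (1 + A * ?c ^ CARD('n)) * (1 + norm x) ^ CARD('n)"
    if F: "finite F" and l: "length \<gamma> \<le> N" for F \<gamma> x
  proof -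
    let ?K = "{k :: int^'n. norm (lattice_pt k) \<le> norm x + supp_const}"
    have ps: "partial_deriv \<gamma> (\<lambda>x. \<Sum>k\<in>F. \<eta> k x) = (\<lambda>x. \<Sum>k\<in>F. partial_deriv \<gamma> (\<eta> k) x)" "smooth (\<lambda>x. \<Sum>k\<in>F. \<eta> k x)"
      using partial_deriv_sum[OF F, of \<eta>] schwartz_smooth[OF eta_schwartz] by auto
    have "norm (\<Sum>k\<in>F. partial_deriv \<gamma> (\<eta> k) x) \<le> (\<Sum>k\<in>F. norm (partial_deriv \<gamma> (\<eta> k) x))" by (rule norm_sum)
    also have "\<dots> = (\<Sum>k\<in>F \<inter> ?K. norm (partial_deriv \<gamma> (\<eta> k) x))"
      using F eta_index_bound[of x] partial_deriv_support[of x "\<eta> _" \<gamma>] by (intro sum.mono_neutral_right) force+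
    also have "\<dots> \<le> (\<Sum>k\<in>F \<inter> ?K. A)"
    proof (rule sum_mono)
      fix k
      have "1 * norm (partial_deriv \<gamma> (\<eta> k) x) \<le> rad k ^ length \<gamma> * norm (partial_deriv \<gamma> (\<eta> k) x)"
        by (intro mult_right_mono one_le_power rad_ge_1) auto
      with A(2)[OF l, of k x] show "norm (partial_deriv \<gamma> (\<eta> k) x) \<le> A" by simp
    qed
    also have "\<dots> \<le> A * real (card ?K)"
    proof -
      have "card (F \<inter> ?K) \<le> card ?K" by (intro card_mono finite_lattice_ball) auto
      then have "A * real (card (F \<inter> ?K)) \<le> A * real (card ?K)" by (intro mult_left_mono A(1)) simp
      then show ?thesis by (simp add: mult.commute)
    qed
    also have "\<dots> \<le> A * (2 * (norm x + supp_const) + 1) ^ CARD('n)"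
      using supp_const(1) by (intro mult_left_mono card_lattice_ball A(1)) (auto simp: add_nonneg_nonneg)
    also have "\<dots> \<le> A * (?c * (1 + norm x)) ^ CARD('n)"
      using supp_const(1) A(1) by (intro mult_left_mono power_mono) (auto simp: algebra_simps)
    finally have 1: "norm (\<Sum>k\<in>F. partial_deriv \<gamma> (\<eta> k) x) \<le> A * ?c ^ CARD('n) * (1 + norm x) ^ CARD('n)"
      by (simp add: power_mult_distrib mult.assoc)
    have "growth_bound (length \<gamma>) 0 (norm (1::complex)) (\<lambda>x::real^'n. 1)" by (rule growth_bound_const)
    then have "norm (partial_deriv \<gamma> (\<lambda>x. 1) x) \<le> 1" by (simp add: growth_bound_def)
    also have "1 \<le> (1 + norm x) ^ CARD('n)" by (intro one_le_power) auto
    finally have 2: "norm (partial_deriv \<gamma> (\<lambda>x. 1) x) \<le> (1 + norm x) ^ CARD('n)" .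
    have "partial_deriv \<gamma> (remainder F) x = partial_deriv \<gamma> (\<lambda>x. 1) x + (- 1) * (\<Sum>k\<in>F. partial_deriv \<gamma> (\<eta> k) x)"
      unfolding remainder_def[abs_def] partial_deriv_add[OF smooth_const smooth_cmul[OF ps(2)]] partial_deriv_cmul[OF ps(2)] ps(1) ..
    also have "norm \<dots> \<le> norm (partial_deriv \<gamma> (\<lambda>x. 1) x) + norm (\<Sum>k\<in>F. partial_deriv \<gamma> (\<eta> k) x)"
      using norm_triangle_ineq4 by simp
    finally show ?thesis using 1 2 by (simp add: algebra_simps)
  qed
  then show ?thesis unfolding growth_bound_def by blast
qed

lemma remainder_eq_0:
  assumes F: "finite F" "{k. norm (lattice_pt k) \<le> K} \<subseteq> F" and x: "norm x + supp_const \<le> K"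
  shows "remainder F x = 0"
proof -
  have "\<eta> k x = 0" if "k \<notin> F" for k
  proof (rule ccontr)
    assume "\<eta> k x \<noteq> 0"
    then have "x \<in> closure {\<xi>. \<eta> k \<xi> \<noteq> 0}" using closure_subset[of "{\<xi>. \<eta> k \<xi> \<noteq> 0}"] by auto
    from eta_index_bound[OF this] x have "norm (lattice_pt k) \<le> K" by linarith
    then show False using F(2) that by (simp add: subset_iff)
  qed
  then have "((\<lambda>k. \<eta> k x) has_sum 1) F"
    using eta_has_sum[of x] by (subst has_sum_cong_neutral[of UNIV F _ "\<lambda>k. \<eta> k x"]) auto
  then have "(\<Sum>k\<in>F. \<eta> k x) = 1" using has_sum_unique[OF has_sum_finite[OF F(1)]] by auto
  then show ?thesis by (simp add: remainder_def)
qed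

text \<open>A multiplier vanishing for \<open>|x| < K - supp_const\<close> costs one power of decay and gains the factor
  \<open>1 / (1 + K - supp_const)\<close>.\<close>

lemma remainder_mult_bound:
  assumes \<psi>: "\<psi> \<in> schwartz"
  shows "\<exists>B. \<forall>K F. supp_const < K \<longrightarrow> finite F \<longrightarrow> {k. norm (lattice_pt k) \<le> K} \<subseteq> F \<longrightarrow>
     schwartz_bound N (B / (1 + (K - supp_const))) (\<lambda>x. remainder F x * \<psi> x)"
proof -
  obtain A where A: "\<And>F. finite F \<Longrightarrow> growth_bound (Suc N) (CARD('n)) A (remainder F)" using remainder_growth by blast
  obtain B where B: "schwartz_bound (Suc N + CARD('n)) B \<psi>" using schwartz_obtain_bound[OF \<psi>] .
  let ?B = "2 ^ Suc N * A * B"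
  have "schwartz_bound N (?B / (1 + (K - supp_const))) (\<lambda>x. remainder F x * \<psi> x)"
    if K: "supp_const < K" and F: "finite F" "{k. norm (lattice_pt k) \<le> K} \<subseteq> F" for K F
    unfolding schwartz_bound_def
  proof (intro allI impI)
    fix \<gamma> :: "'n list" and x :: "real^'n" assume l: "length \<gamma> \<le> N"
    let ?f = "\<lambda>x. remainder F x * \<psi> x"
    have sb: "schwartz_bound (Suc N) ?B ?f"
      by (rule schwartz_bound_mult[OF smooth_remainder[OF F(1)] schwartz_smooth[OF \<psi>] A[OF F(1)] B])
    have d: "0 < 1 + (K - supp_const)" using K by simp
    show "(1 + norm x) ^ N * norm (partial_deriv \<gamma> ?f x) \<le> ?B / (1 + (K - supp_const))"
    proof (cases "norm x < K - supp_const")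
      case True
      have "closure {y. ?f y \<noteq> 0} \<subseteq> {y. K - supp_const \<le> norm y}"
      proof (rule closure_minimal)
        show "{y. ?f y \<noteq> 0} \<subseteq> {y. K - supp_const \<le> norm y}"
          using remainder_eq_0[OF F] by (force simp: not_less)
        show "closed {y::real^'n. K - supp_const \<le> norm y}"
          by (intro closed_Collect_le continuous_intros)
      qed
      then have "partial_deriv \<gamma> ?f x = 0" using True by (intro partial_deriv_support) auto
      then show ?thesis using d schwartz_bound_nonneg[OF sb] by simp
    next
      case False
      have "(1 + (K - supp_const)) * ((1 + norm x) ^ N * norm (partial_deriv \<gamma> ?f x)) \<le> (1 + norm x) * ((1 + norm x) ^ N * norm (partial_deriv \<gamma> ?f x))"
        using False by (intro mult_right_mono) auto
      also have "\<dots> \<le> ?B" using sb l by (auto simp: schwartz_bound_def mult.assoc)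
      finally show ?thesis using d by (simp add: pos_le_divide_eq mult.commute)
    qed
  qed
  then show ?thesis by blast
qed

text \<open>On the Fourier side the difference between \<open>u \<phi>\<close> and a finite partial sum is \<open>u\<close> applied to the
  transform of \<open>remainder F * inv_fourier \<phi>\<close>, which is small in every seminorm once \<open>F\<close> contains a
  large ball.\<close>

theorem has_sum_fourier_mult:
  assumes u: "u \<in> tempered" and \<phi>: "\<phi> \<in> schwartz"
  shows "((\<lambda>k. fourier_mult (\<eta> k) u \<phi>) has_sum u \<phi>) UNIV"
proof -
  define \<psi> where "\<psi> = inv_fourier \<phi>"
  have \<psi>: "\<psi> \<in> schwartz" "fourier \<psi> = \<phi>"
    using schwartz_inv_fourier[OF \<phi>] fourier_inv_fourier[OF \<phi>] by (auto simp: \<psi>_def)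
  obtain N C where C: "C \<ge> 0" "\<And>\<phi> B. \<phi> \<in> schwartz \<Longrightarrow> schwartz_bound N B \<phi> \<Longrightarrow> norm (u \<phi>) \<le> C * B"
    by (rule tempered_obtain_bound[OF u]) blast
  obtain M D where D: "D \<ge> 0" "\<And>f B. f \<in> schwartz \<Longrightarrow> schwartz_bound M B f \<Longrightarrow> schwartz_bound N (D * B) (fourier (f :: real^'n \<Rightarrow> complex))"
    using fourier_schwartz_bound[of N] by blast
  obtain B where B: "\<And>K F. supp_const < K \<Longrightarrow> finite F \<Longrightarrow> {k. norm (lattice_pt k) \<le> K} \<subseteq> F \<Longrightarrow>
     schwartz_bound M (B / (1 + (K - supp_const))) (\<lambda>x. remainder F x * \<psi> x)"
    using remainder_mult_bound[OF \<psi>(1)] by blast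
  have rem_sch: "(\<lambda>x. remainder F x * \<psi> x) \<in> schwartz" if "finite F" for F
    using that by (intro schwartz_multI smooth_remainder \<psi>) (use remainder_growth in blast)+
  have split: "u \<phi> = (\<Sum>k\<in>F. fourier_mult (\<eta> k) u \<phi>) + u (fourier (\<lambda>x. remainder F x * \<psi> x))" if F: "finite F" for F
  proof -
    have s: "(\<lambda>x. \<Sum>k\<in>F. \<eta> k x * \<psi> x) \<in> schwartz" by (intro schwartz_sum F schwartz_mult eta_schwartz \<psi>)
    have "\<psi> = (\<lambda>x. (\<Sum>k\<in>F. \<eta> k x * \<psi> x) + remainder F x * \<psi> x)"
      by (simp add: fun_eq_iff remainder_def left_diff_distrib sum_distrib_right)
    then have "\<phi> = (\<lambda>\<xi>. fourier (\<lambda>x. \<Sum>k\<in>F. \<eta> k x * \<psi> x) \<xi> + fourier (\<lambda>x. remainder F x * \<psi> x) \<xi>)"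
      using fourier_add[OF schwartz_integrable[OF s] schwartz_integrable[OF rem_sch[OF F]]] \<psi>(2) by metis
    then have "u \<phi> = u (fourier (\<lambda>x. \<Sum>k\<in>F. \<eta> k x * \<psi> x)) + u (fourier (\<lambda>x. remainder F x * \<psi> x))"
      using tempered_add[OF u schwartz_fourier[OF s] schwartz_fourier[OF rem_sch[OF F]]] by simp
    also have "u (fourier (\<lambda>x. \<Sum>k\<in>F. \<eta> k x * \<psi> x)) = (\<Sum>k\<in>F. fourier_mult (\<eta> k) u \<phi>)"
      unfolding fourier_mult_apply[OF eta_schwartz \<phi>] \<psi>_def[symmetric]
      by (intro tempered_fourier_sum u F schwartz_mult eta_schwartz \<psi>)
    finally show ?thesis .
  qed
  show ?thesis
    unfolding has_sum_def tendsto_iff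
  proof (intro allI impI)
    fix e :: real assume e: "e > 0"
    define K where "K = supp_const + 1 + C * D * \<bar>B\<bar> / e"
    have CD: "0 \<le> C * D * \<bar>B\<bar>" using C(1) D(1) by auto
    have K: "supp_const < K" using e CD by (simp add: K_def add_pos_nonneg)
    show "\<forall>\<^sub>F F in finite_subsets_at_top UNIV. dist (\<Sum>k\<in>F. fourier_mult (\<eta> k) u \<phi>) (u \<phi>) < e"
      unfolding eventually_finite_subsets_at_top
    proof (intro exI[of _ "{k. norm (lattice_pt k) \<le> K}"] conjI allI impI finite_lattice_ball subset_UNIV)
      fix F assume "finite F \<and> {k. norm (lattice_pt k) \<le> K} \<subseteq> F \<and> F \<subseteq> (UNIV :: (int^'n) set)"
      then have F: "finite F" "{k. norm (lattice_pt k) \<le> K} \<subseteq> F" by auto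
      have "norm (u (fourier (\<lambda>x. remainder F x * \<psi> x))) \<le> C * (D * (B / (1 + (K - supp_const))))"
        by (rule C(2)[OF schwartz_fourier[OF rem_sch[OF F(1)]] D(2)[OF rem_sch[OF F(1)] B[OF K F]]])
      also have "\<dots> \<le> C * (D * (\<bar>B\<bar> / (1 + (K - supp_const))))"
        using C(1) D(1) K by (intro mult_left_mono divide_right_mono) auto
      also have "\<dots> = (C * D * \<bar>B\<bar>) / (1 + (K - supp_const))" by simp
      also have "\<dots> < e"
      proof -
        have "C * D * \<bar>B\<bar> < e * (1 + (K - supp_const))"
          using e by (simp add: K_def distrib_left)
        then show ?thesis using K by (simp add: pos_divide_less_eq)
      qed
      finally show "dist (\<Sum>k\<in>F. fourier_mult (\<eta> k) u \<phi>) (u \<phi>) < e"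
        using split[OF F(1)] by (simp add: dist_norm norm_minus_commute)
    qed
  qed
qed

end

section \<open>Uniqueness of the representing function\<close>

text \<open>Boxes form an intersection-stable generator of the Borel sets, so the integral vanishes over every
  Borel set, in particular over the sets where \<open>g\<close> is positive or negative.\<close>

lemma integral_boxes_zero_imp_AE_zero_real:
  fixes g :: "'a::euclidean_space \<Rightarrow> real"
  assumes g: "integrable lborel g"
    and box0: "\<And>a b. (LINT x|lborel. indicator (box a b) x *\<^sub>R g x) = 0"
  shows "AE x in lborel. g x = 0"
proof -
  have [measurable]: "g \<in> borel_measurable borel" using g by auto
  have si: "set_integrable lborel A g" if "A \<in> sets borel" for A
    unfolding set_integrable_def using that g by (intro integrable_mult_indicator) auto
  have total: "integral\<^sup>L lborel g = 0"
  proof -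
    have "(\<lambda>n. LINT x|lborel. indicator (box (- real n *\<^sub>R One) (real n *\<^sub>R One)) x *\<^sub>R g x) \<longlonglongrightarrow> integral\<^sup>L lborel g"
    proof (rule integral_dominated_convergence)
      show "integrable lborel (\<lambda>x. norm (g x))" using g by simp
      show "AE x in lborel. (\<lambda>n. indicator (box (- real n *\<^sub>R One) (real n *\<^sub>R One)) x *\<^sub>R g x) \<longlonglongrightarrow> g x"
      proof (intro AE_I2)
        fix x :: 'a
        obtain n0 :: nat where n0: "norm x < real n0" using reals_Archimedean2 by blast
        have "\<forall>\<^sub>F n in sequentially. indicator (box (- real n *\<^sub>R One) (real n *\<^sub>R One)) x *\<^sub>R g x = g x"
          unfolding eventually_sequentially
        proof (intro exI[of _ n0] allI impI)
          fix n assume "n0 \<le> n"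
          then have "norm x < real n" using n0 by (meson less_le_trans of_nat_mono)
          then have "\<bar>x \<bullet> b\<bar> < real n" if "b \<in> Basis" for b using Basis_le_norm[OF that, of x] by linarith
          then have "x \<in> box (- real n *\<^sub>R One) (real n *\<^sub>R One)" by (force simp: mem_box abs_less_iff)
          then show "indicator (box (- real n *\<^sub>R One) (real n *\<^sub>R One)) x *\<^sub>R g x = g x" by simp
        qed
        then show "(\<lambda>n. indicator (box (- real n *\<^sub>R One) (real n *\<^sub>R One)) x *\<^sub>R g x) \<longlonglongrightarrow> g x"
          by (rule tendsto_eventually)
      qed
      show "AE x in lborel. norm (indicator (box (- real n *\<^sub>R One) (real n *\<^sub>R One)) x *\<^sub>R g x) \<le> norm (g x)" for n
        by (intro AE_I2) (simp add: indicator_def)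
    qed auto
    then show ?thesis unfolding box0 by (simp add: LIMSEQ_const_iff)
  qed
  have set0: "(LINT x:A|lborel. g x) = 0" if A: "A \<in> sets borel" for A
  proof -
    have "Int_stable (range (\<lambda>(a, b). box a b :: 'a set))"
      by (auto simp: Int_stable_def box_Int_box)
    moreover have "range (\<lambda>(a, b). box a b :: 'a set) \<subseteq> Pow UNIV" by simp
    moreover have "A \<in> sigma_sets UNIV (range (\<lambda>(a, b). box a b))"
      using A unfolding borel_eq_box by simp
    ultimately show ?thesis
    proof (induction A rule: sigma_sets_induct_disjoint)
      case (basic A)
      then show ?case using box0 by (auto simp: set_lebesgue_integral_def)
    next
      case empty
      then show ?case by (simp add: set_lebesgue_integral_def)
    next
      case (compl A)
      then have A: "A \<in> sets borel" by (simp add: borel_eq_box)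
      have "indicator (UNIV - A) x *\<^sub>R g x = g x - indicator A x *\<^sub>R g x" for x
        by (simp add: indicator_def)
      then have "(LINT x:(UNIV - A)|lborel. g x) = integral\<^sup>L lborel g - (LINT x:A|lborel. g x)"
        unfolding set_lebesgue_integral_def using si[OF A] g by (simp add: set_integrable_def)
      then show ?case using total compl by simp
    next
      case (union F)
      then have F: "F i \<in> sets borel" for i by (auto simp: borel_eq_box subset_eq)
      then have "(\<Union>i. F i) \<in> sets borel" by blast
      then show ?case
        using union F si by (subst lebesgue_integral_countable_add) (auto simp: disjoint_family_on_def)
    qed
  qed
  have nn: "AE x in lborel. indicator A x *\<^sub>R (s * g x) = 0" 
    if A: "A \<in> sets borel" and s: "\<And>x. x \<in> A \<Longrightarrow> 0 \<le> s * g x" for A s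
  proof -
    have "integrable lborel (\<lambda>x. s * (indicator A x *\<^sub>R g x))"
      using si[OF A] unfolding set_integrable_def by simp
    moreover have "(LINT x|lborel. s * (indicator A x *\<^sub>R g x)) = 0"
      using set0[OF A] by (simp add: set_lebesgue_integral_def)
    moreover have "AE x in lborel. 0 \<le> s * (indicator A x *\<^sub>R g x)"
      using s by (intro AE_I2) (simp add: indicator_def)
    ultimately have "AE x in lborel. s * (indicator A x *\<^sub>R g x) = 0"
      using integral_nonneg_eq_0_iff_AE by blast
    then show ?thesis by eventually_elim (simp add: indicator_def)
  qed
  have "AE x in lborel. indicator {x. 0 < g x} x *\<^sub>R (1 * g x) = 0" "AE x in lborel. indicator {x. g x < 0} x *\<^sub>R (-1 * g x) = 0"
    by (intro nn; simp)+
  then show ?thesis by eventually_elim (auto simp: indicator_def split: if_splits)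
qed

lemma integral_boxes_zero_imp_AE_zero:
  fixes g :: "'a::euclidean_space \<Rightarrow> complex"
  assumes g: "integrable lborel g"
    and box0: "\<And>a b. (LINT x|lborel. indicator (box a b) x *\<^sub>R g x) = 0"
  shows "AE x in lborel. g x = 0"
proof -
  have i: "integrable lborel (\<lambda>x. indicator (box a b) x *\<^sub>R g x)" for a b
    using g by (intro integrable_mult_indicator) auto
  have "(LINT x|lborel. indicator (box a b) x *\<^sub>R Re (g x)) = 0" for a b
    using integral_Re[OF i, of a b] box0[of a b] by simp
  moreover have "(LINT x|lborel. indicator (box a b) x *\<^sub>R Im (g x)) = 0" for a b
    using integral_Im[OF i, of a b] box0[of a b] by simp
  ultimately have "AE x in lborel. Re (g x) = 0" "AE x in lborel. Im (g x) = 0"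
    using g by (intro integral_boxes_zero_imp_AE_zero_real; simp)+
  then show ?thesis by eventually_elim (simp add: complex_eq_iff)
qed

context alpha_partition
begin

text \<open>Finite sums of the partition serve as compactly supported cutoffs.\<close>

definition cutoff :: "real \<Rightarrow> real^'n \<Rightarrow> complex" where
  "cutoff K x = (\<Sum>k\<in>{k. norm (lattice_pt k) \<le> K + supp_const}. \<eta> k x)"

lemma cutoff_schwartz: "cutoff K \<in> schwartz"
  unfolding cutoff_def[abs_def] by (intro schwartz_sum finite_lattice_ball eta_schwartz)

lemma cutoff_eq_1: "norm x \<le> K \<Longrightarrow> cutoff K x = 1"
  using remainder_eq_0[OF finite_lattice_ball order_refl, of x "K + supp_const"]
  by (simp add: remainder_def cutoff_def)

lemma locally_integrable_of_schwartz_integrable: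
  fixes h :: "real^'n \<Rightarrow> complex"
  assumes h: "h \<in> borel_measurable borel" "\<And>\<phi>. \<phi> \<in> schwartz \<Longrightarrow> integrable lborel (\<lambda>x. h x * \<phi> x)"
  shows "integrable lborel (\<lambda>x. indicator (ball 0 K) x *\<^sub>R (h x :: complex))"
proof (rule Bochner_Integration.integrable_bound[OF h(2)[OF cutoff_schwartz[of K]]])
  show "(\<lambda>x. indicator (ball 0 K) x *\<^sub>R h x) \<in> borel_measurable lborel"
    by (intro borel_measurable_scaleR borel_measurable_indicator) (use h(1) in auto)
  show "AE x in lborel. norm (indicator (ball 0 K) x *\<^sub>R h x) \<le> norm (h x * cutoff K x)"
    by (intro AE_I2) (auto simp: indicator_def cutoff_eq_1)
qed

text \<open>A modulation of \<open>\<eta> 0\<close>, suitably normalised, has integral one: some frequency of \<open>\<eta> 0\<close> is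
  present by Fourier inversion.\<close>

lemma mollifier:
  obtains \<rho> :: "real^'n \<Rightarrow> complex" where "\<rho> \<in> schwartz" "(LINT x|lborel. \<rho> x) = 1" "\<And>x. \<rho> x \<noteq> 0 \<Longrightarrow> norm x < supp_const"
proof -
  have "\<exists>\<xi>. fourier (\<eta> 0) \<xi> \<noteq> 0"
  proof (rule ccontr)
    assume "\<not> ?thesis"
    then have "inv_fourier (fourier (\<eta> 0)) 0 = 0" by (simp add: inv_fourier_wave)
    then show False using inv_fourier_fourier[OF eta_schwartz] eta_zero_nonzero by simp
  qed
  then obtain \<xi> where \<xi>: "fourier (\<eta> 0) \<xi> \<noteq> 0" by blast
  let ?\<rho> = "\<lambda>x. (1 / fourier (\<eta> 0) \<xi>) * (wave (- \<xi>) x * \<eta> 0 x)"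
  have "?\<rho> \<in> schwartz" by (intro schwartz_cmul schwartz_wave_mult eta_schwartz)
  moreover have "(LINT x|lborel. ?\<rho> x) = 1"
    using \<xi> fourier_wave[of "\<eta> 0" \<xi>] by (simp add: mult.commute)
  moreover have "?\<rho> x \<noteq> 0 \<Longrightarrow> norm x < supp_const" for x using eta_zero_support[of x] by auto
  ultimately show ?thesis by (rule that)
qed

text \<open>Testing against \<open>\<rho> ((x - y) / \<epsilon>)\<close> and integrating over \<open>x\<close> in a box gives, by Fubini, the
  integral of \<open>h\<close> against the mollified indicator of the box.\<close>

lemma schwartz_annihilator_box_integral:
  fixes h :: "real^'n \<Rightarrow> complex"
  assumes h: "h \<in> borel_measurable borel" "\<And>\<phi>. \<phi> \<in> schwartz \<Longrightarrow> integrable lborel (\<lambda>x. h x * \<phi> x)"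
    and h0: "\<And>\<phi>. \<phi> \<in> schwartz \<Longrightarrow> (LINT x|lborel. h x * \<phi> x) = 0"
  shows "(LINT x|lborel. indicator (box a b) x *\<^sub>R (h x :: complex)) = 0"
proof -
  obtain \<rho> where \<rho>: "\<rho> \<in> schwartz" "(LINT x|lborel. \<rho> x) = 1" "\<And>x::real^'n. \<rho> x \<noteq> 0 \<Longrightarrow> norm x < supp_const"
    by (rule mollifier) blast
  have [measurable]: "h \<in> borel_measurable borel" "\<rho> \<in> borel_measurable borel" using h(1) schwartz_measurable[OF \<rho>(1)] by auto
  obtain A where A: "A > 0" "\<And>x. norm (\<rho> x) \<le> A"
    by (rule schwartz_bounded[OF \<rho>(1)]) blast
  obtain R where R: "box a b \<subseteq> ball 0 R" using bounded_subset_ballD[OF bounded_box] by blast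
  define K where "K = R + supp_const"
  let ?U = "box a b"
  define hK where "hK y = indicator (ball 0 K) y *\<^sub>R h y" for y
  have int_hK: "integrable lborel hK" unfolding hK_def by (rule locally_integrable_of_schwartz_integrable[OF h])
  have [measurable]: "hK \<in> borel_measurable borel" using int_hK by auto
  have int_U: "integrable lborel (\<lambda>x. indicator ?U x :: complex)"
  proof -
    have "emeasure lborel ?U < \<infinity>" by (simp add: emeasure_lborel_box_eq)
    then have "integrable lborel (\<lambda>x. indicator ?U x :: real)" by (intro integrable_real_indicator) auto
    then have "integrable lborel (\<lambda>x. complex_of_real (indicator ?U x))" by (rule integrable_of_real)
    moreover have "complex_of_real (indicator ?U x) = indicator ?U x" for x by (simp add: indicator_def)
    ultimately show ?thesis by simp
  qed
  define e where "e m = 1 / real (Suc m)" for m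
  have e: "0 < e m" "e m \<le> 1" for m by (auto simp: e_def)
  have e0: "e \<longlonglongrightarrow> 0" unfolding e_def using LIMSEQ_inverse_real_of_nat by (simp add: inverse_eq_divide)
  define \<Psi> where "\<Psi> m y = (LINT w|lborel. indicator ?U (y + e m *\<^sub>R w) * \<rho> w)" for m y
  have \<Psi>_zero: "(LINT y|lborel. hK y * \<Psi> m y) = 0" for m
  proof -
    let ?k = "\<lambda>x y. \<rho> ((1 / e m) *\<^sub>R (x - y)) / A"
    have inner: "(LINT y|lborel. indicator ?U x * hK y * ?k x y) = 0" for x
    proof (cases "x \<in> ?U")
      case True
      have sch: "(\<lambda>y. \<rho> ((1 / e m) *\<^sub>R x + (- (1 / e m)) *\<^sub>R y)) \<in> schwartz"
        using e[of m] by (intro schwartz_affine \<rho>) auto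
      have "indicator ?U x * hK y * ?k x y = (1 / A) * (h y * \<rho> ((1 / e m) *\<^sub>R x + (- (1 / e m)) *\<^sub>R y))" for y
      proof (cases "\<rho> ((1 / e m) *\<^sub>R (x - y)) = 0")
        case False
        have "norm x < R" using True R by auto
        have "norm (x - y) / e m < supp_const" using \<rho>(3)[OF False] e[of m] by simp
        then have "norm (x - y) < e m * supp_const" using e(1)[of m] by (simp add: pos_divide_less_eq mult.commute)
        moreover have "e m * supp_const \<le> 1 * supp_const" using e(2)[of m] supp_const(1) by (intro mult_right_mono) auto
        ultimately have "norm (x - y) < supp_const" by linarith
        moreover have "norm y \<le> norm x + norm (x - y)" using norm_triangle_ineq4[of x "x - y"] by simp
        ultimately have "norm y < K" using \<open>norm x < R\<close> by (simp add: K_def)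
        then have "y \<in> ball 0 K" by simp
        then show ?thesis using True by (simp add: hK_def scaleR_diff_right)
      qed (simp add: scaleR_diff_right)
      then have "(LINT y|lborel. indicator ?U x * hK y * ?k x y) = (LINT y|lborel. (1 / A) * (h y * \<rho> ((1 / e m) *\<^sub>R x + (- (1 / e m)) *\<^sub>R y)))"
        by (intro Bochner_Integration.integral_cong refl)
      also have "\<dots> = (1 / A) * (LINT y|lborel. h y * \<rho> ((1 / e m) *\<^sub>R x + (- (1 / e m)) *\<^sub>R y))" by (rule integral_mult_right_zero)
      also have "\<dots> = 0" unfolding h0[OF sch] by simp
      finally show ?thesis .
    qed simp
    have "0 = (LINT x|lborel. LINT y|lborel. indicator ?U x * hK y * ?k x y)" unfolding inner by simp
    also have "\<dots> = (LINT y|lborel. LINT x|lborel. indicator ?U x * hK y * ?k x y)"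
      using A by (intro fubini_bounded_kernel int_U int_hK) (auto simp: norm_divide divide_le_eq_1)
    also have "\<dots> = (LINT y|lborel. (e m ^ CARD('n) / A) *\<^sub>R (hK y * \<Psi> m y))"
    proof (rule Bochner_Integration.integral_cong[OF refl])
      fix y
      have "(LINT x|lborel. indicator ?U x * hK y * ?k x y) = \<bar>e m\<bar> ^ DIM(real^'n) *\<^sub>R (LINT w|lborel. indicator ?U (y + e m *\<^sub>R w) * hK y * ?k (y + e m *\<^sub>R w) y)"
        using e[of m] by (intro integral_affine) auto
      also have "(LINT w|lborel. indicator ?U (y + e m *\<^sub>R w) * hK y * ?k (y + e m *\<^sub>R w) y) = (LINT w|lborel. (hK y / A) * (indicator ?U (y + e m *\<^sub>R w) * \<rho> w))"
        using e[of m] by (intro Bochner_Integration.integral_cong) auto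
      also have "\<dots> = (hK y / A) * \<Psi> m y" by (simp add: \<Psi>_def)
      finally show "(LINT x|lborel. indicator ?U x * hK y * ?k x y) = (e m ^ CARD('n) / A) *\<^sub>R (hK y * \<Psi> m y)"
        using e[of m] by (simp add: scaleR_conv_of_real)
    qed
    also have "\<dots> = (e m ^ CARD('n) / A) *\<^sub>R (LINT y|lborel. hK y * \<Psi> m y)" by (rule integral_scaleR_right)
    finally show ?thesis using e[of m] A by simp
  qed
  define L where "L = (LINT w|lborel. norm (\<rho> w))"
  have [measurable]: "(\<lambda>y. \<Psi> m y) \<in> borel_measurable borel" for m
    unfolding \<Psi>_def by (rule lborel.borel_measurable_lebesgue_integral) measurable
  have "(\<lambda>m. LINT y|lborel. hK y * \<Psi> m y) \<longlonglongrightarrow> (LINT y|lborel. hK y * indicator ?U y)"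
  proof (rule integral_dominated_convergence)
    show "integrable lborel (\<lambda>y. norm (hK y) * L)" using int_hK by simp
    have "emeasure lborel (cbox a b - box a b) = 0"
      by (subst emeasure_Diff) (auto simp: box_subset_cbox emeasure_lborel_cbox_eq emeasure_lborel_box_eq)
    then have "AE y in lborel. y \<notin> cbox a b - box a b"
      by (intro AE_not_in) (simp add: null_sets_def)
    then show "AE y in lborel. (\<lambda>m. hK y * \<Psi> m y) \<longlonglongrightarrow> hK y * indicator ?U y"
    proof eventually_elim
      fix y assume y: "y \<notin> cbox a b - box a b"
      have "(\<lambda>m. \<Psi> m y) \<longlonglongrightarrow> (LINT w|lborel. indicator ?U y * \<rho> w)"
        unfolding \<Psi>_def
      proof (rule integral_dominated_convergence)
        show "integrable lborel (\<lambda>w. norm (\<rho> w))" using schwartz_integrable[OF \<rho>(1)] by simp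
        show "AE w in lborel. (\<lambda>m. indicator ?U (y + e m *\<^sub>R w) * \<rho> w) \<longlonglongrightarrow> indicator ?U y * \<rho> w"
        proof (intro AE_I2 tendsto_mult_right tendsto_eventually)
          fix w
          have "(\<lambda>m. y + e m *\<^sub>R w) \<longlonglongrightarrow> y + 0 *\<^sub>R w" by (intro tendsto_intros e0)
          then have lim: "(\<lambda>m. y + e m *\<^sub>R w) \<longlonglongrightarrow> y" by simp
          show "\<forall>\<^sub>F m in sequentially. indicator ?U (y + e m *\<^sub>R w) = (indicator ?U y :: complex)"
          proof (cases "y \<in> ?U")
            case True
            from topological_tendstoD[OF lim open_box True] show ?thesis
              by eventually_elim (simp add: True)
          next
            case False
            then have "y \<in> - cbox a b" using y by auto
            from topological_tendstoD[OF lim _ this] have "\<forall>\<^sub>F m in sequentially. y + e m *\<^sub>R w \<in> - cbox a b" by auto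
            then show ?thesis by eventually_elim (use False box_subset_cbox in \<open>auto simp: indicator_def\<close>)
          qed
        qed
        show "AE w in lborel. norm (indicator ?U (y + e m *\<^sub>R w) * \<rho> w) \<le> norm (\<rho> w)" for m
          by (intro AE_I2) (simp add: indicator_def)
      qed measurable
      moreover have "(LINT w|lborel. indicator ?U y * \<rho> w) = indicator ?U y" using \<rho>(2) by simp
      ultimately show "(\<lambda>m. hK y * \<Psi> m y) \<longlonglongrightarrow> hK y * indicator ?U y"
        by (intro tendsto_mult_left) (simp only:)
    qed
    show "AE y in lborel. norm (hK y * \<Psi> m y) \<le> norm (hK y) * L" for m
    proof (intro AE_I2)
      fix y
      have "norm (\<Psi> m y) \<le> L"
        unfolding \<Psi>_def L_def
      proof (rule lborel_norm_integral_le)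
        show "integrable lborel (\<lambda>w. norm (\<rho> w))" using schwartz_integrable[OF \<rho>(1)] by simp
        show "norm (indicator ?U (y + e m *\<^sub>R w) * \<rho> w) \<le> norm (\<rho> w)" for w by (simp add: indicator_def)
        show "integrable lborel (\<lambda>w. indicator ?U (y + e m *\<^sub>R w) * \<rho> w)"
          by (rule Bochner_Integration.integrable_bound[OF schwartz_integrable[OF \<rho>(1)]]) (auto simp: indicator_def)
      qed
      then show "norm (hK y * \<Psi> m y) \<le> norm (hK y) * L" by (simp add: norm_mult mult_left_mono)
    qed
  qed measurable
  then have "(LINT y|lborel. hK y * indicator ?U y) = 0" by (simp add: \<Psi>_zero LIMSEQ_const_iff)
  moreover have "hK y * indicator ?U y = indicator ?U y *\<^sub>R h y" for y
    using R supp_const(1) by (auto simp: hK_def indicator_def K_def)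
  ultimately show ?thesis by simp
qed

text \<open>Two representatives differ by a locally integrable function that annihilates all Schwartz
  functions, hence has integral zero over every box.\<close>

theorem represents_unique:
  assumes g: "represents g u" and g': "represents g' u"
  shows "AE x in lborel. g x = g' (x :: real^'n)"
proof -
  define h where "h x = g x - g' x" for x
  have meas: "h \<in> borel_measurable borel"
    unfolding h_def[abs_def] using g g' by (intro borel_measurable_diff) (simp_all add: represents_def)
  have int: "integrable lborel (\<lambda>x. h x * \<phi> x)" if "\<phi> \<in> schwartz" for \<phi>
    using g g' that by (simp add: represents_def h_def left_diff_distrib)
  have zero: "(LINT x|lborel. h x * \<phi> x) = 0" if \<phi>: "\<phi> \<in> schwartz" for \<phi>
  proof -
    have "regular_distr g \<phi> = regular_distr g' \<phi>" using g g' by (simp add: represents_def)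
    then show ?thesis using g g' \<phi> by (simp add: represents_def h_def left_diff_distrib regular_distr_def)
  qed
  have "AE x in lborel. \<forall>K::nat. indicator (box (- real K *\<^sub>R One) (real K *\<^sub>R One)) x *\<^sub>R h x = 0"
    unfolding AE_all_countable
  proof
    fix K :: nat
    let ?B = "box (- real K *\<^sub>R One) (real K *\<^sub>R One) :: (real^'n) set"
    obtain R where R: "?B \<subseteq> ball 0 R" using bounded_subset_ballD[OF bounded_box] by blast
    have "integrable lborel (\<lambda>x. indicator ?B x *\<^sub>R (indicator (ball 0 R) x *\<^sub>R h x))"
      by (intro integrable_mult_indicator locally_integrable_of_schwartz_integrable meas int) auto
    moreover have "(\<lambda>x. indicator ?B x *\<^sub>R (indicator (ball 0 R) x *\<^sub>R h x)) = (\<lambda>x. indicator ?B x *\<^sub>R h x)"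
      using R by (auto simp: indicator_def fun_eq_iff)
    ultimately have "integrable lborel (\<lambda>x. indicator ?B x *\<^sub>R h x)" by (simp only:)
    then show "AE x in lborel. indicator ?B x *\<^sub>R h x = 0"
    proof (rule integral_boxes_zero_imp_AE_zero)
      fix a b :: "real^'n"
      obtain c d where cd: "box a b \<inter> ?B = box c d" by (rule that[OF box_Int_box])
      have "indicator (box a b) x *\<^sub>R indicator ?B x *\<^sub>R h x = indicator (box c d) x *\<^sub>R h x" for x
        unfolding cd[symmetric] by (simp add: indicator_def)
      then show "(LINT x|lborel. indicator (box a b) x *\<^sub>R indicator ?B x *\<^sub>R h x) = 0"
        by (simp only: schwartz_annihilator_box_integral[OF meas int zero])
    qed
  qed
  then show ?thesis
  proof eventually_elim
    fix x :: "real^'n" assume *: "\<forall>K::nat. indicator (box (- real K *\<^sub>R One) (real K *\<^sub>R One)) x *\<^sub>R h x = 0"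
    obtain K :: nat where K: "norm x < real K" using reals_Archimedean2 by blast
    then have "\<bar>x \<bullet> b\<bar> < real K" if "b \<in> Basis" for b using Basis_le_norm[OF that, of x] by linarith
    then have "x \<in> box (- real K *\<^sub>R One) (real K *\<^sub>R One)" by (force simp: mem_box abs_less_iff)
    with * show "g x = g' x" by (auto simp: h_def indicator_def dest: spec[of _ K])
  qed
qed

end

section \<open>Powers of extended nonnegative reals and Lebesgue quasi-norms\<close>

lemma epowr_ennreal: "0 \<le> x \<Longrightarrow> epowr (ennreal x) a = ennreal (x powr a)"
  by (simp add: epowr_def)

lemma epowr_top [simp]: "epowr \<infinity> a = \<infinity>" "epowr top a = top"
  by (simp_all add: epowr_def infinity_ennreal_def)

lemma ennreal_cases_real:
  obtains (real) r where "0 \<le> r" "x = ennreal r" | (top) "x = \<infinity>"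
  by (cases x) (auto simp: infinity_ennreal_def)

lemma epowr_mono: 
  assumes "x \<le> y" "0 \<le> a" shows "epowr x a \<le> epowr y a"
proof (cases y rule: ennreal_cases_real)
  case (real r)
  then obtain s where s: "0 \<le> s" "x = ennreal s" using assms(1) by (cases x rule: ennreal_cases_real) (auto simp: top_unique)
  then show ?thesis using real assms by (simp add: epowr_ennreal powr_mono2 ennreal_leI)
qed simp

lemma epowr_eq_top_iff: "epowr x a = \<infinity> \<longleftrightarrow> x = \<infinity>"
  by (simp add: epowr_def)

lemma epowr_1 [simp]: "epowr x 1 = x"
  by (cases x rule: ennreal_cases_real) (auto simp: epowr_ennreal)

lemma epowr_epowr: "epowr (epowr x a) b = epowr x (a * b)"
  by (cases x rule: ennreal_cases_real) (auto simp: epowr_ennreal powr_powr)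

lemma epowr_0_left: "epowr 0 a = 0"
  by (simp add: epowr_def)

lemma epowr_mult: "epowr (x * y) a = epowr x a * epowr y a"
proof (cases "x = 0 \<or> y = 0")
  case False
  then show ?thesis
  proof (cases x rule: ennreal_cases_real)
    case (real r)
    show ?thesis
    proof (cases y rule: ennreal_cases_real)
      case (real s)
      then show ?thesis using \<open>0 \<le> r\<close> \<open>x = ennreal r\<close> by (simp add: ennreal_mult[symmetric] epowr_ennreal powr_mult)
    next
      case top
      have "epowr x a \<noteq> 0" using False real by (auto simp: epowr_ennreal ennreal_eq_0_iff)
      then show ?thesis using False top by (simp add: ennreal_mult_top infinity_ennreal_def)
    qed
  next
    case top
    have "epowr y a \<noteq> 0" using False by (cases y rule: ennreal_cases_real) (auto simp: epowr_ennreal ennreal_eq_0_iff)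
    then show ?thesis using False top by (simp add: ennreal_top_mult infinity_ennreal_def)
  qed
qed (auto simp: epowr_0_left)

lemma measurable_epowr [measurable]:
  assumes [measurable]: "f \<in> borel_measurable M"
  shows "(\<lambda>x. epowr (f x) a) \<in> borel_measurable M"
  unfolding epowr_def by measurable

lemma Lp_norm_1: "Lp_norm 1 f = (\<integral>\<^sup>+x. ennreal (norm (f x)) \<partial>lborel)"
  by (simp add: Lp_norm_def recip_def)

lemma Lp_norm_cong_AE:
  assumes "AE x in lborel. f x = g x" and [measurable]: "f \<in> borel_measurable borel" "g \<in> borel_measurable borel"
  shows "Lp_norm p f = Lp_norm p g"
proof (cases "p = \<infinity>")
  case True
  have "AE x in lborel. ennreal (norm (f x)) = ennreal (norm (g x))" using assms(1) by eventually_elim simp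
  then show ?thesis using True by (simp add: Lp_norm_def esssup_AE_cong)
next
  case False
  have "AE x in lborel. epowr (ennreal (norm (f x))) (enn2real p) = epowr (ennreal (norm (g x))) (enn2real p)"
    using assms(1) by eventually_elim simp
  then have "(\<integral>\<^sup>+x. epowr (ennreal (norm (f x))) (enn2real p) \<partial>lborel) = (\<integral>\<^sup>+x. epowr (ennreal (norm (g x))) (enn2real p) \<partial>lborel)"
    by (rule nn_integral_cong_AE)
  then show ?thesis using False by (simp add: Lp_norm_def)
qed

lemma represents_measurable: "represents g u \<Longrightarrow> g \<in> borel_measurable borel"
  by (simp add: represents_def)

text \<open>By uniqueness of representatives the infimum in \<open>distr_Lp_norm\<close> ranges over a single value.\<close>

lemma (in alpha_partition) distr_Lp_norm_eq:
  assumes g: "represents g (u :: 'n distr)"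
  shows "distr_Lp_norm p u = Lp_norm p g"
proof -
  have "Lp_norm p g' = Lp_norm p g" if "represents g' u" for g'
    using Lp_norm_cong_AE[OF represents_unique[OF that g] represents_measurable[OF that] represents_measurable[OF g]] .
  then have "(INF g'\<in>{g. represents g u}. Lp_norm p g') = (INF g'\<in>{g. represents g u}. Lp_norm p g)"
    by (intro INF_cong) auto
  moreover have "{g. represents g u} \<noteq> {}" using g by blast
  ultimately show ?thesis unfolding distr_Lp_norm_def by simp
qed

lemma distr_Lp_norm_finite_imp_represents:
  assumes "distr_Lp_norm p u < \<infinity>" obtains g where "represents g u"
proof -
  have "{g. represents g u} \<noteq> {}"
  proof
    assume "{g. represents g u} = {}"
    then have "distr_Lp_norm p u = top" unfolding distr_Lp_norm_def by simp
    then show False using assms by (simp add: infinity_ennreal_def)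
  qed
  then show ?thesis using that by blast
qed

lemma represents_regular:
  assumes "g \<in> borel_measurable borel" "\<And>\<phi>. \<phi> \<in> schwartz \<Longrightarrow> integrable lborel (\<lambda>x. g x * \<phi> x)"
  shows "represents g (regular_distr g)"
  using assms by (simp add: represents_def)

lemma represents_regular_integrable:
  fixes g :: "real^'n::finite \<Rightarrow> complex"
  assumes "integrable lborel g"
  shows "represents g (regular_distr g)"
proof (rule represents_regular)
  show [measurable]: "g \<in> borel_measurable borel" using assms by auto
  fix \<phi> :: "real^'n \<Rightarrow> complex" assume \<phi>: "\<phi> \<in> schwartz"
  have [measurable]: "\<phi> \<in> borel_measurable borel" using schwartz_measurable[OF \<phi>] .
  obtain A where A: "0 < A" "\<And>x. norm (\<phi> x) \<le> A" by (rule schwartz_bounded[OF \<phi>]) blast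
  show "integrable lborel (\<lambda>x. g x * \<phi> x)"
  proof (rule Bochner_Integration.integrable_bound)
    show "integrable lborel (\<lambda>x. norm (g x) * A)" using assms by simp
    show "AE x in lborel. norm (g x * \<phi> x) \<le> norm (norm (g x) * A)"
      using A by (intro AE_I2) (simp add: norm_mult mult_left_mono)
  qed measurable
qed

section \<open>A Bernstein inequality below exponent one\<close>

text \<open>From \<open>\<bar>f\<bar> \<le> B * T\<close> with \<open>T\<close> the \<open>L\<^sup>1\<close> norm one gets
  \<open>T = \<integral> \<bar>f\<bar>\<^bsup>1 - t\<^esup> \<bar>f\<bar>\<^sup>t \<le> (B T)\<^bsup>1 - t\<^esup> \<integral> \<bar>f\<bar>\<^sup>t\<close>, and the finite \<open>T\<close> can be absorbed.\<close>

lemma L1_le_Lp_of_sup_le_L1: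
  fixes f :: "real^'n::finite \<Rightarrow> complex"
  assumes f: "integrable lborel f" and t: "0 < t" "t \<le> 1" and B: "0 < B"
    and sup: "AE x in lborel. norm (f x) \<le> B * (LINT x|lborel. norm (f x))"
  shows "(\<integral>\<^sup>+x. ennreal (norm (f x)) \<partial>lborel)
     \<le> ennreal (B powr (1 / t - 1)) * epowr (\<integral>\<^sup>+x. epowr (ennreal (norm (f x))) t \<partial>lborel) (1 / t)"
proof -
  define T where "T = (LINT x|lborel. norm (f x))"
  define J where "J = (\<integral>\<^sup>+x. epowr (ennreal (norm (f x))) t \<partial>lborel)"
  have [measurable]: "f \<in> borel_measurable borel" using f by auto
  have T0: "0 \<le> T" unfolding T_def by (rule integral_nonneg_AE) simp
  have TE: "(\<integral>\<^sup>+x. ennreal (norm (f x)) \<partial>lborel) = ennreal T"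
    unfolding T_def by (rule nn_integral_eq_integral) (use f in auto)
  show ?thesis
  proof (cases "T = 0")
    case False
    then have T: "0 < T" using T0 by simp
    have "(\<integral>\<^sup>+x. ennreal (norm (f x)) \<partial>lborel) \<le> (\<integral>\<^sup>+x. ennreal ((B * T) powr (1 - t)) * epowr (ennreal (norm (f x))) t \<partial>lborel)"
    proof (rule nn_integral_mono_AE)
      show "AE x in lborel. ennreal (norm (f x)) \<le> ennreal ((B * T) powr (1 - t)) * epowr (ennreal (norm (f x))) t"
        using sup unfolding T_def[symmetric]
      proof eventually_elim
        fix x assume x: "norm (f x) \<le> B * T"
        have "norm (f x) = norm (f x) powr (1 - t) * norm (f x) powr t"
          by (simp add: powr_add[symmetric])
        also have "\<dots> \<le> (B * T) powr (1 - t) * norm (f x) powr t"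
          using x t by (intro mult_right_mono powr_mono2) auto
        finally show "ennreal (norm (f x)) \<le> ennreal ((B * T) powr (1 - t)) * epowr (ennreal (norm (f x))) t"
          by (simp add: epowr_ennreal ennreal_mult[symmetric] ennreal_leI)
      qed
    qed
    also have "\<dots> = ennreal ((B * T) powr (1 - t)) * J"
      unfolding J_def by (rule nn_integral_cmult) measurable
    finally have TJ: "ennreal T \<le> ennreal ((B * T) powr (1 - t)) * J" by (simp only: TE)
    show ?thesis
    proof (cases J rule: ennreal_cases_real)
      case (real j)
      have "T \<le> (B * T) powr (1 - t) * j"
        using TJ real T B by (simp add: ennreal_mult[symmetric])
      then have "T powr (1 - t) * T powr t \<le> T powr (1 - t) * (B powr (1 - t) * j)"
        using T B by (simp add: powr_add[symmetric] powr_mult mult_ac)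
      then have "T powr t \<le> B powr (1 - t) * j" using T by simp
      then have "(T powr t) powr (1 / t) \<le> (B powr (1 - t) * j) powr (1 / t)"
        using t by (intro powr_mono2) auto
      moreover have "(T powr t) powr (1 / t) = T" using T t by (simp add: powr_powr)
      moreover have "(B powr (1 - t) * j) powr (1 / t) = B powr (1 / t - 1) * j powr (1 / t)"
        using t real B by (simp add: powr_mult powr_powr diff_divide_distrib)
      ultimately have "T \<le> B powr (1 / t - 1) * j powr (1 / t)" by simp
      then show ?thesis unfolding TE J_def[symmetric] real(2) using real(1)
        by (simp add: epowr_ennreal ennreal_mult[symmetric] ennreal_leI)
    next
      case top
      then show ?thesis unfolding J_def[symmetric] using B by (simp add: ennreal_mult_top infinity_ennreal_def)
    qed
  qed (simp add: TE)
qed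

context alpha_partition
begin

text \<open>The margin of one radius around the support of \<open>\<eta> k\<close> leaves room for the spectral spreading caused
  by the regularisation in the proof of Bernstein's inequality.\<close>

definition plateau :: "int^'n \<Rightarrow> real^'n \<Rightarrow> complex" where
  "plateau k \<xi> = cutoff (supp_const + 1) ((1 / rad k) *\<^sub>R (\<xi> - cen k))"

lemma plateau_affine: "plateau k = (\<lambda>\<xi>. cutoff (supp_const + 1) (- ((1 / rad k) *\<^sub>R cen k) + (1 / rad k) *\<^sub>R \<xi>))"
  by (simp add: plateau_def fun_eq_iff scaleR_diff_right)

lemma plateau_schwartz: "plateau k \<in> schwartz"
  unfolding plateau_affine using rad_pos[of k] by (intro schwartz_affine cutoff_schwartz) auto

lemma plateau_eq_1: "norm (\<xi> - cen k) \<le> (supp_const + 1) * rad k \<Longrightarrow> plateau k \<xi> = 1"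
  unfolding plateau_def using rad_pos[of k] by (intro cutoff_eq_1) (simp add: pos_divide_le_eq)

lemma norm_inv_fourier_plateau_le:
  "norm (inv_fourier (plateau k) x) \<le> rad k ^ CARD('n) * (LINT x|lborel. norm (cutoff (supp_const + 1) x))"
proof -
  have "norm (inv_fourier (plateau k) x) \<le> (LINT \<xi>|lborel. norm (plateau k \<xi>))"
    unfolding inv_fourier_eq by (rule norm_fourier_le[OF schwartz_integrable[OF plateau_schwartz]])
  also have "\<dots> = \<bar>rad k\<bar> ^ DIM(real^'n) *\<^sub>R (LINT x|lborel. norm (plateau k (cen k + rad k *\<^sub>R x)))"
    using rad_pos[of k] by (intro integral_affine) auto
  also have "\<dots> = rad k ^ CARD('n) * (LINT x|lborel. norm (cutoff (supp_const + 1) x))"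
    using rad_pos[of k] by (simp add: plateau_def)
  finally show ?thesis .
qed

lemma fourier_mult_eq_0:
  assumes u: "u \<in> tempered" and \<phi>: "\<phi> \<in> schwartz"
    and 0: "\<And>\<xi>. norm (\<xi> - cen k) < supp_const * rad k \<Longrightarrow> inv_fourier \<phi> \<xi> = 0"
  shows "fourier_mult (\<eta> k) u \<phi> = 0"
proof -
  have "(\<lambda>\<xi>. \<eta> k \<xi> * inv_fourier \<phi> \<xi>) = (\<lambda>\<xi>. 0)"
  proof
    fix \<xi> show "\<eta> k \<xi> * inv_fourier \<phi> \<xi> = 0"
      using 0[of \<xi>] eta_support[of k \<xi>] by (cases "\<eta> k \<xi> = 0") auto
  qed
  moreover have "fourier (\<lambda>x::real^'n. 0) = (\<lambda>\<xi>. 0)" by (simp add: fourier_wave fun_eq_iff)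
  ultimately show ?thesis by (simp only: fourier_mult_apply[OF eta_schwartz \<phi>] tempered_zero[OF u])
qed

text \<open>A product becomes a convolution: the spectrum of \<open>fourier \<psi>\<close> is smeared out at scale \<open>d\<close>.\<close>

lemma inv_fourier_dilated_product:
  fixes \<rho> \<psi> :: "real^'n \<Rightarrow> complex"
  assumes \<rho>: "\<rho> \<in> schwartz" and \<psi>: "\<psi> \<in> schwartz"
  shows "inv_fourier (\<lambda>x. fourier \<rho> (d *\<^sub>R x) * fourier \<psi> x) \<xi> = (LINT y|lborel. \<rho> y * \<psi> (\<xi> - d *\<^sub>R y))"
proof -
  have i: "integrable lborel \<rho>" "integrable lborel (fourier \<psi>)"
    using schwartz_integrable \<rho> schwartz_fourier[OF \<psi>] by blast+
  have "inv_fourier (\<lambda>x. fourier \<rho> (d *\<^sub>R x) * fourier \<psi> x) \<xi> = (LINT x|lborel. LINT y|lborel. \<rho> y * fourier \<psi> x * wave (\<xi> - d *\<^sub>R y) x)"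
  proof -
    have "fourier \<rho> (d *\<^sub>R x) * fourier \<psi> x * wave \<xi> x = (LINT y|lborel. \<rho> y * fourier \<psi> x * wave (\<xi> - d *\<^sub>R y) x)" for x
    proof -
      have w: "wave (\<xi> - d *\<^sub>R y) x = wave (- (d *\<^sub>R x)) y * wave \<xi> x" for y
        by (simp add: wave_def exp_add[symmetric] inner_diff_right inner_commute algebra_simps)
      have "(LINT y|lborel. \<rho> y * fourier \<psi> x * wave (\<xi> - d *\<^sub>R y) x) = (LINT y|lborel. (\<rho> y * wave (- (d *\<^sub>R x)) y) * (fourier \<psi> x * wave \<xi> x))"
        by (simp only: w mult_ac)
      also have "\<dots> = fourier \<rho> (d *\<^sub>R x) * (fourier \<psi> x * wave \<xi> x)" unfolding fourier_wave[of \<rho>] by (rule integral_mult_left_zero)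
      finally show ?thesis by (simp only: mult.assoc)
    qed
    then show ?thesis by (simp only: inv_fourier_wave)
  qed
  also have "\<dots> = (LINT y|lborel. LINT x|lborel. \<rho> y * fourier \<psi> x * wave (\<xi> - d *\<^sub>R y) x)"
    by (rule fubini_bounded_kernel[OF i, symmetric]) auto
  also have "\<dots> = (LINT y|lborel. \<rho> y * \<psi> (\<xi> - d *\<^sub>R y))"
  proof -
    have "(LINT x|lborel. \<rho> y * fourier \<psi> x * wave (\<xi> - d *\<^sub>R y) x) = \<rho> y * \<psi> (\<xi> - d *\<^sub>R y)" for y
      using inv_fourier_fourier[OF \<psi>] inv_fourier_wave[of "fourier \<psi>" "\<xi> - d *\<^sub>R y"]
      by (simp only: mult.assoc integral_mult_right_zero)
    then show ?thesis by simp
  qed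
  finally show ?thesis .
qed

lemma fourier_mult_inv_fourier_conv:
  fixes \<theta> \<phi> :: "real^'n \<Rightarrow> complex"
  assumes \<theta>: "\<theta> \<in> schwartz" and \<phi>: "\<phi> \<in> schwartz"
  shows "fourier (\<lambda>\<xi>. \<theta> \<xi> * inv_fourier \<phi> \<xi>) x = (LINT y|lborel. \<phi> y * inv_fourier \<theta> (y - x))"
proof -
  have "fourier (\<lambda>\<xi>. \<theta> \<xi> * inv_fourier \<phi> \<xi>) x = (LINT \<xi>|lborel. LINT y|lborel. \<theta> \<xi> * \<phi> y * wave (y - x) \<xi>)"
  proof -
    have "\<theta> \<xi> * inv_fourier \<phi> \<xi> * wave (- x) \<xi> = (LINT y|lborel. \<theta> \<xi> * \<phi> y * wave (y - x) \<xi>)" for \<xi>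
    proof -
      have w: "wave (y - x) \<xi> = wave \<xi> y * wave (- x) \<xi>" for y
        by (simp add: wave_def exp_add[symmetric] inner_diff_right inner_commute algebra_simps)
      have "(LINT y|lborel. \<theta> \<xi> * \<phi> y * wave (y - x) \<xi>) = (LINT y|lborel. (\<phi> y * wave \<xi> y) * (\<theta> \<xi> * wave (- x) \<xi>))"
        by (simp only: w mult_ac)
      also have "\<dots> = inv_fourier \<phi> \<xi> * (\<theta> \<xi> * wave (- x) \<xi>)" unfolding inv_fourier_wave by (rule integral_mult_left_zero)
      finally show ?thesis by (simp only: mult_ac)
    qed
    then show ?thesis by (simp only: fourier_wave)
  qed
  also have "\<dots> = (LINT y|lborel. LINT \<xi>|lborel. \<theta> \<xi> * \<phi> y * wave (y - x) \<xi>)"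
    by (rule fubini_bounded_kernel) (auto intro: schwartz_integrable \<theta> \<phi>)
  also have "\<dots> = (LINT y|lborel. \<phi> y * inv_fourier \<theta> (y - x))"
  proof -
    have "(LINT \<xi>|lborel. \<theta> \<xi> * \<phi> y * wave (y - x) \<xi>) = (LINT \<xi>|lborel. \<phi> y * (\<theta> \<xi> * wave (y - x) \<xi>))" for y
      by (simp only: mult_ac)
    then show ?thesis by (simp only: integral_mult_right_zero inv_fourier_wave)
  qed
  finally show ?thesis .
qed


text \<open>The factor \<open>fourier \<rho> (d x)\<close> spreads the spectrum of \<open>\<eta> k\<close> by less than one radius, so the
  plateau multiplier still acts as the identity on the product.\<close>

lemma plateau_reproduces:
  fixes d :: real
  assumes u: "u \<in> tempered" and g: "represents g (fourier_mult (\<eta> k) u)"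
    and \<rho>: "\<rho> \<in> schwartz" "\<And>x. \<rho> x \<noteq> 0 \<Longrightarrow> norm x < supp_const" and d: "0 < d" "d * supp_const \<le> 1"
    and \<phi>: "\<phi> \<in> schwartz"
  shows "(LINT x|lborel. (g x * fourier \<rho> (d *\<^sub>R x)) * \<phi> x)
     = (LINT x|lborel. (g x * fourier \<rho> (d *\<^sub>R x)) * fourier (\<lambda>\<xi>. plateau k \<xi> * inv_fourier \<phi> \<xi>) x)"
proof -
  define \<psi> where "\<psi> \<xi> = inv_fourier \<phi> \<xi> + (- 1) * (plateau k \<xi> * inv_fourier \<phi> \<xi>)" for \<xi>
  define \<tau> where "\<tau> = (\<lambda>\<xi>. plateau k \<xi> * inv_fourier \<phi> \<xi>)"
  have \<tau>: "\<tau> \<in> schwartz" unfolding \<tau>_def by (intro schwartz_mult plateau_schwartz schwartz_inv_fourier \<phi>)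
  have \<psi>: "\<psi> \<in> schwartz" unfolding \<psi>_def[abs_def]
    by (intro schwartz_add schwartz_cmul schwartz_mult plateau_schwartz schwartz_inv_fourier \<phi>)
  have F\<psi>: "fourier \<psi> = (\<lambda>x. \<phi> x + (- 1) * fourier \<tau> x)"
    unfolding \<psi>_def[abs_def] \<tau>_def[symmetric]
    using fourier_add[OF schwartz_integrable[OF schwartz_inv_fourier[OF \<phi>]] schwartz_integrable[OF schwartz_cmul[OF \<tau>, of "-1"]]]
    unfolding \<tau>_def by (simp only: fourier_cmul fourier_inv_fourier[OF \<phi>])
  define \<kappa> where "\<kappa> = (\<lambda>x::real^'n. fourier \<rho> (0 + d *\<^sub>R x))"
  have \<kappa>: "\<kappa> \<in> schwartz" unfolding \<kappa>_def using d by (intro schwartz_affine schwartz_fourier \<rho>) auto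
  have w: "fourier_mult (\<eta> k) u \<beta> = (LINT x|lborel. g x * \<beta> x)" if "\<beta> \<in> schwartz" for \<beta>
    using g that by (simp add: represents_def regular_distr_def)
  have wi: "integrable lborel (\<lambda>x. g x * \<beta> x)" if "\<beta> \<in> schwartz" for \<beta>
    using g that by (simp add: represents_def)
  have \<beta>: "(\<lambda>x. \<kappa> x * fourier \<psi> x) \<in> schwartz" by (intro schwartz_mult \<kappa> schwartz_fourier \<psi>)
  have "fourier_mult (\<eta> k) u (\<lambda>x. \<kappa> x * fourier \<psi> x) = 0"
  proof (rule fourier_mult_eq_0[OF u \<beta>])
    fix \<xi> assume \<xi>: "norm (\<xi> - cen k) < supp_const * rad k"
    have "\<rho> y * \<psi> (\<xi> - d *\<^sub>R y) = 0" for y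
    proof (cases "\<rho> y = 0")
      case False
      have "norm (\<xi> - d *\<^sub>R y - cen k) \<le> norm (\<xi> - cen k) + norm (d *\<^sub>R y)"
        using norm_triangle_ineq4[of "\<xi> - cen k" "d *\<^sub>R y"] by (simp add: algebra_simps)
      also have "norm (d *\<^sub>R y) \<le> d * supp_const" using \<rho>(2)[OF False] d by (simp add: mult_left_mono)
      also have "\<dots> \<le> rad k" using d(2) rad_ge_1[of k] by linarith
      finally have "plateau k (\<xi> - d *\<^sub>R y) = 1" using \<xi> by (intro plateau_eq_1) (simp add: algebra_simps)
      then show ?thesis by (simp add: \<psi>_def)
    qed simp
    then have "(LINT y|lborel. \<rho> y * \<psi> (\<xi> - d *\<^sub>R y)) = 0" by (simp only: integral_zero)
    then show "inv_fourier (\<lambda>x. \<kappa> x * fourier \<psi> x) \<xi> = 0"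
      using inv_fourier_dilated_product[OF \<rho>(1) \<psi>, of d \<xi>] by (simp add: \<kappa>_def)
  qed
  then have "0 = (LINT x|lborel. g x * (\<kappa> x * fourier \<psi> x))" using w[OF \<beta>] by simp
  also have "\<dots> = (LINT x|lborel. g x * (\<kappa> x * \<phi> x) - g x * (\<kappa> x * fourier \<tau> x))"
    unfolding F\<psi> by (intro Bochner_Integration.integral_cong) (auto simp: algebra_simps)
  also have "\<dots> = (LINT x|lborel. g x * (\<kappa> x * \<phi> x)) - (LINT x|lborel. g x * (\<kappa> x * fourier \<tau> x))"
    by (intro Bochner_Integration.integral_diff wi schwartz_mult \<kappa> \<phi> schwartz_fourier \<tau>)
  finally show ?thesis unfolding \<tau>_def[symmetric] by (simp add: \<kappa>_def mult.assoc)
qed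

lemma regularised_sup_bound:
  fixes d :: real
  assumes u: "u \<in> tempered" and g: "represents g (fourier_mult (\<eta> k) u)"
    and \<rho>: "\<rho> \<in> schwartz" "\<And>x. \<rho> x \<noteq> 0 \<Longrightarrow> norm x < supp_const" and d: "0 < d" "d * supp_const \<le> 1"
    and B: "0 < B" "\<And>x. norm (inv_fourier (plateau k) x) \<le> B"
  defines "f \<equiv> \<lambda>x. g x * fourier \<rho> (d *\<^sub>R x)"
  shows "integrable lborel f" "AE x in lborel. norm (f x) \<le> B * (LINT x|lborel. norm (f x))"
proof -
  have "(\<lambda>x::real^'n. fourier \<rho> (0 + d *\<^sub>R x)) \<in> schwartz" using d by (intro schwartz_affine schwartz_fourier \<rho>) auto
  then show int: "integrable lborel f" using g unfolding f_def by (simp add: represents_def)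
  have [measurable]: "f \<in> borel_measurable borel" using int by auto
  define \<Phi> where "\<Phi> = inv_fourier (plateau k)"
  have \<Phi>: "\<Phi> \<in> schwartz" unfolding \<Phi>_def by (intro schwartz_inv_fourier plateau_schwartz)
  have [measurable]: "\<Phi> \<in> borel_measurable borel" using schwartz_measurable[OF \<Phi>] .
  define G where "G y = (LINT x|lborel. f x * \<Phi> (y - x))" for y
  have Gm [measurable]: "G \<in> borel_measurable borel"
    unfolding G_def[abs_def] by (rule lborel.borel_measurable_lebesgue_integral) measurable
  have Gb: "norm (G y) \<le> B * (LINT x|lborel. norm (f x))" for y
  proof -
    have "norm (G y) \<le> (LINT x|lborel. B * norm (f x))"
      unfolding G_def
    proof (rule lborel_norm_integral_le)
      show "integrable lborel (\<lambda>x. B * norm (f x))" using int by simp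
      show le: "norm (f x * \<Phi> (y - x)) \<le> B * norm (f x)" for x
        using mult_right_mono[OF B(2)[of "y - x"] norm_ge_zero[of "f x"]] by (simp add: norm_mult \<Phi>_def mult.commute)
      show "integrable lborel (\<lambda>x. f x * \<Phi> (y - x))"
        by (rule Bochner_Integration.integrable_bound[OF \<open>integrable lborel (\<lambda>x. B * norm (f x))\<close>])
          (use le B in \<open>auto simp: abs_mult\<close>)
    qed
    then show ?thesis by simp
  qed
  have Gi: "integrable lborel (\<lambda>y. G y * \<phi> y)" if \<phi>: "\<phi> \<in> schwartz" for \<phi>
  proof (rule Bochner_Integration.integrable_bound)
    show "integrable lborel (\<lambda>y. (B * (LINT x|lborel. norm (f x))) * norm (\<phi> y))"
      by (intro integrable_mult_right integrable_norm schwartz_integrable \<phi>)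
    have [measurable]: "\<phi> \<in> borel_measurable borel" using schwartz_measurable[OF \<phi>] .
    show "(\<lambda>y. G y * \<phi> y) \<in> borel_measurable lborel" by measurable
    show "AE y in lborel. norm (G y * \<phi> y) \<le> norm ((B * (LINT x|lborel. norm (f x))) * norm (\<phi> y))"
    proof (intro AE_I2)
      fix y
      have "norm (G y * \<phi> y) \<le> (B * (LINT x|lborel. norm (f x))) * norm (\<phi> y)"
        using Gb[of y] by (simp add: norm_mult mult_right_mono)
      also have "\<dots> \<le> norm ((B * (LINT x|lborel. norm (f x))) * norm (\<phi> y))" by simp
      finally show "norm (G y * \<phi> y) \<le> norm ((B * (LINT x|lborel. norm (f x))) * norm (\<phi> y))" .
    qed
  qed
  have eq: "(LINT x|lborel. f x * \<phi> x) = (LINT y|lborel. G y * \<phi> y)" if \<phi>: "\<phi> \<in> schwartz" for \<phi>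
  proof -
    have "(LINT x|lborel. f x * \<phi> x) = (LINT x|lborel. f x * fourier (\<lambda>\<xi>. plateau k \<xi> * inv_fourier \<phi> \<xi>) x)"
      unfolding f_def by (rule plateau_reproduces[OF u g \<rho> d \<phi>])
    also have "\<dots> = (LINT x|lborel. LINT y|lborel. B *\<^sub>R (f x * \<phi> y * (\<Phi> (y - x) / B)))"
    proof -
      have "f x * fourier (\<lambda>\<xi>. plateau k \<xi> * inv_fourier \<phi> \<xi>) x = (LINT y|lborel. B *\<^sub>R (f x * \<phi> y * (\<Phi> (y - x) / B)))" for x
      proof -
        have "f x * fourier (\<lambda>\<xi>. plateau k \<xi> * inv_fourier \<phi> \<xi>) x = (LINT y|lborel. f x * (\<phi> y * \<Phi> (y - x)))"
          unfolding fourier_mult_inv_fourier_conv[OF plateau_schwartz \<phi>] \<Phi>_def by (rule integral_mult_right_zero[symmetric])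
        also have "\<dots> = (LINT y|lborel. B *\<^sub>R (f x * \<phi> y * (\<Phi> (y - x) / B)))"
          using B(1) by (intro Bochner_Integration.integral_cong) (auto simp: scaleR_conv_of_real)
        finally show ?thesis .
      qed
      then show ?thesis by simp
    qed
    also have "\<dots> = B *\<^sub>R (LINT x|lborel. LINT y|lborel. f x * \<phi> y * (\<Phi> (y - x) / B))"
      by (simp only: integral_scaleR_right)
    also have "(LINT x|lborel. LINT y|lborel. f x * \<phi> y * (\<Phi> (y - x) / B)) = (LINT y|lborel. LINT x|lborel. f x * \<phi> y * (\<Phi> (y - x) / B))"
      using B by (intro fubini_bounded_kernel int schwartz_integrable \<phi>) (auto simp: \<Phi>_def[symmetric] norm_divide divide_le_eq_1)
    also have "B *\<^sub>R \<dots> = (LINT y|lborel. LINT x|lborel. B *\<^sub>R (f x * \<phi> y * (\<Phi> (y - x) / B)))"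
      by (simp only: integral_scaleR_right)
    also have "\<dots> = (LINT y|lborel. G y * \<phi> y)"
    proof (intro Bochner_Integration.integral_cong refl)
      fix y
      have "(LINT x|lborel. B *\<^sub>R (f x * \<phi> y * (\<Phi> (y - x) / B))) = (LINT x|lborel. (f x * \<Phi> (y - x)) * \<phi> y)"
        using B(1) by (intro Bochner_Integration.integral_cong) (auto simp: scaleR_conv_of_real)
      then show "(LINT x|lborel. B *\<^sub>R (f x * \<phi> y * (\<Phi> (y - x) / B))) = G y * \<phi> y"
        unfolding G_def by (simp only: integral_mult_left_zero)
    qed
    finally show ?thesis .
  qed
  have "regular_distr f = regular_distr G"
    unfolding regular_distr_def using eq by (intro restrict_ext)
  then have "represents f (regular_distr G)" "represents G (regular_distr G)"
    using represents_regular_integrable[OF int] represents_regular[OF Gm Gi] by auto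
  from represents_unique[OF this]
  show "AE x in lborel. norm (f x) \<le> B * (LINT x|lborel. norm (f x))"
    by eventually_elim (simp add: Gb)
qed

text \<open>Below exponent one, a spectral localisation at scale \<open>rad k\<close> controls the \<open>L\<^sup>1\<close> norm by the
  \<open>L\<^sup>t\<close> quasi-norm. The regularised functions \<open>g x * fourier \<rho> (d x)\<close> are integrable, which
  makes the absorption argument legitimate; Fatou's lemma removes the regularisation.\<close>

theorem bernstein:
  assumes t: "0 < t" "t \<le> 1"
  shows "\<exists>C>0. \<forall>u k g. u \<in> tempered \<longrightarrow> represents g (fourier_mult (\<eta> k) u) \<longrightarrow>
     (\<integral>\<^sup>+x. ennreal (norm (g x)) \<partial>lborel)
       \<le> ennreal (C * rad k powr (real CARD('n) * (1 / t - 1))) * epowr (\<integral>\<^sup>+x. epowr (ennreal (norm (g x))) t \<partial>lborel) (1 / t)"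
proof -
  obtain \<rho> :: "real^'n \<Rightarrow> complex" where \<rho>: "\<rho> \<in> schwartz" "(LINT x|lborel. \<rho> x) = 1" "\<And>x. \<rho> x \<noteq> 0 \<Longrightarrow> norm x < supp_const"
    by (rule mollifier) blast
  obtain A where A: "0 < A" "\<And>x. norm (fourier \<rho> x) \<le> A"
    by (rule schwartz_bounded[OF schwartz_fourier[OF \<rho>(1)]]) blast
  define \<Lambda> where "\<Lambda> = (LINT x|lborel. norm (cutoff (supp_const + 1) x)) + 1"
  have \<Lambda>: "0 < \<Lambda>" unfolding \<Lambda>_def by (intro add_nonneg_pos integral_nonneg_AE) auto
  define C where "C = \<Lambda> powr (1 / t - 1) * A"
  have C: "0 < C" using \<Lambda> A by (simp add: C_def)
  have "(\<integral>\<^sup>+x. ennreal (norm (g x)) \<partial>lborel)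
       \<le> ennreal (C * rad k powr (real CARD('n) * (1 / t - 1))) * epowr (\<integral>\<^sup>+x. epowr (ennreal (norm (g x))) t \<partial>lborel) (1 / t)"
    if u: "u \<in> tempered" and g: "represents g (fourier_mult (\<eta> k) u)" for u k g
  proof -
    have gm [measurable]: "g \<in> borel_measurable borel" using represents_measurable[OF g] .
    define B where "B = rad k ^ CARD('n) * \<Lambda>"
    have B: "0 < B" "norm (inv_fourier (plateau k) x) \<le> B" for x
    proof -
      show "0 < B" using rad_pos[of k] \<Lambda> by (simp add: B_def)
      have "rad k ^ CARD('n) * (LINT x|lborel. norm (cutoff (supp_const + 1) x)) \<le> B"
        unfolding B_def \<Lambda>_def using rad_pos[of k] by (intro mult_left_mono) auto
      then show "norm (inv_fourier (plateau k) x) \<le> B" using norm_inv_fourier_plateau_le[of k x] by linarith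
    qed
    define I where "I = epowr (\<integral>\<^sup>+x. epowr (ennreal (norm (g x))) t \<partial>lborel) (1 / t)"
    define K where "K = ennreal (C * rad k powr (real CARD('n) * (1 / t - 1))) * I"
    define d where "d m = 1 / ((supp_const + 1) * real (Suc m))" for m
    have d: "0 < d m" "d m * supp_const \<le> 1" for m
    proof -
      show "0 < d m" using supp_const(1) by (simp add: d_def)
      have "supp_const * 1 \<le> (supp_const + 1) * real (Suc m)" using supp_const(1) by (intro mult_mono) auto
      then show "d m * supp_const \<le> 1" using supp_const(1) by (simp add: d_def divide_le_eq)
    qed
    have d0: "d \<longlonglongrightarrow> 0"
    proof -
      have "(\<lambda>m. (1 / (supp_const + 1)) * (1 / real (Suc m))) \<longlonglongrightarrow> (1 / (supp_const + 1)) * 0"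
        by (intro tendsto_mult_left) (use LIMSEQ_inverse_real_of_nat in \<open>simp add: inverse_eq_divide\<close>)
      then show ?thesis by (simp add: d_def[abs_def])
    qed
    define f where "f m x = g x * fourier \<rho> (d m *\<^sub>R x)" for m x
    have fm [measurable]: "f m \<in> borel_measurable borel" for m
      unfolding f_def[abs_def] using schwartz_measurable[OF schwartz_fourier[OF \<rho>(1)]] by measurable
    have bound: "(\<integral>\<^sup>+x. ennreal (norm (f m x)) \<partial>lborel) \<le> K" for m
    proof -
      note reg = regularised_sup_bound[OF u g \<rho>(1,3) d(1)[of m] d(2)[of m] B]
      have "(\<integral>\<^sup>+x. ennreal (norm (f m x)) \<partial>lborel)
        \<le> ennreal (B powr (1 / t - 1)) * epowr (\<integral>\<^sup>+x. epowr (ennreal (norm (f m x))) t \<partial>lborel) (1 / t)"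
        using reg unfolding f_def by (intro L1_le_Lp_of_sup_le_L1 t B) auto
      also have "\<dots> \<le> ennreal (B powr (1 / t - 1)) * (ennreal A * I)"
      proof (intro mult_left_mono)
        have "(\<integral>\<^sup>+x. epowr (ennreal (norm (f m x))) t \<partial>lborel) \<le> (\<integral>\<^sup>+x. epowr (ennreal A) t * epowr (ennreal (norm (g x))) t \<partial>lborel)"
        proof (intro nn_integral_mono)
          fix x
          have "norm (f m x) \<le> A * norm (g x)"
            using mult_left_mono[OF A(2)[of "d m *\<^sub>R x"] norm_ge_zero[of "g x"]] by (simp add: f_def norm_mult mult.commute)
          then have "ennreal (norm (f m x)) \<le> ennreal A * ennreal (norm (g x))"
            using A(1) by (simp add: ennreal_mult[symmetric] ennreal_leI)
          then show "epowr (ennreal (norm (f m x))) t \<le> epowr (ennreal A) t * epowr (ennreal (norm (g x))) t"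
            unfolding epowr_mult[symmetric] using t by (intro epowr_mono) auto
        qed
        also have "\<dots> = epowr (ennreal A) t * (\<integral>\<^sup>+x. epowr (ennreal (norm (g x))) t \<partial>lborel)"
          by (rule nn_integral_cmult) measurable
        finally have "epowr (\<integral>\<^sup>+x. epowr (ennreal (norm (f m x))) t \<partial>lborel) (1 / t) \<le>
          epowr (epowr (ennreal A) t * (\<integral>\<^sup>+x. epowr (ennreal (norm (g x))) t \<partial>lborel)) (1 / t)"
          using t by (intro epowr_mono) auto
        also have "\<dots> = ennreal A * I" using t by (simp add: epowr_mult epowr_epowr I_def)
        finally show "epowr (\<integral>\<^sup>+x. epowr (ennreal (norm (f m x))) t \<partial>lborel) (1 / t) \<le> ennreal A * I" .
      qed simp
      also have "\<dots> = K"
      proof -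
        have "B powr (1 / t - 1) = rad k powr (real CARD('n) * (1 / t - 1)) * \<Lambda> powr (1 / t - 1)"
          using rad_pos[of k] \<Lambda> by (simp add: B_def powr_mult powr_powr powr_realpow[symmetric])
        then have "B powr (1 / t - 1) * A = C * rad k powr (real CARD('n) * (1 / t - 1))"
          by (simp add: C_def)
        then show ?thesis using A(1) unfolding K_def mult.assoc[symmetric] by (simp add: ennreal_mult[symmetric])
      qed
      finally show ?thesis .
    qed
    have "(\<integral>\<^sup>+x. ennreal (norm (g x)) \<partial>lborel) = (\<integral>\<^sup>+x. liminf (\<lambda>m. ennreal (norm (f m x))) \<partial>lborel)"
    proof (rule nn_integral_cong)
      fix x :: "real^'n"
      have c: "isCont (fourier \<rho>) 0"
        using smooth_imp_continuous_on[OF schwartz_smooth[OF schwartz_fourier[OF \<rho>(1)]], of UNIV] by (simp add: continuous_on_eq_continuous_at)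
      have "(\<lambda>m. d m *\<^sub>R x) \<longlonglongrightarrow> 0 *\<^sub>R x" by (rule tendsto_scaleR[OF d0 tendsto_const])
      then have "(\<lambda>m. fourier \<rho> (d m *\<^sub>R x)) \<longlonglongrightarrow> fourier \<rho> 0" by (intro isCont_tendsto_compose[OF c]) simp
      moreover have "fourier \<rho> 0 = 1" using \<rho>(2) by (simp add: fourier_wave)
      ultimately have "(\<lambda>m. f m x) \<longlonglongrightarrow> g x * 1" unfolding f_def by (intro tendsto_mult_left) simp
      then have "(\<lambda>m. ennreal (norm (f m x))) \<longlonglongrightarrow> ennreal (norm (g x))"
        by (intro tendsto_ennrealI tendsto_norm) simp
      then show "ennreal (norm (g x)) = liminf (\<lambda>m. ennreal (norm (f m x)))"
        by (rule lim_imp_Liminf[OF sequentially_bot, symmetric])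
    qed
    also have "\<dots> \<le> liminf (\<lambda>m. \<integral>\<^sup>+x. ennreal (norm (f m x)) \<partial>lborel)"
      by (rule nn_integral_liminf) measurable
    also have "\<dots> \<le> liminf (\<lambda>m::nat. K)" using bound by (intro Liminf_mono always_eventually) auto
    also have "\<dots> = K" by (simp add: Liminf_const)
    finally show ?thesis unfolding K_def I_def .
  qed
  then show ?thesis using C by blast
qed

end

section \<open>Weighted sequence norms\<close>

text \<open>The quasi-norm of \<open>\<ell>\<^sup>q\<close>, in the shape in which it occurs in \<open>modulation_norm\<close>.\<close>

definition lq_norm :: "ennreal \<Rightarrow> ('i \<Rightarrow> ennreal) \<Rightarrow> ennreal" where
  "lq_norm q c = (if q = \<infinity> then (SUP k. c k) else epowr (\<Sum>\<^sub>\<infinity>k. epowr (c k) (enn2real q)) (recip q))"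

lemma enn2real_pos_of_finite: "0 < q \<Longrightarrow> q \<noteq> \<infinity> \<Longrightarrow> 0 < enn2real q"
  by (cases q rule: ennreal_cases_real) auto

lemma recip_eq: 
  assumes "0 < q" "q \<noteq> \<infinity>" shows "recip q = 1 / enn2real q"
proof -
  obtain r where r: "0 < r" "q = ennreal r" using assms by (cases q rule: ennreal_cases_real) auto
  have "1 / ennreal r = ennreal (1 / r)" using r divide_ennreal[of 1 r] by simp
  then show ?thesis using r by (simp add: recip_def)
qed

lemma recip_infinity: "recip \<infinity> = 0" "recip top = 0"
  by (simp_all add: recip_def infinity_ennreal_def)

lemma recip_ge_1_iff: 
  assumes "0 < q" shows "1 \<le> recip q \<longleftrightarrow> q \<le> 1"
proof (cases "q = \<infinity>")
  case True then show ?thesis by (simp add: recip_infinity infinity_ennreal_def top_unique)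
next
  case False
  then obtain r where r: "0 < r" "q = ennreal r" using assms by (cases q rule: ennreal_cases_real) auto
  then show ?thesis using recip_eq[OF assms False] by (simp add: le_divide_eq)
qed

lemma modulation_norm_eq_lq_norm:
  fixes \<eta> :: "int^'n::finite \<Rightarrow> real^'n \<Rightarrow> complex"
  assumes "0 < q"
  shows "modulation_norm \<eta> s \<alpha> p q u = lq_norm q (\<lambda>k. ennreal (jap k powr (s / (1 - \<alpha>))) * distr_Lp_norm p (fourier_mult (\<eta> k) u))"
proof (cases "q = \<infinity>")
  case False
  have "ennreal (jap k powr (s * enn2real q / (1 - \<alpha>))) = epowr (ennreal (jap k powr (s / (1 - \<alpha>)))) (enn2real q)" for k :: "int^'n"
    by (simp add: epowr_ennreal powr_powr)
  then show ?thesis using False by (simp add: modulation_norm_def lq_norm_def epowr_mult)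
qed (simp add: modulation_norm_def lq_norm_def)

lemma sum_le_infsum_ennreal: "finite F \<Longrightarrow> (\<Sum>k\<in>F. f k) \<le> (\<Sum>\<^sub>\<infinity>k. f k :: ennreal)"
  by (subst nonneg_infsum_complete) (auto intro: SUP_upper)

text \<open>Finite exponents are reduced to a vector \<open>c\<close> normalised by \<open>M = \<parallel>c\<parallel>\<close>: for
  \<open>q \<le> 1\<close> every \<open>c k / M\<close> is at most its \<open>q\<close>-th power, for \<open>q > 1\<close> Young's inequality applies.\<close>

lemma weighted_sum_le_lq_norm_finite:
  fixes w c :: "'i \<Rightarrow> real"
  assumes q: "0 < q" and w: "\<And>k. 0 \<le> w k" and c: "\<And>k. 0 \<le> c k" and M: "0 \<le> M"
    and cM: "\<And>F. finite F \<Longrightarrow> (\<Sum>k\<in>F. c k powr q) \<le> M powr q"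
    and small: "\<And>k. q \<le> 1 \<Longrightarrow> w k \<le> 1"
    and big: "\<And>F. 1 < q \<Longrightarrow> finite F \<Longrightarrow> (\<Sum>k\<in>F. w k powr (q / (q - 1))) \<le> K"
    and K: "0 \<le> K"
    and F: "finite F"
  shows "(\<Sum>k\<in>F. w k * c k) \<le> (K + 1) * M"
proof (cases "M = 0")
  case True
  have "c k = 0" for k
  proof -
    have "c k powr q \<le> 0" using cM[of "{k}"] True q by simp
    then have "c k powr q = 0" by (rule antisym) simp
    then show ?thesis by simp
  qed
  then show ?thesis using True by simp
next
  case False
  then have M: "0 < M" using M by simp
  define e where "e k = c k / M" for k
  have e: "0 \<le> e k" for k using c M by (simp add: e_def)
  have eF: "(\<Sum>k\<in>F. e k powr q) \<le> 1" if "finite F" for F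
  proof -
    have "(\<Sum>k\<in>F. e k powr q) = (\<Sum>k\<in>F. c k powr q) / M powr q"
      using c M by (simp add: e_def powr_divide sum_divide_distrib)
    also have "\<dots> \<le> 1" using cM[OF that] M by simp
    finally show ?thesis .
  qed
  have "(\<Sum>k\<in>F. w k * e k) \<le> K + 1"
  proof (cases "q \<le> 1")
    case True
    have "w k * e k \<le> e k powr q" for k
    proof -
      have "e k powr q \<le> 1" using eF[of "{k}"] by simp
      then have "e k \<le> 1" using e[of k] q by (metis less_eq_real_def not_le powr_less_mono2 powr_one_eq_one zero_le_one)
      then have "e k \<le> e k powr q" using e[of k] True powr_mono'[of q 1 "e k"] by simp
      moreover have "w k * e k \<le> 1 * e k" using small[OF True] e by (intro mult_right_mono)
      ultimately show ?thesis by simp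
    qed
    then have "(\<Sum>k\<in>F. w k * e k) \<le> (\<Sum>k\<in>F. e k powr q)" by (rule sum_mono)
    then show ?thesis using eF[OF F] K by simp
  next
    case False
    then have q1: "1 < q" by simp
    define q' where "q' = q / (q - 1)"
    have q': "1 < q'" "1 / q' + 1 / q = 1" using q1 by (auto simp: q'_def field_simps)
    have "w k * e k \<le> w k powr q' + e k powr q" for k
    proof -
      have "w k * e k \<le> w k powr q' / q' + e k powr q / q"
        using Youngs_inequality[OF q'(1) q1 q'(2) w e] .
      also have "w k powr q' / q' \<le> w k powr q'" using q' by (simp add: divide_le_eq mult_left_le[of 1, simplified] mult_le_cancel_left1)
      also have "e k powr q / q \<le> e k powr q" using q1 by (simp add: divide_le_eq mult_le_cancel_left1)
      finally show ?thesis by simp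
    qed
    then have "(\<Sum>k\<in>F. w k * e k) \<le> (\<Sum>k\<in>F. w k powr q' + e k powr q)" by (rule sum_mono)
    also have "\<dots> \<le> K + 1" using big[OF q1 F] eF[OF F] by (simp add: sum.distrib q'_def)
    finally show ?thesis .
  qed
  then have "(\<Sum>k\<in>F. w k * e k) * M \<le> (K + 1) * M" using M by simp
  moreover have "(\<Sum>k\<in>F. w k * e k) * M = (\<Sum>k\<in>F. w k * c k)"
    using M by (simp add: e_def sum_distrib_right)
  ultimately show ?thesis by simp
qed

lemma weighted_sum_le_lq_norm:
  fixes w :: "'i \<Rightarrow> real" and c :: "'i \<Rightarrow> ennreal"
  assumes q: "0 < q" and w: "\<And>k. 0 \<le> w k"
    and small: "\<And>k. q \<le> 1 \<Longrightarrow> w k \<le> 1"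
    and big: "\<And>F. 1 < q \<Longrightarrow> finite F \<Longrightarrow> (\<Sum>k\<in>F. w k powr (1 / (1 - recip q))) \<le> K"
    and K: "0 \<le> K" and F: "finite F"
  shows "(\<Sum>k\<in>F. ennreal (w k) * c k) \<le> ennreal (K + 1) * lq_norm q c"
proof (cases "lq_norm q c" rule: ennreal_cases_real)
  case top
  then show ?thesis using K by (simp add: ennreal_mult_top infinity_ennreal_def)
next
  case (real M)
  show ?thesis
  proof (cases "q = \<infinity>")
    case True
    have "(\<Sum>k\<in>F. ennreal (w k) * c k) \<le> (\<Sum>k\<in>F. ennreal (w k) * ennreal M)"
    proof (intro sum_mono mult_left_mono)
      show "c k \<le> ennreal M" for k using real(2) True by (auto simp: lq_norm_def intro: SUP_upper[of k UNIV c, simplified] elim!: subst)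
    qed simp
    also have "\<dots> = ennreal (\<Sum>k\<in>F. w k) * ennreal M"
      using w by (simp add: sum_distrib_right[symmetric] sum_ennreal)
    also have "\<dots> \<le> ennreal (K + 1) * ennreal M"
    proof (intro mult_right_mono ennreal_leI)
      have "1 < q" using True by (simp add: infinity_ennreal_def)
      from big[OF this F] w have "(\<Sum>k\<in>F. w k) \<le> K" by (simp add: True recip_infinity)
      then show "(\<Sum>k\<in>F. w k) \<le> K + 1" by simp
    qed simp
    finally show ?thesis using real by simp
  next
    case False
    define r where "r = enn2real q"
    have r: "0 < r" "q = ennreal r" "recip q = 1 / r"
      using enn2real_pos_of_finite[OF q False] recip_eq[OF q False] False
      by (auto simp: r_def ennreal_enn2real infinity_ennreal_def less_top)
    define S where "S = (\<Sum>\<^sub>\<infinity>k. epowr (c k) r)"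
    have SM: "epowr S (1 / r) = ennreal M" using real(2) False r by (simp add: lq_norm_def S_def r_def[symmetric])
    have "S \<noteq> \<infinity>" using SM epowr_eq_top_iff[of S "1 / r"] by (auto simp: infinity_ennreal_def)
    have "S = epowr (epowr S (1 / r)) r" using r by (simp add: epowr_epowr)
    also have "\<dots> = ennreal (M powr r)" using real(1) by (simp add: SM epowr_ennreal)
    finally have S: "S = ennreal (M powr r)" .
    have ck: "epowr (c k) r \<le> S" for k
      using sum_le_infsum_ennreal[of "{k}" "\<lambda>k. epowr (c k) r"] by (simp add: S_def)
    have "c k \<noteq> \<infinity>" for k
    proof
      assume "c k = \<infinity>"
      then have "S = \<infinity>" using ck[of k] by (simp add: infinity_ennreal_def top_unique)
      then show False using \<open>S \<noteq> \<infinity>\<close> by simp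
    qed
    moreover define b where "b k = enn2real (c k)" for k
    ultimately have b: "0 \<le> b k" "c k = ennreal (b k)" for k
      by (simp_all add: infinity_ennreal_def less_top)
    have "(\<Sum>k\<in>F. w k * b k) \<le> (K + 1) * M"
    proof (rule weighted_sum_le_lq_norm_finite[where q=r])
      fix F :: "'i set" assume F: "finite F"
      have "ennreal (\<Sum>k\<in>F. b k powr r) = (\<Sum>k\<in>F. epowr (c k) r)"
        using b by (simp add: epowr_ennreal sum_ennreal)
      also have "\<dots> \<le> S" unfolding S_def by (rule sum_le_infsum_ennreal[OF F])
      finally show "(\<Sum>k\<in>F. b k powr r) \<le> M powr r" unfolding S by simp
    next
      fix k assume "r \<le> 1" then show "w k \<le> 1" using small r by simp
    next
      fix F :: "'i set" assume "1 < r" "finite F"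
      then have "1 < q" using r by (simp add: one_less_ennreal)
      moreover have "1 / (1 - recip q) = r / (r - 1)" using \<open>1 < r\<close> unfolding r(3) by (simp add: field_simps)
      ultimately show "(\<Sum>k\<in>F. w k powr (r / (r - 1))) \<le> K" using big[OF _ \<open>finite F\<close>] by simp
    qed (use r w b real K F in auto)
    then have "ennreal (\<Sum>k\<in>F. w k * b k) \<le> ennreal ((K + 1) * M)" by (rule ennreal_leI)
    also have "\<dots> = ennreal (K + 1) * lq_norm q c" unfolding real(2) using K real(1) by (intro ennreal_mult) auto
    also have "ennreal (\<Sum>k\<in>F. w k * b k) = (\<Sum>k\<in>F. ennreal (w k) * c k)"
      using w b by (simp add: ennreal_mult[symmetric] sum_ennreal)
    finally show ?thesis .
  qed
qed

section \<open>Sufficiency\<close>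

lemma infinite_lattice: "infinite (UNIV :: (int^'n::finite) set)"
proof
  assume fin: "finite (UNIV :: (int^'n) set)"
  obtain k :: "int^'n" where "(\<Sum>k\<in>(UNIV :: (int^'n) set). jap k) + 1 \<le> jap k" using lattice_unbounded by blast
  moreover have "jap k \<le> (\<Sum>k\<in>(UNIV :: (int^'n) set). jap k)"
    using fin japanese_pos by (intro member_le_sum) (auto intro: less_imp_le)
  ultimately show False by simp
qed

text \<open>Absolute convergence in \<open>L\<^sup>1\<close> lets the sum over the pieces be exchanged with the integral against a
  Schwartz function, so the sum of the representatives represents \<open>u\<close>.\<close>

lemma (in alpha_partition) tempered_eq_regular_distr_of_summable_pieces:
  fixes u :: "'n distr"
  assumes u: "u \<in> tempered" and g: "\<And>k. represents (g k) (fourier_mult (\<eta> k) u)"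
    and S: "\<And>F. finite F \<Longrightarrow> (\<Sum>k\<in>F. \<integral>\<^sup>+x. ennreal (norm (g k x)) \<partial>lborel) \<le> S" and fin: "S < \<infinity>"
  shows "\<exists>f. integrable lborel f \<and> u = regular_distr f \<and> (\<integral>\<^sup>+x. ennreal (norm (f x)) \<partial>lborel) \<le> S"
proof -
  define e where "e = from_nat_into (UNIV :: (int^'n) set)"
  have e: "bij e" unfolding e_def using bij_betw_from_nat_into[OF countableI_type infinite_lattice] .
  have [measurable]: "g k \<in> borel_measurable borel" for k using represents_measurable[OF g] .
  have "(\<integral>\<^sup>+x. ennreal (norm (g k x)) \<partial>lborel) < \<infinity>" for k
    using S[of "{k}"] fin by (simp add: order.strict_trans1)
  then have gi: "integrable lborel (g k)" for k by (intro integrableI_bounded) auto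
  have sumS: "(\<Sum>i. \<integral>\<^sup>+x. ennreal (norm (g (e i) x)) \<partial>lborel) \<le> S"
    unfolding suminf_eq_SUP
  proof (rule SUP_least)
    fix n
    have "(\<Sum>i<n. \<integral>\<^sup>+x. ennreal (norm (g (e i) x)) \<partial>lborel) = (\<Sum>k\<in>e ` {..<n}. \<integral>\<^sup>+x. ennreal (norm (g k x)) \<partial>lborel)"
      using e by (subst sum.reindex) (auto simp: bij_def intro: inj_on_subset)
    also have "\<dots> \<le> S" by (rule S) simp
    finally show "(\<Sum>i<n. \<integral>\<^sup>+x. ennreal (norm (g (e i) x)) \<partial>lborel) \<le> S" .
  qed
  have nnsum: "(\<integral>\<^sup>+x. (\<Sum>i. ennreal (norm (g (e i) x))) \<partial>lborel) \<le> S"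
    using sumS by (subst nn_integral_suminf) auto
  then have "(\<integral>\<^sup>+x. (\<Sum>i. ennreal (norm (g (e i) x))) \<partial>lborel) \<noteq> \<infinity>" using fin by auto
  then have "AE x in lborel. (\<Sum>i. ennreal (norm (g (e i) x))) \<noteq> \<infinity>"
    by (intro nn_integral_PInf_AE) auto
  then have AEs: "AE x in lborel. summable (\<lambda>i. norm (g (e i) x))"
    by eventually_elim (intro summable_suminf_not_top, auto simp: infinity_ennreal_def)
  have sI: "summable (\<lambda>i. LINT x|lborel. norm (g (e i) x))"
  proof (rule summable_suminf_not_top)
    have "(\<integral>\<^sup>+x. ennreal (norm (g k x)) \<partial>lborel) = ennreal (LINT x|lborel. norm (g k x))" for k
      by (rule nn_integral_eq_integral) (use gi in auto)
    then have "(\<Sum>i. ennreal (LINT x|lborel. norm (g (e i) x))) \<le> S" using sumS by simp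
    then show "(\<Sum>i. ennreal (LINT x|lborel. norm (g (e i) x))) \<noteq> top" using fin by (auto simp: infinity_ennreal_def)
  qed (auto intro: integral_nonneg_AE)
  define f where "f x = (\<Sum>i. g (e i) x)" for x
  have fi: "integrable lborel f" unfolding f_def[abs_def] by (rule integrable_suminf[OF gi AEs sI])
  have "u \<phi> = regular_distr f \<phi>" if \<phi>: "\<phi> \<in> schwartz" for \<phi>
  proof -
    have [measurable]: "\<phi> \<in> borel_measurable borel" using schwartz_measurable[OF \<phi>] .
    obtain A where A: "0 < A" "\<And>x. norm (\<phi> x) \<le> A" by (rule schwartz_bounded[OF \<phi>]) blast
    have gpi: "integrable lborel (\<lambda>x. g k x * \<phi> x)" for k using g \<phi> by (simp add: represents_def)
    have 1: "(\<lambda>i. LINT x|lborel. g (e i) x * \<phi> x) sums (LINT x|lborel. (\<Sum>i. g (e i) x * \<phi> x))"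
    proof (rule sums_integral[OF gpi])
      show "AE x in lborel. summable (\<lambda>i. norm (g (e i) x * \<phi> x))"
        using AEs by eventually_elim (simp add: norm_mult summable_mult2)
      show "summable (\<lambda>i. LINT x|lborel. norm (g (e i) x * \<phi> x))"
      proof (rule summable_comparison_test[OF _ summable_mult[OF sI, of A]], intro exI[of _ 0] allI impI)
        fix i
        have "norm (LINT x|lborel. norm (g (e i) x * \<phi> x)) \<le> (LINT x|lborel. A * norm (g (e i) x))"
        proof (rule lborel_norm_integral_le)
          show "integrable lborel (\<lambda>x. norm (g (e i) x * \<phi> x))" by (intro integrable_norm gpi)
          show "integrable lborel (\<lambda>x. A * norm (g (e i) x))" by (intro integrable_mult_right integrable_norm gi)
          show "norm (norm (g (e i) x * \<phi> x)) \<le> A * norm (g (e i) x)" for x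
            using mult_right_mono[OF A(2)[of x] norm_ge_zero[of "g (e i) x"]] by (simp add: norm_mult mult.commute)
        qed
        then show "norm (LINT x|lborel. norm (g (e i) x * \<phi> x)) \<le> A * (LINT x|lborel. norm (g (e i) x))" by simp
      qed
    qed
    have "(LINT x|lborel. (\<Sum>i. g (e i) x * \<phi> x)) = (LINT x|lborel. f x * \<phi> x)"
    proof (rule integral_cong_AE)
      show "AE x in lborel. (\<Sum>i. g (e i) x * \<phi> x) = f x * \<phi> x"
        using AEs
      proof eventually_elim
        fix x assume "summable (\<lambda>i. norm (g (e i) x))"
        from suminf_mult2[OF summable_norm_cancel[OF this], of "\<phi> x"]
        show "(\<Sum>i. g (e i) x * \<phi> x) = f x * \<phi> x" by (simp add: f_def)
      qed
      show "(\<lambda>x. f x * \<phi> x) \<in> borel_measurable lborel" using fi by measurable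
    qed measurable
    then have 2: "(\<lambda>i. LINT x|lborel. g (e i) x * \<phi> x) sums (LINT x|lborel. f x * \<phi> x)" using 1 by simp
    have "fourier_mult (\<eta> k) u \<phi> = (LINT x|lborel. g k x * \<phi> x)" for k
      using g[of k] \<phi> by (simp add: represents_def regular_distr_def)
    then have "((\<lambda>k. LINT x|lborel. g k x * \<phi> x) has_sum u \<phi>) UNIV"
      using has_sum_fourier_mult[OF u \<phi>] by simp
    then have "((\<lambda>i. LINT x|lborel. g (e i) x * \<phi> x) has_sum u \<phi>) UNIV"
      using has_sum_reindex_bij_betw[OF e, of "\<lambda>k. LINT x|lborel. g k x * \<phi> x" "u \<phi>"] by simp
    then have "(\<lambda>i. LINT x|lborel. g (e i) x * \<phi> x) sums u \<phi>" by (rule has_sum_imp_sums)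
    then show ?thesis using 2 \<phi> sums_unique2 by (auto simp: regular_distr_def)
  qed
  moreover have "u \<phi> = regular_distr f \<phi>" if "\<phi> \<notin> schwartz" for \<phi>
    using that tempered_extensional[OF u] by (simp add: regular_distr_def extensional_def)
  ultimately have "u = regular_distr f" by blast
  moreover have "(\<integral>\<^sup>+x. ennreal (norm (f x)) \<partial>lborel) \<le> S"
  proof -
    have "(\<integral>\<^sup>+x. ennreal (norm (f x)) \<partial>lborel) \<le> (\<integral>\<^sup>+x. (\<Sum>i. ennreal (norm (g (e i) x))) \<partial>lborel)"
    proof (rule nn_integral_mono_AE)
      show "AE x in lborel. ennreal (norm (f x)) \<le> (\<Sum>i. ennreal (norm (g (e i) x)))"
        using AEs
      proof eventually_elim
        fix x assume s: "summable (\<lambda>i. norm (g (e i) x))"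
        have "norm (f x) \<le> (\<Sum>i. norm (g (e i) x))" unfolding f_def by (rule summable_norm[OF s])
        then show "ennreal (norm (f x)) \<le> (\<Sum>i. ennreal (norm (g (e i) x)))"
          using s by (subst suminf_ennreal2) (auto intro: ennreal_leI)
      qed
    qed
    then show ?thesis using nnsum by (rule order_trans)
  qed
  ultimately show ?thesis using fi by blast
qed

lemma recip_nonneg: "0 \<le> recip q"
  by (simp add: recip_def)

lemma recip_one: "recip 1 = 1"
  by (simp add: recip_def)

lemma B_index_one:
  assumes "0 < q"
  shows "B_index n 1 q = (if q \<le> 1 then 0 else real n * (1 - recip q))"
proof -
  have B: "B_index n 1 q = max 0 (max (- (real n * recip q)) (real n * (1 - recip q)))"
    by (simp add: B_index_def recip_one)
  have n: "0 \<le> real n * recip q" using recip_nonneg by simp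
  show ?thesis
  proof (cases "q \<le> 1")
    case True
    then have "1 \<le> recip q" using recip_ge_1_iff[OF assms] by simp
    then have "real n * (1 - recip q) \<le> 0" by (simp add: mult_nonneg_nonpos)
    then show ?thesis using True n unfolding B by (simp add: max.absorb1)
  next
    case False
    then have "recip q \<le> 1" using recip_ge_1_iff[OF assms] by simp
    then have "0 \<le> real n * (1 - recip q)" by simp
    then show ?thesis using False n unfolding B by (simp add: max.absorb2)
  qed
qed

lemma lq_norm_finite_imp_finite:
  assumes "lq_norm q c < \<infinity>" shows "c k < \<infinity>"
proof (cases "q = \<infinity>")
  case True
  have "c k \<le> (SUP k. c k)" by (rule SUP_upper) simp
  then show ?thesis using assms True by (simp add: lq_norm_def order.strict_trans1)
next
  case False
  have "(\<Sum>\<^sub>\<infinity>k. epowr (c k) (enn2real q)) \<noteq> \<infinity>"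
    using assms False epowr_eq_top_iff by (metis lq_norm_def order_less_irrefl)
  moreover have "epowr (c k) (enn2real q) \<le> (\<Sum>\<^sub>\<infinity>k. epowr (c k) (enn2real q))"
    using sum_le_infsum_ennreal[of "{k}" "\<lambda>k. epowr (c k) (enn2real q)"] by simp
  ultimately have "epowr (c k) (enn2real q) \<noteq> \<infinity>" by (auto simp: infinity_ennreal_def top_unique)
  then have "c k \<noteq> \<infinity>" using epowr_eq_top_iff by blast
  then show ?thesis by (simp add: infinity_ennreal_def less_top)
qed

context alpha_partition
begin

text \<open>Bernstein's inequality turns the \<open>L\<^sup>1\<close> norms of the pieces into \<open>w k * c k\<close> with
  \<open>w k = jap k powr (- (\<delta> / (1 - \<alpha>)))\<close>; the power of the radius accounts for the shift from \<open>s\<close> to \<open>\<delta>\<close>.\<close>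

theorem embedding_sufficient:
  assumes p: "0 < p" and q: "0 < q" and p1: "1 \<le> recip p"
    and s1: "s \<ge> real CARD('n) * \<alpha> * (recip p - 1) + (1 - \<alpha>) * B_index CARD('n) 1 q"
    and s2: "q > 1 \<longrightarrow> s > real CARD('n) * \<alpha> * (recip p - 1) + (1 - \<alpha>) * B_index CARD('n) 1 q"
  shows "embedded (modulation_space \<eta> s \<alpha> p q) (modulation_norm \<eta> s \<alpha> p q)
                  (L1_space :: 'n distr set) (distr_Lp_norm 1)"
proof -
  define n where "n = real CARD('n)"
  define \<delta> where "\<delta> = s - n * \<alpha> * (recip p - 1)"
  define w where "w k = jap k powr (- (\<delta> / (1 - \<alpha>)))" for k :: "int^'n"
  have \<alpha>1: "0 < 1 - \<alpha>" using alpha_less_1 by simp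
  have pinf: "p \<noteq> \<infinity>" using p1 by (auto simp: recip_infinity)
  define t where "t = enn2real p"
  have t: "0 < t" "recip p = 1 / t" "t \<le> 1"
  proof -
    show "0 < t" using enn2real_pos_of_finite[OF p pinf] by (simp add: t_def)
    show "recip p = 1 / t" using recip_eq[OF p pinf] by (simp add: t_def)
    then show "t \<le> 1" using p1 \<open>0 < t\<close> by (simp add: le_divide_eq)
  qed
  have small: "w k \<le> 1" if "q \<le> 1" for k
  proof -
    have "0 \<le> \<delta>" using s1 that by (simp add: \<delta>_def n_def B_index_one[OF q])
    then have "w k \<le> jap k powr 0" unfolding w_def using \<alpha>1 japanese_ge_1 by (intro powr_mono) auto
    then show ?thesis using japanese_pos[of "lattice_pt k"] by simp
  qed
  obtain K where K: "0 \<le> K" "\<And>F. 1 < q \<Longrightarrow> finite F \<Longrightarrow> (\<Sum>k\<in>F. w k powr (1 / (1 - recip q))) \<le> K"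
  proof (cases "1 < q")
    case True
    then have rq: "recip q < 1" using recip_ge_1_iff[OF q] by auto
    define T where "T = \<delta> / ((1 - \<alpha>) * (1 - recip q))"
    have "n * ((1 - \<alpha>) * (1 - recip q)) < \<delta>"
      using s2 True by (simp add: \<delta>_def n_def B_index_one[OF q] not_le[symmetric] algebra_simps)
    then have T: "n < T" using \<alpha>1 rq by (simp add: T_def pos_less_divide_eq)
    have wT: "w k powr (1 / (1 - recip q)) = jap k powr (- T)" for k
      unfolding w_def T_def by (simp add: powr_powr)
    obtain K where "\<And>F. finite F \<Longrightarrow> (\<Sum>k\<in>F. jap (k :: int^'n) powr (- T)) \<le> K"
      using lattice_sum_converges[where 'n='n] T by (auto simp: n_def)
    then have "\<And>F. finite F \<Longrightarrow> (\<Sum>k\<in>F. w k powr (1 / (1 - recip q))) \<le> max K 0" unfolding wT by (simp add: le_max_iff_disj)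
    then show ?thesis by (intro that[of "max K 0"]) auto
  qed (use that[of 0] in auto)
  obtain C where C: "0 < C" "\<And>u k g. u \<in> tempered \<Longrightarrow> represents g (fourier_mult (\<eta> k) u) \<Longrightarrow>
     (\<integral>\<^sup>+x. ennreal (norm (g x)) \<partial>lborel)
       \<le> ennreal (C * rad k powr (real CARD('n) * (1 / t - 1))) * epowr (\<integral>\<^sup>+x. epowr (ennreal (norm (g x))) t \<partial>lborel) (1 / t)"
    using bernstein[OF t(1,3)] by blast
  have main: "\<exists>f. integrable lborel f \<and> u = regular_distr f \<and> (\<integral>\<^sup>+x. ennreal (norm (f x)) \<partial>lborel) \<le> ennreal (C * (K + 1)) * modulation_norm \<eta> s \<alpha> p q u"
    if u: "u \<in> modulation_space \<eta> s \<alpha> p q" for u :: "'n distr"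
  proof -
    define c where "c k = ennreal (jap k powr (s / (1 - \<alpha>))) * distr_Lp_norm p (fourier_mult (\<eta> k) u)" for k
    have ut: "u \<in> tempered" and fin: "modulation_norm \<eta> s \<alpha> p q u < \<infinity>" using u by (auto simp: modulation_space_def)
    have mn: "modulation_norm \<eta> s \<alpha> p q u = lq_norm q c"
      unfolding c_def[abs_def] by (rule modulation_norm_eq_lq_norm[OF q])
    have "distr_Lp_norm p (fourier_mult (\<eta> k) u) < \<infinity>" for k
    proof -
      have "c k < \<infinity>" using fin unfolding mn by (rule lq_norm_finite_imp_finite)
      then show ?thesis using japanese_pos[of "lattice_pt k"]
        by (auto simp: c_def ennreal_mult_less_top infinity_ennreal_def ennreal_eq_0_iff)
    qed
    then have "\<exists>g. represents g (fourier_mult (\<eta> k) u)" for k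
      using distr_Lp_norm_finite_imp_represents by meson
    then obtain g where g: "\<And>k. represents (g k) (fourier_mult (\<eta> k) u)" by metis
    have piece: "(\<integral>\<^sup>+x. ennreal (norm (g k x)) \<partial>lborel) \<le> ennreal C * (ennreal (w k) * c k)" for k
    proof -
      have J: "0 < jap k" by (rule japanese_pos)
      have "(\<integral>\<^sup>+x. ennreal (norm (g k x)) \<partial>lborel) \<le> ennreal (C * rad k powr (real CARD('n) * (1 / t - 1))) * Lp_norm p (g k)"
        using C(2)[OF ut g] pinf by (simp add: Lp_norm_def t_def[symmetric] t(2))
      also have "Lp_norm p (g k) = distr_Lp_norm p (fourier_mult (\<eta> k) u)" by (rule distr_Lp_norm_eq[OF g, symmetric])
      also have "C * rad k powr (real CARD('n) * (1 / t - 1)) = C * (w k * jap k powr (s / (1 - \<alpha>)))"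
      proof -
        have "rad k powr (real CARD('n) * (1 / t - 1)) = jap k powr (\<alpha> / (1 - \<alpha>) * (n * (1 / t - 1)))"
          by (simp add: alpha_radius_def powr_powr n_def)
        also have "\<alpha> / (1 - \<alpha>) * (n * (1 / t - 1)) = - (\<delta> / (1 - \<alpha>)) + s / (1 - \<alpha>)"
          unfolding \<delta>_def t(2) by (simp add: add_divide_distrib[symmetric] minus_divide_left algebra_simps)
        finally show ?thesis by (simp only: w_def powr_add)
      qed
      finally show ?thesis using C(1) J
        by (simp add: c_def ennreal_mult w_def mult.assoc)
    qed
    have "\<exists>f. integrable lborel f \<and> u = regular_distr f \<and> (\<integral>\<^sup>+x. ennreal (norm (f x)) \<partial>lborel) \<le> ennreal (C * (K + 1)) * lq_norm q c"
    proof (rule tempered_eq_regular_distr_of_summable_pieces[OF ut g])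
      fix F :: "(int^'n) set" assume F: "finite F"
      have "(\<Sum>k\<in>F. \<integral>\<^sup>+x. ennreal (norm (g k x)) \<partial>lborel) \<le> (\<Sum>k\<in>F. ennreal C * (ennreal (w k) * c k))"
        by (intro sum_mono piece)
      also have "\<dots> = ennreal C * (\<Sum>k\<in>F. ennreal (w k) * c k)" by (rule sum_distrib_left[symmetric])
      also have "\<dots> \<le> ennreal C * (ennreal (K + 1) * lq_norm q c)"
        by (intro mult_left_mono weighted_sum_le_lq_norm q small K F) (auto simp: w_def)
      also have "\<dots> = ennreal (C * (K + 1)) * lq_norm q c" using C(1) K(1) by (simp add: ennreal_mult mult.assoc)
      finally show "(\<Sum>k\<in>F. \<integral>\<^sup>+x. ennreal (norm (g k x)) \<partial>lborel) \<le> ennreal (C * (K + 1)) * lq_norm q c" .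
    next
      show "ennreal (C * (K + 1)) * lq_norm q c < \<infinity>" using fin unfolding mn by (simp add: ennreal_mult_less_top infinity_ennreal_def)
    qed
    then show ?thesis by (simp only: mn)
  qed
  show ?thesis
    unfolding embedded_def
  proof (intro conjI exI[of _ "C * (K + 1)"] ballI subsetI)
    fix u :: "'n distr" assume u: "u \<in> modulation_space \<eta> s \<alpha> p q"
    from main[OF u] obtain f where f: "integrable lborel f" "u = regular_distr f"
      "(\<integral>\<^sup>+x. ennreal (norm (f x)) \<partial>lborel) \<le> ennreal (C * (K + 1)) * modulation_norm \<eta> s \<alpha> p q u" by blast
    show "u \<in> L1_space" using f by (auto simp: L1_space_def)
    have "represents f u" using represents_regular_integrable[OF f(1)] f(2) by simp
    then have "distr_Lp_norm 1 u = (\<integral>\<^sup>+x. ennreal (norm (f x)) \<partial>lborel)"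
      by (simp add: distr_Lp_norm_eq Lp_norm_1)
    then show "distr_Lp_norm 1 u \<le> ennreal (C * (K + 1)) * modulation_norm \<eta> s \<alpha> p q u" using f(3) by simp
  qed
qed

end

section \<open>Test functions\<close>

text \<open>A sequence carried by finitely many blocks of bounded size is controlled by its bounds on the
  blocks. Overlaps of blocks only increase the right-hand side.\<close>

lemma lq_norm_le_blocks:
  fixes c :: "'i \<Rightarrow> ennreal" and S :: "'m \<Rightarrow> 'i set" and v :: "'m \<Rightarrow> real"
  assumes q: "0 < q" and G: "finite G"
    and S: "\<And>m. m \<in> G \<Longrightarrow> finite (S m) \<and> card (S m) \<le> N" and N: "0 < N"
    and c0: "\<And>l. l \<notin> (\<Union>m\<in>G. S m) \<Longrightarrow> c l = 0"
    and c: "\<And>l m. m \<in> G \<Longrightarrow> l \<in> S m \<Longrightarrow> c l \<le> ennreal (v m)"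
    and v: "\<And>m. m \<in> G \<Longrightarrow> 0 \<le> v m" and V: "0 \<le> V"
    and vinf: "\<And>m. q = \<infinity> \<Longrightarrow> m \<in> G \<Longrightarrow> v m \<le> V"
    and vfin: "q \<noteq> \<infinity> \<Longrightarrow> (\<Sum>m\<in>G. v m powr enn2real q) \<le> V powr enn2real q"
  shows "lq_norm q c \<le> ennreal (real N powr recip q * V)"
proof (cases "q = \<infinity>")
  case True
  have "c l \<le> ennreal V" for l
  proof (cases "l \<in> (\<Union>m\<in>G. S m)")
    case l: True
    then obtain m where "m \<in> G" "l \<in> S m" by blast
    then show ?thesis using c vinf[OF True] order_trans ennreal_leI by metis
  qed (simp add: c0)
  then have "(SUP k. c k) \<le> ennreal V" by (rule SUP_least)
  then show ?thesis using True N by (simp add: lq_norm_def recip_infinity)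
next
  case False
  define r where "r = enn2real q"
  have r: "0 < r" "recip q = 1 / r" using enn2real_pos_of_finite[OF q False] recip_eq[OF q False] by (auto simp: r_def)
  let ?U = "\<Union>m\<in>G. S m"
  have finU: "finite ?U" using G S by auto
  have "(\<Sum>\<^sub>\<infinity>k. epowr (c k) r) = (\<Sum>\<^sub>\<infinity>k\<in>?U. epowr (c k) r)"
    by (rule infsum_cong_neutral) (auto simp: c0 epowr_0_left)
  also have "\<dots> = (\<Sum>k\<in>?U. epowr (c k) r)" using finU by simp
  also have "\<dots> \<le> (\<Sum>m\<in>G. \<Sum>k\<in>S m. epowr (c k) r)"
    using G S
  proof (induction G rule: finite_induct)
    case (insert m G)
    have fin: "finite (S m)" "finite (\<Union>m\<in>G. S m)" using insert by auto
    have "(\<Sum>k\<in>(\<Union>m\<in>insert m G. S m). epowr (c k) r) \<le> (\<Sum>k\<in>S m. epowr (c k) r) + (\<Sum>k\<in>(\<Union>m\<in>G. S m). epowr (c k) r)"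
      using sum.union_inter[OF fin, of "\<lambda>k. epowr (c k) r"] by (simp add: le_iff_add) metis
    also have "\<dots> \<le> (\<Sum>k\<in>S m. epowr (c k) r) + (\<Sum>m\<in>G. \<Sum>k\<in>S m. epowr (c k) r)"
      using insert by (intro add_left_mono insert.IH) auto
    finally show ?case using insert by simp
  qed simp
  also have "\<dots> \<le> (\<Sum>m\<in>G. ennreal (real N * v m powr r))"
  proof (rule sum_mono)
    fix m assume m: "m \<in> G"
    have "(\<Sum>k\<in>S m. epowr (c k) r) \<le> (\<Sum>k\<in>S m. epowr (ennreal (v m)) r)"
      using c[OF m] r by (intro sum_mono epowr_mono) auto
    also have "\<dots> = ennreal (real (card (S m)) * v m powr r)"
      using v[OF m] by (simp add: epowr_ennreal ennreal_of_nat_eq_real_of_nat ennreal_mult)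
    also have "\<dots> \<le> ennreal (real N * v m powr r)"
      using S[OF m] by (intro ennreal_leI mult_right_mono) auto
    finally show "(\<Sum>k\<in>S m. epowr (c k) r) \<le> ennreal (real N * v m powr r)" .
  qed
  also have "\<dots> = ennreal (real N * (\<Sum>m\<in>G. v m powr r))"
    by (simp add: sum_ennreal sum_distrib_left)
  also have "\<dots> \<le> ennreal (real N * V powr r)"
    using vfin[OF False] by (intro ennreal_leI mult_left_mono) (auto simp: r_def)
  finally have "epowr (\<Sum>\<^sub>\<infinity>k. epowr (c k) r) (1 / r) \<le> epowr (ennreal (real N * V powr r)) (1 / r)"
    using r by (intro epowr_mono) auto
  also have "\<dots> = ennreal (real N powr (1 / r) * V)"
    using r V by (simp add: epowr_ennreal powr_mult powr_powr)
  finally show ?thesis using False r by (simp add: lq_norm_def r_def[symmetric])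
qed

text \<open>For small exponents only fast decay makes the powers integrable, so the order \<open>M\<close> of decay depends on
  \<open>p\<close>; the power of \<open>r\<close> comes from the change of variables.\<close>

lemma Lp_norm_decay:
  assumes p: "0 < p"
  shows "\<exists>M K. 0 \<le> K \<and> (\<forall>g r b x0. g \<in> borel_measurable borel \<longrightarrow> 0 < r \<longrightarrow> 0 \<le> b \<longrightarrow>
     (\<forall>x :: real^'n::finite. norm (g x) \<le> b / (1 + norm (r *\<^sub>R (x - x0))) ^ M) \<longrightarrow>
     Lp_norm p g \<le> ennreal (K * b * r powr (- (real CARD('n) * recip p))))"
proof (cases "p = \<infinity>")
  case True
  have "Lp_norm p g \<le> ennreal (1 * b * r powr (- (real CARD('n) * recip p)))"
    if "g \<in> borel_measurable borel" "0 < r" "\<forall>x :: real^'n. norm (g x) \<le> b / (1 + norm (r *\<^sub>R (x - x0))) ^ 0" for g r b x0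
  proof -
    have [measurable]: "g \<in> borel_measurable borel" by fact
    have "Lp_norm p g \<le> ennreal b" using that(3) True unfolding Lp_norm_def
      by (auto intro!: esssup_I ennreal_leI)
    then show ?thesis using that(2) True by (simp add: recip_infinity)
  qed
  then show ?thesis by (intro exI[of _ 0] exI[of _ 1]) auto
next
  case False
  define t where "t = enn2real p"
  have t: "0 < t" "recip p = 1 / t" using enn2real_pos_of_finite[OF p False] recip_eq[OF p False] by (auto simp: t_def)
  define M where "M = nat \<lceil>2 * real CARD('n) / t\<rceil>"
  have "2 * real CARD('n) / t \<le> real M" unfolding M_def by linarith
  then have M: "2 * real CARD('n) \<le> real M * t" using t by (simp add: pos_divide_le_eq)
  define W where "W = integral\<^sup>L lborel (weight :: real^'n \<Rightarrow> real)"
  have W: "0 \<le> W" unfolding W_def by (rule integral_nonneg_AE) simp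
  have WE: "(\<integral>\<^sup>+x. ennreal (weight (x :: real^'n)) \<partial>lborel) = ennreal W"
    unfolding W_def by (rule nn_integral_eq_integral[OF integrable_weight]) simp
  have "Lp_norm p g \<le> ennreal (W powr (1 / t) * b * r powr (- (real CARD('n) * recip p)))"
    if g: "g \<in> borel_measurable borel" and r: "0 < r" and b: "0 \<le> b"
      and dec: "\<And>x :: real^'n. norm (g x) \<le> b / (1 + norm (r *\<^sub>R (x - x0))) ^ M" for g r b x0
  proof -
    have wm [measurable]: "(weight :: real^'n \<Rightarrow> real) \<in> borel_measurable borel" using integrable_weight by auto
    have "(\<integral>\<^sup>+x. epowr (ennreal (norm (g x))) t \<partial>lborel) \<le> (\<integral>\<^sup>+x. ennreal (b powr t) * ennreal (weight (r *\<^sub>R (x - x0))) \<partial>lborel)"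
    proof (rule nn_integral_mono)
      fix x :: "real^'n"
      let ?z = "1 + norm (r *\<^sub>R (x - x0))"
      have z: "1 \<le> ?z" by simp
      have "norm (g x) powr t \<le> (b / ?z ^ M) powr t" using dec[of x] t by (intro powr_mono2) auto
      also have "\<dots> = b powr t * ?z powr (- (real M * t))"
      proof -
        have "(y ^ M) powr t = y powr (real M * t)" if "1 \<le> y" for y :: real
          using that by (simp add: powr_realpow[symmetric] powr_powr)
        from this[OF z] show ?thesis using b z by (simp only: powr_divide powr_minus_divide) simp
      qed
      also have "\<dots> \<le> b powr t * ?z powr (- (2 * real CARD('n)))"
        using M z by (intro mult_left_mono powr_mono) auto
      also have "?z powr (- (2 * real CARD('n))) = weight (r *\<^sub>R (x - x0))"
      proof -
        have "y powr (2 * real CARD('n)) = y ^ (2 * CARD('n))" if "1 \<le> y" for y :: real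
          using that by (subst powr_realpow[symmetric]) auto
        from this[OF z] have "?z powr (2 * real CARD('n)) = ?z ^ (2 * CARD('n))" .
        then show ?thesis by (simp only: weight_def powr_minus_divide)
      qed
      finally show "epowr (ennreal (norm (g x))) t \<le> ennreal (b powr t) * ennreal (weight (r *\<^sub>R (x - x0)))"
        by (simp add: epowr_ennreal ennreal_mult[symmetric] ennreal_leI)
    qed
    also have "\<dots> = ennreal (b powr t) * (\<integral>\<^sup>+x. ennreal (weight (r *\<^sub>R (x - x0))) \<partial>lborel)"
      by (intro nn_integral_cmult) measurable
    also have "(\<integral>\<^sup>+x. ennreal (weight (r *\<^sub>R (x - x0))) \<partial>lborel) = ennreal (\<bar>1 / r\<bar> ^ DIM(real^'n)) * (\<integral>\<^sup>+z. ennreal (weight (r *\<^sub>R (x0 + (1 / r) *\<^sub>R z - x0))) \<partial>lborel)"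
      using r by (intro nn_integral_affine) measurable
    also have "\<dots> = ennreal (r powr (- real CARD('n)) * W)"
      using r WE W by (simp add: ennreal_mult[symmetric] powr_minus_divide powr_realpow power_divide)
    finally have "(\<integral>\<^sup>+x. epowr (ennreal (norm (g x))) t \<partial>lborel) \<le> ennreal (b powr t * (r powr (- real CARD('n)) * W))"
      using W by (simp add: ennreal_mult[symmetric])
    then have "epowr (\<integral>\<^sup>+x. epowr (ennreal (norm (g x))) t \<partial>lborel) (1 / t) \<le> epowr (ennreal (b powr t * (r powr (- real CARD('n)) * W))) (1 / t)"
      using t by (intro epowr_mono) auto
    also have "\<dots> = ennreal (W powr (1 / t) * b * r powr (- (real CARD('n) * recip p)))"
      using W b r t by (simp add: epowr_ennreal powr_mult powr_powr mult_ac)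
    finally show ?thesis using False t by (simp add: Lp_norm_def t_def[symmetric])
  qed
  then show ?thesis by (intro exI[of _ M] exI[of _ "W powr (1 / t)"]) auto
qed

lemma schwartz_regular_tempered:
  fixes f :: "real^'n::finite \<Rightarrow> complex"
  assumes f: "f \<in> schwartz" shows "regular_distr f \<in> tempered"
proof -
  have i: "integrable lborel (\<lambda>x. f x * \<phi> x)" if "\<phi> \<in> schwartz" for \<phi>
    using schwartz_integrable[OF schwartz_mult[OF f that]] .
  have b: "norm (regular_distr f \<phi>) \<le> (LINT x|lborel. norm (f x)) * schwartz_seminorm 0 \<phi>" if \<phi>: "\<phi> \<in> schwartz" for \<phi>
  proof -
    have le: "norm (\<phi> x) \<le> schwartz_seminorm 0 \<phi>" for x
      using schwartz_bound_pointwise[OF schwartz_bound_le_seminorm[OF \<phi>, of 0], of "[]" x] by simp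
    have "norm (LINT x|lborel. f x * \<phi> x) \<le> (LINT x|lborel. norm (f x) * schwartz_seminorm 0 \<phi>)"
      by (rule lborel_norm_integral_le[OF i[OF \<phi>]])
        (auto simp: norm_mult le intro!: mult_left_mono schwartz_integrable f)
    then show ?thesis using \<phi> by (simp add: regular_distr_def)
  qed
  show ?thesis
    unfolding tempered_def mem_Collect_eq
  proof (intro conjI ballI allI)
    show "regular_distr f \<in> extensional schwartz" by (simp add: regular_distr_def)
    fix \<phi> :: "real^'n \<Rightarrow> complex" assume \<phi>: "\<phi> \<in> schwartz"
    show "regular_distr f (\<lambda>x. \<phi> x + \<psi> x) = regular_distr f \<phi> + regular_distr f \<psi>" if \<psi>: "\<psi> \<in> schwartz" for \<psi>
      using \<phi> \<psi> schwartz_add[OF \<phi> \<psi>] i[OF \<phi>] i[OF \<psi>] by (simp add: regular_distr_def distrib_left)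
    show "regular_distr f (\<lambda>x. c * \<phi> x) = c * regular_distr f \<phi>" for c
      using \<phi> schwartz_cmul[OF \<phi>, of c] by (simp add: regular_distr_def mult.left_commute[of _ c])
  next
    show "\<exists>N C. \<forall>\<phi>\<in>schwartz. norm (regular_distr f \<phi>) \<le> C * schwartz_seminorm N \<phi>" using b by blast
  qed
qed

text \<open>Two applications of the multiplication formula move the multiplier from the test function to \<open>b\<close>.\<close>

lemma fourier_mult_regular:
  fixes b m :: "real^'n::finite \<Rightarrow> complex"
  assumes b: "b \<in> schwartz" and m: "m \<in> schwartz"
  shows "represents (inv_fourier (\<lambda>\<xi>. m \<xi> * b \<xi>)) (fourier_mult m (regular_distr (inv_fourier b)))"
proof -
  let ?h = "\<lambda>\<xi>. m \<xi> * b \<xi>"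
  have h: "?h \<in> schwartz" by (intro schwartz_mult m b)
  have fb: "inv_fourier b \<in> schwartz" by (intro schwartz_inv_fourier b)
  have inv_mult: "(LINT x|lborel. inv_fourier ?h x * \<phi> x) = (LINT x|lborel. ?h x * inv_fourier \<phi> x)" if \<phi>: "\<phi> \<in> schwartz" for \<phi>
  proof -
    have "(LINT x|lborel. ?h x * inv_fourier \<phi> x) = (LINT x|lborel. fourier (inv_fourier ?h) x * inv_fourier \<phi> x)"
      by (simp only: fourier_inv_fourier[OF h])
    also have "\<dots> = (LINT x|lborel. inv_fourier ?h x * fourier (inv_fourier \<phi>) x)"
      by (rule fourier_multiplication_formula[symmetric]) (intro schwartz_integrable schwartz_inv_fourier h \<phi>)+
    finally show ?thesis by (simp only: fourier_inv_fourier[OF \<phi>])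
  qed
  have "fourier_mult m (regular_distr (inv_fourier b)) = regular_distr (inv_fourier ?h)"
  proof
    fix \<phi>
    show "fourier_mult m (regular_distr (inv_fourier b)) \<phi> = regular_distr (inv_fourier ?h) \<phi>"
    proof (cases "\<phi> \<in> schwartz")
      case \<phi>: True
      have s: "(\<lambda>\<xi>. m \<xi> * inv_fourier \<phi> \<xi>) \<in> schwartz" by (intro schwartz_mult m schwartz_inv_fourier \<phi>)
      have "fourier_mult m (regular_distr (inv_fourier b)) \<phi> = (LINT x|lborel. inv_fourier b x * fourier (\<lambda>\<xi>. m \<xi> * inv_fourier \<phi> \<xi>) x)"
        using schwartz_fourier[OF s] by (simp add: fourier_mult_apply[OF m \<phi>] regular_distr_def)
      also have "\<dots> = (LINT x|lborel. fourier (inv_fourier b) x * (m x * inv_fourier \<phi> x))"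
        by (rule fourier_multiplication_formula) (intro schwartz_integrable fb s)+
      also have "\<dots> = (LINT x|lborel. ?h x * inv_fourier \<phi> x)" by (simp only: fourier_inv_fourier[OF b] mult_ac)
      finally show ?thesis using \<phi> by (simp add: regular_distr_def inv_mult)
    next
      case False
      then show ?thesis by (simp add: fourier_mult_def inv_fourier_distr_def regular_distr_def)
    qed
  qed
  moreover have "represents (inv_fourier ?h) (regular_distr (inv_fourier ?h))"
    by (intro represents_regular_integrable schwartz_integrable schwartz_inv_fourier h)
  ultimately show ?thesis by simp
qed

context alpha_partition
begin

text \<open>Frequency bumps: dilated and translated copies of \<open>\<eta> 0\<close>, modulated so that the inverse
  transform is concentrated near \<open>x0\<close> at scale \<open>1 / r\<close>.\<close>

definition bump :: "real^'n \<Rightarrow> real \<Rightarrow> real^'n \<Rightarrow> real^'n \<Rightarrow> complex" where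
  "bump c r x0 \<xi> = wave (- x0) \<xi> * \<eta> 0 ((1 / r) *\<^sub>R (\<xi> - c))"

definition profile :: "real^'n \<Rightarrow> complex" where
  "profile = inv_fourier (\<eta> 0)"

lemma bump_schwartz:
  assumes "0 < r" shows "bump c r x0 \<in> schwartz"
proof -
  have "bump c r x0 = (\<lambda>\<xi>. wave (- x0) \<xi> * \<eta> 0 (- ((1 / r) *\<^sub>R c) + (1 / r) *\<^sub>R \<xi>))"
    by (simp add: bump_def fun_eq_iff scaleR_diff_right)
  then show ?thesis using assms by (simp only:) (intro schwartz_wave_mult schwartz_affine eta_schwartz, auto)
qed

lemma bump_support:
  assumes "0 < r" "bump c r x0 \<xi> \<noteq> 0" shows "norm (\<xi> - c) < supp_const * r"
proof -
  have "norm ((1 / r) *\<^sub>R (\<xi> - c)) < supp_const"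
    using assms(2) by (intro eta_zero_support) (auto simp: bump_def)
  then show ?thesis using assms(1) by (simp add: pos_divide_less_eq)
qed

lemma inv_fourier_mult_bump:
  assumes r: "0 < r"
  shows "inv_fourier (\<lambda>\<xi>. m \<xi> * bump c r x0 \<xi>) x =
    complex_of_real (r ^ CARD('n)) * (wave (x - x0) c * inv_fourier (\<lambda>\<zeta>. m (c + r *\<^sub>R \<zeta>) * \<eta> 0 \<zeta>) (r *\<^sub>R (x - x0)))"
proof -
  have "inv_fourier (\<lambda>\<xi>. m \<xi> * bump c r x0 \<xi>) x = (LINT \<xi>|lborel. m \<xi> * bump c r x0 \<xi> * wave x \<xi>)"
    by (rule inv_fourier_wave)
  also have "\<dots> = \<bar>r\<bar> ^ DIM(real^'n) *\<^sub>R (LINT \<zeta>|lborel. m (c + r *\<^sub>R \<zeta>) * bump c r x0 (c + r *\<^sub>R \<zeta>) * wave x (c + r *\<^sub>R \<zeta>))"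
    using r by (intro integral_affine) auto
  also have "(LINT \<zeta>|lborel. m (c + r *\<^sub>R \<zeta>) * bump c r x0 (c + r *\<^sub>R \<zeta>) * wave x (c + r *\<^sub>R \<zeta>))
     = (LINT \<zeta>|lborel. wave (x - x0) c * (m (c + r *\<^sub>R \<zeta>) * \<eta> 0 \<zeta> * wave (r *\<^sub>R (x - x0)) \<zeta>))"
  proof (intro Bochner_Integration.integral_cong refl)
    fix \<zeta>
    have "wave (- x0) (c + r *\<^sub>R \<zeta>) * wave x (c + r *\<^sub>R \<zeta>) = wave (x - x0) (c + r *\<^sub>R \<zeta>)"
      unfolding wave_add[symmetric] by simp
    also have "\<dots> = wave (x - x0) c * wave (r *\<^sub>R (x - x0)) \<zeta>" by (simp only: wave_add_right wave_scaleR)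
    finally have w: "wave (- x0) (c + r *\<^sub>R \<zeta>) * wave x (c + r *\<^sub>R \<zeta>) = wave (x - x0) c * wave (r *\<^sub>R (x - x0)) \<zeta>" .
    have "m (c + r *\<^sub>R \<zeta>) * bump c r x0 (c + r *\<^sub>R \<zeta>) * wave x (c + r *\<^sub>R \<zeta>)
      = (m (c + r *\<^sub>R \<zeta>) * \<eta> 0 \<zeta>) * (wave (- x0) (c + r *\<^sub>R \<zeta>) * wave x (c + r *\<^sub>R \<zeta>))"
      using r by (simp add: bump_def mult_ac)
    then show "m (c + r *\<^sub>R \<zeta>) * bump c r x0 (c + r *\<^sub>R \<zeta>) * wave x (c + r *\<^sub>R \<zeta>)
      = wave (x - x0) c * (m (c + r *\<^sub>R \<zeta>) * \<eta> 0 \<zeta> * wave (r *\<^sub>R (x - x0)) \<zeta>)"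
      unfolding w by (simp only: mult_ac)
  qed
  also have "\<dots> = wave (x - x0) c * inv_fourier (\<lambda>\<zeta>. m (c + r *\<^sub>R \<zeta>) * \<eta> 0 \<zeta>) (r *\<^sub>R (x - x0))"
    by (simp only: integral_mult_right_zero inv_fourier_wave)
  finally show ?thesis using r by (simp add: scaleR_conv_of_real)
qed

lemma norm_inv_fourier_bump:
  assumes "0 < r"
  shows "norm (inv_fourier (bump c r x0) x) = r ^ CARD('n) * norm (profile (r *\<^sub>R (x - x0)))"
  using inv_fourier_mult_bump[OF assms, of "\<lambda>_. 1" c x0 x] assms
  by (simp add: norm_mult profile_def norm_power)

text \<open>On a cell of comparable size the rescaled \<open>\<eta> l\<close> has derivatives bounded independently of the
  cell, so the pieces of a bump decay uniformly.\<close>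

lemma localized_bump_decay:
  "\<exists>C\<ge>0. \<forall>l c r x0 x. 0 < r \<longrightarrow> r \<le> A * rad l \<longrightarrow>
     norm (inv_fourier (\<lambda>\<xi>. \<eta> l \<xi> * bump c r x0 \<xi>) x) \<le> C * r ^ CARD('n) / (1 + norm (r *\<^sub>R (x - x0))) ^ M"
proof -
  obtain M' D where D: "0 \<le> D" "\<And>f B. f \<in> schwartz \<Longrightarrow> schwartz_bound M' B f \<Longrightarrow> schwartz_bound M (D * B) (inv_fourier (f :: real^'n \<Rightarrow> complex))"
    using inv_fourier_schwartz_bound[of M] by blast
  obtain A' where A': "0 \<le> A'" "\<And>k \<gamma> \<xi>. length \<gamma> \<le> M' \<Longrightarrow> rad k ^ length \<gamma> * norm (partial_deriv \<gamma> (\<eta> k) \<xi>) \<le> A'"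
    using eta_partial_deriv_bound by blast
  obtain B where B: "schwartz_bound (M' + 0) B (\<eta> 0)" using schwartz_obtain_bound[OF eta_schwartz] .
  define A1 where "A1 = (1 + \<bar>A\<bar>) ^ M' * A'"
  have B0: "0 \<le> B" using schwartz_bound_nonneg[OF B] .
  have "norm (inv_fourier (\<lambda>\<xi>. \<eta> l \<xi> * bump c r x0 \<xi>) x) \<le> (D * (2 ^ M' * A1 * B)) * r ^ CARD('n) / (1 + norm (r *\<^sub>R (x - x0))) ^ M"
    if r: "0 < r" "r \<le> A * rad l" for l c r x0 x
  proof -
    let ?m = "\<lambda>\<zeta>. \<eta> l (c + r *\<^sub>R \<zeta>)"
    have gb: "growth_bound M' 0 A1 ?m"
      unfolding growth_bound_def
    proof (intro allI impI)
      fix \<gamma> :: "'n list" and x :: "real^'n" assume l: "length \<gamma> \<le> M'"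
      have "norm (partial_deriv \<gamma> ?m x) = r ^ length \<gamma> * norm (partial_deriv \<gamma> (\<eta> l) (c + r *\<^sub>R x))"
        using r unfolding partial_deriv_affine[OF schwartz_smooth[OF eta_schwartz]] by (simp add: norm_mult norm_power)
      also have "\<dots> \<le> ((1 + \<bar>A\<bar>) * rad l) ^ length \<gamma> * norm (partial_deriv \<gamma> (\<eta> l) (c + r *\<^sub>R x))"
      proof (intro mult_right_mono power_mono)
        have "A * rad l \<le> (1 + \<bar>A\<bar>) * rad l" using rad_pos[of l] by (intro mult_right_mono) auto
        then show "r \<le> (1 + \<bar>A\<bar>) * rad l" using r by linarith
      qed (use r in auto)
      also have "\<dots> = (1 + \<bar>A\<bar>) ^ length \<gamma> * (rad l ^ length \<gamma> * norm (partial_deriv \<gamma> (\<eta> l) (c + r *\<^sub>R x)))"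
        by (simp add: power_mult_distrib)
      also have "\<dots> \<le> (1 + \<bar>A\<bar>) ^ M' * A'"
        using rad_pos[of l] l by (intro mult_mono A'(2) power_increasing) auto
      finally show "norm (partial_deriv \<gamma> ?m x) \<le> A1 * (1 + norm x) ^ 0" by (simp add: A1_def)
    qed
    have ms: "?m \<in> schwartz" using r by (intro schwartz_affine eta_schwartz) auto
    have "schwartz_bound M' (2 ^ M' * A1 * B) (\<lambda>\<zeta>. ?m \<zeta> * \<eta> 0 \<zeta>)"
      by (rule schwartz_bound_mult[OF schwartz_smooth[OF ms] schwartz_smooth[OF eta_schwartz] gb B])
    from D(2)[OF schwartz_mult[OF ms eta_schwartz] this]
    have dec: "norm (inv_fourier (\<lambda>\<zeta>. ?m \<zeta> * \<eta> 0 \<zeta>) y) \<le> D * (2 ^ M' * A1 * B) / (1 + norm y) ^ M" for y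
      using schwartz_bound_pointwise[of M _ _ "[]"] by force
    have "r ^ CARD('n) * norm (inv_fourier (\<lambda>\<zeta>. ?m \<zeta> * \<eta> 0 \<zeta>) (r *\<^sub>R (x - x0))) \<le> r ^ CARD('n) * (D * (2 ^ M' * A1 * B) / (1 + norm (r *\<^sub>R (x - x0))) ^ M)"
      using r by (intro mult_left_mono dec) auto
    moreover have "norm (inv_fourier (\<lambda>\<xi>. \<eta> l \<xi> * bump c r x0 \<xi>) x) = r ^ CARD('n) * norm (inv_fourier (\<lambda>\<zeta>. ?m \<zeta> * \<eta> 0 \<zeta>) (r *\<^sub>R (x - x0)))"
      unfolding inv_fourier_mult_bump[OF r(1)] using r by (simp add: norm_mult norm_power)
    ultimately show ?thesis by (simp add: mult_ac)
  qed
  moreover have "0 \<le> D * (2 ^ M' * A1 * B)" using D(1) A'(1) B0 by (simp add: A1_def)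
  ultimately show ?thesis by blast
qed

lemma profile_schwartz: "profile \<in> schwartz"
  unfolding profile_def by (intro schwartz_inv_fourier eta_schwartz)

lemma profile_L1_pos: "0 < (LINT x|lborel. norm (profile x))"
proof -
  have i: "integrable lborel (\<lambda>x. norm (profile x))" by (intro integrable_norm schwartz_integrable profile_schwartz)
  have "norm (fourier profile 0) \<le> (LINT x|lborel. norm (profile x))"
    by (rule norm_fourier_le[OF schwartz_integrable[OF profile_schwartz]])
  moreover have "fourier profile 0 = \<eta> 0 0" unfolding profile_def by (simp add: fourier_inv_fourier[OF eta_schwartz])
  ultimately show ?thesis using eta_zero_nonzero by (metis norm_le_zero_iff not_le order_trans)
qed

lemma piece_Lp_norm:
  assumes p: "0 < p"
  shows "\<exists>K\<ge>0. \<forall>l c r x0 a. 0 < r \<longrightarrow> r \<le> A * rad l \<longrightarrow> 0 \<le> a \<longrightarrow>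
     Lp_norm p (inv_fourier (\<lambda>\<xi>. \<eta> l \<xi> * (complex_of_real a * bump c r x0 \<xi>))) \<le> ennreal (K * a * r powr (real CARD('n) * (1 - recip p)))"
proof -
  obtain M K where K: "0 \<le> K" "\<And>g r b x0. g \<in> borel_measurable borel \<Longrightarrow> 0 < r \<Longrightarrow> 0 \<le> b \<Longrightarrow>
     (\<And>x :: real^'n. norm (g x) \<le> b / (1 + norm (r *\<^sub>R (x - x0))) ^ M) \<Longrightarrow>
     Lp_norm p g \<le> ennreal (K * b * r powr (- (real CARD('n) * recip p)))"
    using Lp_norm_decay[OF p, where 'n='n] by blast
  obtain C where C: "0 \<le> C" "\<And>l c r x0 x. 0 < r \<Longrightarrow> r \<le> A * rad l \<Longrightarrow>
     norm (inv_fourier (\<lambda>\<xi>. \<eta> l \<xi> * bump c r x0 \<xi>) x) \<le> C * r ^ CARD('n) / (1 + norm (r *\<^sub>R (x - x0))) ^ M"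
    using localized_bump_decay[of A M] by blast
  have "Lp_norm p (inv_fourier (\<lambda>\<xi>. \<eta> l \<xi> * (complex_of_real a * bump c r x0 \<xi>))) \<le> ennreal ((K * C) * a * r powr (real CARD('n) * (1 - recip p)))"
    if r: "0 < r" "r \<le> A * rad l" and a: "0 \<le> a" for l c r x0 a
  proof -
    let ?f = "\<lambda>\<xi>. \<eta> l \<xi> * (complex_of_real a * bump c r x0 \<xi>)"
    have s: "?f \<in> schwartz" by (intro schwartz_mult eta_schwartz schwartz_cmul bump_schwartz r)
    have eq: "inv_fourier ?f x = complex_of_real a * inv_fourier (\<lambda>\<xi>. \<eta> l \<xi> * bump c r x0 \<xi>) x" for x
    proof -
      have "?f = (\<lambda>\<xi>. complex_of_real a * (\<eta> l \<xi> * bump c r x0 \<xi>))" by (simp add: fun_eq_iff)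
      then show ?thesis by (simp only: inv_fourier_eq fourier_cmul)
    qed
    have "Lp_norm p (inv_fourier ?f) \<le> ennreal (K * (a * (C * r ^ CARD('n))) * r powr (- (real CARD('n) * recip p)))"
    proof (rule K(2))
      show "inv_fourier ?f \<in> borel_measurable borel" by (rule schwartz_measurable[OF schwartz_inv_fourier[OF s]])
      show "norm (inv_fourier ?f x) \<le> a * (C * r ^ CARD('n)) / (1 + norm (r *\<^sub>R (x - x0))) ^ M" for x
        unfolding eq using mult_left_mono[OF C(2)[OF r, of c x0 x] a] a by (simp add: norm_mult)
    qed (use r a C in auto)
    also have "K * (a * (C * r ^ CARD('n))) * r powr (- (real CARD('n) * recip p)) = (K * C) * a * r powr (real CARD('n) * (1 - recip p))"
    proof -
      have "r powr (real CARD('n) * (1 - recip p)) = r powr (real CARD('n) + - (real CARD('n) * recip p))"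
        by (simp add: algebra_simps)
      also have "\<dots> = r ^ CARD('n) * r powr (- (real CARD('n) * recip p))"
        using r by (simp only: powr_add powr_realpow)
      finally show ?thesis by simp
    qed
    finally show ?thesis .
  qed
  then show ?thesis using K(1) C(1) by (intro exI[of _ "K * C"]) auto
qed

text \<open>Testing the embedding on \<open>inv_fourier b\<close>, whose pieces are \<open>inv_fourier (\<eta> l * b)\<close>.\<close>

lemma embedding_test:
  assumes emb: "\<forall>u\<in>modulation_space \<eta> s \<alpha> p q. distr_Lp_norm 1 u \<le> ennreal C * modulation_norm \<eta> s \<alpha> p q u"
    and q: "0 < q" and b: "b \<in> schwartz"
    and V: "lq_norm q (\<lambda>l. ennreal (jap l powr (s / (1 - \<alpha>))) * Lp_norm p (inv_fourier (\<lambda>\<xi>. \<eta> l \<xi> * b \<xi>))) \<le> ennreal V"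
  shows "(\<integral>\<^sup>+x. ennreal (norm (inv_fourier b x)) \<partial>lborel) \<le> ennreal C * ennreal V"
proof -
  let ?u = "regular_distr (inv_fourier b)"
  have f: "inv_fourier b \<in> schwartz" by (intro schwartz_inv_fourier b)
  have "distr_Lp_norm p (fourier_mult (\<eta> l) ?u) = Lp_norm p (inv_fourier (\<lambda>\<xi>. \<eta> l \<xi> * b \<xi>))" for l
    by (rule distr_Lp_norm_eq[OF fourier_mult_regular[OF b eta_schwartz]])
  then have mn: "modulation_norm \<eta> s \<alpha> p q ?u \<le> ennreal V"
    using V by (simp add: modulation_norm_eq_lq_norm[OF q])
  also have "\<dots> < \<infinity>" by simp
  finally have "?u \<in> modulation_space \<eta> s \<alpha> p q"
    using schwartz_regular_tempered[OF f] by (simp add: modulation_space_def)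
  then have "distr_Lp_norm 1 ?u \<le> ennreal C * modulation_norm \<eta> s \<alpha> p q ?u" using emb by blast
  also have "\<dots> \<le> ennreal C * ennreal V" by (intro mult_left_mono mn) auto
  also have "distr_Lp_norm 1 ?u = Lp_norm 1 (inv_fourier b)"
    by (intro distr_Lp_norm_eq represents_regular_integrable schwartz_integrable f)
  finally show ?thesis by (simp add: Lp_norm_1)
qed

section \<open>Necessity\<close>

text \<open>Dilating one bump towards frequency zero involves only finitely many pieces, and compares a
  constant \<open>L\<^sup>1\<close> norm with \<open>r\<^bsup>n(1 - 1/p)\<^esup>\<close> as the radius \<open>r\<close> tends to zero.\<close>

lemma necessary_p_le_1:
  assumes emb: "\<forall>u\<in>modulation_space \<eta> s \<alpha> p q. distr_Lp_norm 1 u \<le> ennreal C * modulation_norm \<eta> s \<alpha> p q u"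
    and p: "0 < p" and q: "0 < q"
  shows "1 \<le> recip p"
proof (rule ccontr)
  assume "\<not> 1 \<le> recip p"
  define \<epsilon> where "\<epsilon> = real CARD('n) * (1 - recip p)"
  have \<epsilon>: "0 < \<epsilon>" using \<open>\<not> 1 \<le> recip p\<close> by (simp add: \<epsilon>_def)
  obtain K where K: "0 \<le> K" "\<And>l c r x0 a. 0 < r \<Longrightarrow> r \<le> 1 * rad l \<Longrightarrow> 0 \<le> a \<Longrightarrow>
     Lp_norm p (inv_fourier (\<lambda>\<xi>. \<eta> l \<xi> * (complex_of_real a * bump c r x0 \<xi>))) \<le> ennreal (K * a * r powr (real CARD('n) * (1 - recip p)))"
    using piece_Lp_norm[OF p, of 1] by blast
  define L where "L = {l :: int^'n. norm (lattice_pt l) \<le> 2 * supp_const}"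
  have finL: "finite L" unfolding L_def by (rule finite_lattice_ball)
  define J where "J = (\<Sum>l\<in>L. jap l powr (s / (1 - \<alpha>)))"
  have J: "jap l powr (s / (1 - \<alpha>)) \<le> J" if "l \<in> L" for l
    unfolding J_def using finL that by (intro member_le_sum) auto
  have J0: "0 \<le> J" unfolding J_def by (intro sum_nonneg) auto
  define L0 where "L0 = (LINT x|lborel. norm (profile x))"
  have L0: "0 < L0" using profile_L1_pos by (simp add: L0_def)
  define E where "E = \<bar>C\<bar> * (real (card L + 1) powr recip q * (J * K))"
  have E: "0 \<le> E" using J0 K by (simp add: E_def)
  have key: "L0 \<le> E * r powr \<epsilon>" if r: "0 < r" "r \<le> 1" for r
  proof -
    have r1: "r \<le> 1 * rad l" for l using r rad_ge_1[of l] by linarith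
    let ?b = "\<lambda>\<xi>. complex_of_real 1 * bump 0 r 0 \<xi>"
    let ?c = "\<lambda>l. ennreal (jap l powr (s / (1 - \<alpha>))) * Lp_norm p (inv_fourier (\<lambda>\<xi>. \<eta> l \<xi> * ?b \<xi>))"
    have V: "lq_norm q ?c \<le> ennreal (real (card L + 1) powr recip q * (J * (K * 1 * r powr \<epsilon>)))"
    proof (rule lq_norm_le_blocks[where G="{()}" and S="\<lambda>_. L" and v="\<lambda>_. J * (K * 1 * r powr \<epsilon>)", OF q])
      fix l assume "l \<notin> (\<Union>m\<in>{()}. L)"
      then have l: "2 * supp_const < norm (lattice_pt l)" by (simp add: L_def)
      have "\<eta> l \<xi> * ?b \<xi> = 0" for \<xi>
      proof (rule ccontr)
        assume nz: "\<eta> l \<xi> * ?b \<xi> \<noteq> 0"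
        then have "\<xi> \<in> closure {\<xi>. \<eta> l \<xi> \<noteq> 0}" using closure_subset[of "{\<xi>. \<eta> l \<xi> \<noteq> 0}"] by auto
        from eta_index_bound[OF this] have "norm (lattice_pt l) \<le> norm \<xi> + supp_const" .
        moreover have "norm (\<xi> - 0) < supp_const * r" using nz by (intro bump_support[OF r(1), of 0 0]) auto
        moreover have "supp_const * r \<le> supp_const * 1" using r supp_const(1) by (intro mult_left_mono) auto
        ultimately show False using l by simp
      qed
      then have "(\<lambda>\<xi>. \<eta> l \<xi> * ?b \<xi>) = (\<lambda>\<xi>. 0)" by (rule ext)
      moreover have z: "inv_fourier (\<lambda>\<xi>::real^'n. 0) = (\<lambda>x. 0)" by (simp add: inv_fourier_wave fun_eq_iff)
      ultimately have "inv_fourier (\<lambda>\<xi>. \<eta> l \<xi> * ?b \<xi>) = (\<lambda>x. 0)" by (simp only:)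
      moreover have "Lp_norm p (\<lambda>x::real^'n. 0) = 0"
        using K(2)[OF r(1) r1[of l] order_refl, of 0 0] by (simp add: z)
      ultimately show "?c l = 0" by (simp only: mult_zero_right)
    next
      fix l and m :: unit assume l: "l \<in> L"
      have "?c l \<le> ennreal J * ennreal (K * 1 * r powr \<epsilon>)"
        unfolding \<epsilon>_def by (intro mult_mono ennreal_leI J[OF l] K(2) r r1) auto
      then show "?c l \<le> ennreal (J * (K * 1 * r powr \<epsilon>))" using J0 K by (simp add: ennreal_mult)
    qed (use finL J0 K in auto)
    have b: "?b \<in> schwartz" by (intro schwartz_cmul bump_schwartz r)
    have "(\<integral>\<^sup>+x. ennreal (norm (inv_fourier ?b x)) \<partial>lborel) \<le> ennreal C * ennreal (real (card L + 1) powr recip q * (J * (K * 1 * r powr \<epsilon>)))"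
      by (rule embedding_test[OF emb q b V])
    also have "\<dots> \<le> ennreal \<bar>C\<bar> * ennreal (real (card L + 1) powr recip q * (J * (K * 1 * r powr \<epsilon>)))"
      by (intro mult_right_mono ennreal_leI) auto
    also have "\<dots> = ennreal (E * r powr \<epsilon>)" using J0 K by (simp add: E_def ennreal_mult[symmetric] mult_ac)
    finally have up: "(\<integral>\<^sup>+x. ennreal (norm (inv_fourier ?b x)) \<partial>lborel) \<le> ennreal (E * r powr \<epsilon>)" .
    have "(\<integral>\<^sup>+x. ennreal (norm (inv_fourier ?b x)) \<partial>lborel) = ennreal (LINT x|lborel. norm (inv_fourier ?b x))"
      by (intro nn_integral_eq_integral integrable_norm schwartz_integrable schwartz_inv_fourier b) auto
    also have "(LINT x|lborel. norm (inv_fourier ?b x)) = (LINT x|lborel. r ^ CARD('n) * norm (profile (0 + r *\<^sub>R x)))"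
      using norm_inv_fourier_bump[OF r(1), of 0 0] by simp
    also have "\<dots> = L0"
      unfolding L0_def using integral_affine[of r "\<lambda>x. norm (profile x)" 0] r by simp
    finally have "ennreal L0 \<le> ennreal (E * r powr \<epsilon>)" using up by simp
    then show ?thesis using E by (simp add: ennreal_le_iff)
  qed
  define r where "r = min 1 ((L0 / (2 * (E + 1))) powr (1 / \<epsilon>))"
  have x: "0 < L0 / (2 * (E + 1))" using L0 E by simp
  have r: "0 < r" "r \<le> 1" using x by (auto simp: r_def)
  have "r powr \<epsilon> \<le> ((L0 / (2 * (E + 1))) powr (1 / \<epsilon>)) powr \<epsilon>"
    using \<epsilon> r by (intro powr_mono2) (auto simp: r_def)
  also have "\<dots> = L0 / (2 * (E + 1))"
  proof -
    have "(y powr (1 / \<epsilon>)) powr \<epsilon> = y" if "0 < y" for y :: real using that \<epsilon> by (simp add: powr_powr)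
    from this[OF x] show ?thesis .
  qed
  finally have "E * r powr \<epsilon> \<le> E * (L0 / (2 * (E + 1)))" using E by (rule mult_left_mono)
  also have "\<dots> \<le> (E + 1) * (L0 / (2 * (E + 1)))" using x by (intro mult_right_mono) auto
  also have "\<dots> = L0 / 2" using E by (simp add: field_simps)
  finally show False using key[OF r] L0 by linarith
qed

end

definition dilate :: "int \<Rightarrow> int^'n::finite \<Rightarrow> int^'n" where
  "dilate D m = (\<chi> i. D * m $ i)"

lemma dilate_separation:
  assumes D: "1 \<le> D" and "m \<noteq> m'"
  shows "real_of_int D \<le> norm (lattice_pt (dilate D m) - lattice_pt (dilate D m'))"
proof -
  obtain i where i: "m $ i \<noteq> m' $ i" using assms(2) by (auto simp: vec_eq_iff)
  have "D * 1 \<le> D * \<bar>m $ i - m' $ i\<bar>" using i D by (intro mult_left_mono) auto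
  also have "\<dots> = \<bar>(dilate D m - dilate D m') $ i\<bar>" using D by (simp add: dilate_def right_diff_distrib[symmetric] abs_mult)
  finally have "real_of_int D \<le> \<bar>real_of_int ((dilate D m - dilate D m') $ i)\<bar>" by linarith
  also have "\<dots> \<le> norm (lattice_pt (dilate D m - dilate D m'))" by (rule abs_lattice_pt_le)
  finally show ?thesis by (simp add: lattice_pt_diff)
qed

text \<open>On \<open>Q m\<close> the term \<open>m\<close> competes with all the others, elsewhere all terms may cancel; in both
  cases \<open>\<bar>f\<bar> \<ge> (\<Sum>m. a m \<bar>h m\<bar> (2 * indicator (Q m) - 1))\<close> pointwise.\<close>

lemma L1_lower_bound_separated:
  fixes h :: "'m \<Rightarrow> 'a::euclidean_space \<Rightarrow> complex"
  assumes G: "finite G" and h: "\<And>m. m \<in> G \<Longrightarrow> integrable lborel (h m)" and a: "\<And>m. m \<in> G \<Longrightarrow> 0 \<le> a m"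
    and Q: "\<And>m. m \<in> G \<Longrightarrow> Q m \<in> sets borel" and disj: "\<And>m m'. m \<in> G \<Longrightarrow> m' \<in> G \<Longrightarrow> m \<noteq> m' \<Longrightarrow> Q m \<inter> Q m' = {}"
    and tot: "\<And>m. m \<in> G \<Longrightarrow> (LINT x|lborel. norm (h m x)) = L"
    and conc: "\<And>m. m \<in> G \<Longrightarrow> 3 / 4 * L \<le> (LINT x|lborel. indicator (Q m) x * norm (h m x))"
  shows "L / 2 * (\<Sum>m\<in>G. a m) \<le> (LINT x|lborel. norm (\<Sum>m\<in>G. complex_of_real (a m) * h m x))"
proof -
  have iQ: "integrable lborel (\<lambda>x. indicator (Q m) x * norm (h m x))" if "m \<in> G" for m
    using integrable_mult_indicator[of "Q m" lborel "\<lambda>x. norm (h m x)"] Q[OF that] h[OF that] by simp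
  have iT: "integrable lborel (\<lambda>x. a m * (2 * (indicator (Q m) x * norm (h m x)) - norm (h m x)))" if "m \<in> G" for m
    using iQ[OF that] h[OF that] by (intro integrable_mult_right Bochner_Integration.integrable_diff integrable_norm)
  have "L / 2 * (\<Sum>m\<in>G. a m) \<le> (\<Sum>m\<in>G. a m * (2 * (LINT x|lborel. indicator (Q m) x * norm (h m x)) - (LINT x|lborel. norm (h m x))))"
    unfolding sum_distrib_left
  proof (rule sum_mono)
    fix m assume m: "m \<in> G"
    have "L / 2 \<le> 2 * (LINT x|lborel. indicator (Q m) x * norm (h m x)) - (LINT x|lborel. norm (h m x))"
      using conc[OF m] tot[OF m] by simp
    from mult_left_mono[OF this a[OF m]]
    show "L / 2 * a m \<le> a m * (2 * (LINT x|lborel. indicator (Q m) x * norm (h m x)) - (LINT x|lborel. norm (h m x)))"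
      by (simp add: mult.commute)
  qed
  also have "\<dots> = (\<Sum>m\<in>G. LINT x|lborel. a m * (2 * (indicator (Q m) x * norm (h m x)) - norm (h m x)))"
  proof (rule sum.cong[OF refl])
    fix m assume m: "m \<in> G"
    show "a m * (2 * (LINT x|lborel. indicator (Q m) x * norm (h m x)) - (LINT x|lborel. norm (h m x)))
      = (LINT x|lborel. a m * (2 * (indicator (Q m) x * norm (h m x)) - norm (h m x)))"
      using iQ[OF m] h[OF m] by (simp add: Bochner_Integration.integral_diff)
  qed
  also have "\<dots> = (LINT x|lborel. (\<Sum>m\<in>G. a m * (2 * (indicator (Q m) x * norm (h m x)) - norm (h m x))))"
    by (rule Bochner_Integration.integral_sum[symmetric, OF iT])
  also have "\<dots> \<le> (LINT x|lborel. norm (\<Sum>m\<in>G. complex_of_real (a m) * h m x))"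
  proof (rule lborel_integral_mono)
    show "integrable lborel (\<lambda>x. \<Sum>m\<in>G. a m * (2 * (indicator (Q m) x * norm (h m x)) - norm (h m x)))"
      by (intro Bochner_Integration.integrable_sum iT)
    show "integrable lborel (\<lambda>x. norm (\<Sum>m\<in>G. complex_of_real (a m) * h m x))"
      by (intro integrable_norm Bochner_Integration.integrable_sum integrable_mult_right h)
    fix x
    let ?t = "\<lambda>m. a m * (2 * (indicator (Q m) x * norm (h m x)) - norm (h m x))"
    show "(\<Sum>m\<in>G. ?t m) \<le> norm (\<Sum>m\<in>G. complex_of_real (a m) * h m x)"
    proof (cases "\<exists>m\<in>G. x \<in> Q m")
      case True
      then obtain j where j: "j \<in> G" "x \<in> Q j" by blast
      have nj: "x \<notin> Q m" if "m \<in> G - {j}" for m using disj[of m j] that j by blast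
      have "(\<Sum>m\<in>G. ?t m) = ?t j + (\<Sum>m\<in>G - {j}. ?t m)" using G j(1) by (rule sum.remove)
      also have "(\<Sum>m\<in>G - {j}. ?t m) = (\<Sum>m\<in>G - {j}. - norm (complex_of_real (a m) * h m x))"
        using nj a by (intro sum.cong) (auto simp: norm_mult)
      also have "\<dots> = - (\<Sum>m\<in>G - {j}. norm (complex_of_real (a m) * h m x))" by (rule sum_negf)
      also have "?t j = norm (complex_of_real (a j) * h j x)" using j a[OF j(1)] by (simp add: norm_mult)
      also have "norm (complex_of_real (a j) * h j x) + - (\<Sum>m\<in>G - {j}. norm (complex_of_real (a m) * h m x))
         \<le> norm (complex_of_real (a j) * h j x) - norm (\<Sum>m\<in>G - {j}. complex_of_real (a m) * h m x)"
        using norm_sum[of "\<lambda>m. complex_of_real (a m) * h m x" "G - {j}"] by simp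
      also have "\<dots> \<le> norm (complex_of_real (a j) * h j x + (\<Sum>m\<in>G - {j}. complex_of_real (a m) * h m x))"
        by (rule norm_diff_ineq)
      also have "complex_of_real (a j) * h j x + (\<Sum>m\<in>G - {j}. complex_of_real (a m) * h m x) = (\<Sum>m\<in>G. complex_of_real (a m) * h m x)"
        using sum.remove[OF G j(1), of "\<lambda>m. complex_of_real (a m) * h m x"] by simp
      finally show ?thesis .
    next
      case False
      then have "(\<Sum>m\<in>G. ?t m) \<le> (\<Sum>m\<in>G. 0)" using a by (intro sum_mono) (auto simp: mult_nonneg_nonneg)
      then show ?thesis using norm_ge_zero order_trans by fastforce
    qed
  qed
  finally show ?thesis .
qed

context alpha_partition
begin

lemma inv_fourier_sum:
  assumes "finite I" "\<And>i. i \<in> I \<Longrightarrow> f i \<in> schwartz"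
  shows "inv_fourier (\<lambda>x. \<Sum>i\<in>I. complex_of_real (a i) * f i x) = (\<lambda>x::real^'n. \<Sum>i\<in>I. complex_of_real (a i) * inv_fourier (f i) x)"
proof
  fix x :: "real^'n"
  have i: "integrable lborel (\<lambda>\<xi>. complex_of_real (a i) * (f i \<xi> * wave x \<xi>))" if "i \<in> I" for i
    by (intro integrable_mult_right integrable_mult_wave schwartz_integrable assms that)
  have "inv_fourier (\<lambda>x. \<Sum>i\<in>I. complex_of_real (a i) * f i x) x = (LINT \<xi>|lborel. (\<Sum>i\<in>I. complex_of_real (a i) * (f i \<xi> * wave x \<xi>)))"
    by (simp add: inv_fourier_wave sum_distrib_right mult.assoc)
  also have "\<dots> = (\<Sum>i\<in>I. LINT \<xi>|lborel. complex_of_real (a i) * (f i \<xi> * wave x \<xi>))"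
    by (rule Bochner_Integration.integral_sum[OF i])
  also have "\<dots> = (\<Sum>i\<in>I. complex_of_real (a i) * inv_fourier (f i) x)"
    by (simp only: integral_mult_right_zero inv_fourier_wave)
  finally show "inv_fourier (\<lambda>x. \<Sum>i\<in>I. complex_of_real (a i) * f i x) x = (\<Sum>i\<in>I. complex_of_real (a i) * inv_fourier (f i) x)" .
qed

lemma profile_concentration:
  "\<exists>R>0. 3 / 4 * (LINT x|lborel. norm (profile x)) \<le> (LINT x|lborel. indicator (ball 0 R) x * norm (profile x))"
proof -
  let ?L = "LINT x|lborel. norm (profile x)"
  have [measurable]: "profile \<in> borel_measurable borel" by (rule schwartz_measurable[OF profile_schwartz])
  have "(\<lambda>n. LINT x|lborel. indicator (ball 0 (real n)) x * norm (profile x)) \<longlonglongrightarrow> ?L"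
  proof (rule integral_dominated_convergence)
    show "integrable lborel (\<lambda>x. norm (profile x))" by (intro integrable_norm schwartz_integrable profile_schwartz)
    show "AE x in lborel. (\<lambda>n. indicator (ball 0 (real n)) x * norm (profile x)) \<longlonglongrightarrow> norm (profile x)"
    proof (intro AE_I2 tendsto_eventually)
      fix x :: "real^'n"
      obtain n0 :: nat where n0: "norm x < real n0" using reals_Archimedean2 by blast
      show "\<forall>\<^sub>F n in sequentially. indicator (ball 0 (real n)) x * norm (profile x) = norm (profile x)"
        unfolding eventually_sequentially
      proof (intro exI[of _ n0] allI impI)
        fix n assume "n0 \<le> n"
        then have "norm x < real n" using n0 by (meson less_le_trans of_nat_mono)
        then show "indicator (ball 0 (real n)) x * norm (profile x) = norm (profile x)" by simp
      qed
    qed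
    show "AE x in lborel. norm (indicator (ball 0 (real n)) x * norm (profile x)) \<le> norm (profile x)" for n
      by (intro AE_I2) (simp add: indicator_def)
    show "(\<lambda>x. indicator (ball 0 (real n)) x * norm (profile x)) \<in> borel_measurable lborel" for n
      by (intro borel_measurable_times borel_measurable_indicator) simp_all
  qed simp
  moreover have "3 / 4 * ?L < ?L" using profile_L1_pos by simp
  ultimately have "\<forall>\<^sub>F n in sequentially. 3 / 4 * ?L < (LINT x|lborel. indicator (ball 0 (real n)) x * norm (profile x))"
    by (rule order_tendstoD(1))
  then have "\<forall>\<^sub>F n in sequentially. 0 < n \<and> 3 / 4 * ?L < (LINT x|lborel. indicator (ball 0 (real n)) x * norm (profile x))"
    using eventually_gt_at_top[of 0] by eventually_elim simp
  then obtain n :: nat where "0 < n" "3 / 4 * ?L < (LINT x|lborel. indicator (ball 0 (real n)) x * norm (profile x))"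
    using eventually_happens[of _ sequentially] by auto
  then show ?thesis by (intro exI[of _ "real n"]) auto
qed

text \<open>The \<open>L\<^sup>1\<close> normalisation does not depend on \<open>r\<close>, and for \<open>r \<ge> 1\<close> the mass only gets more
  concentrated, so one radius \<open>R\<close> works for all bumps.\<close>

lemma bump_L1:
  assumes r: "1 \<le> r"
  shows "(LINT x|lborel. norm (inv_fourier (bump c r x0) x)) = (LINT x|lborel. norm (profile x))"
    and "(LINT x|lborel. indicator (ball 0 R) x * norm (profile x)) \<le> (LINT x|lborel. indicator (ball x0 R) x * norm (inv_fourier (bump c r x0) x))"
proof -
  have r0: "0 < r" using r by simp
  have [measurable]: "profile \<in> borel_measurable borel" by (rule schwartz_measurable[OF profile_schwartz])
  have ip: "integrable lborel (\<lambda>x. norm (profile x))" by (intro integrable_norm schwartz_integrable profile_schwartz)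
  have sub: "norm (inv_fourier (bump c r x0) (x0 + (1 / r) *\<^sub>R z)) = r ^ CARD('n) * norm (profile z)" for z
    using r0 by (simp add: norm_inv_fourier_bump)
  have "(LINT x|lborel. norm (inv_fourier (bump c r x0) x)) = \<bar>1 / r\<bar> ^ DIM(real^'n) *\<^sub>R (LINT z|lborel. norm (inv_fourier (bump c r x0) (x0 + (1 / r) *\<^sub>R z)))"
    using r0 by (intro integral_affine) auto
  then show "(LINT x|lborel. norm (inv_fourier (bump c r x0) x)) = (LINT x|lborel. norm (profile x))"
    using r0 unfolding sub by (simp add: power_divide)
  have eq: "(LINT x|lborel. indicator (ball x0 R) x * norm (inv_fourier (bump c r x0) x)) = (LINT z|lborel. indicator (ball x0 R) (x0 + (1 / r) *\<^sub>R z) * norm (profile z))"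
  proof -
    have "(LINT x|lborel. indicator (ball x0 R) x * norm (inv_fourier (bump c r x0) x)) =
      \<bar>1 / r\<bar> ^ DIM(real^'n) *\<^sub>R (LINT z|lborel. indicator (ball x0 R) (x0 + (1 / r) *\<^sub>R z) * norm (inv_fourier (bump c r x0) (x0 + (1 / r) *\<^sub>R z)))"
      using r0 by (intro integral_affine) auto
    also have "\<dots> = \<bar>1 / r\<bar> ^ DIM(real^'n) *\<^sub>R (LINT z|lborel. r ^ CARD('n) * (indicator (ball x0 R) (x0 + (1 / r) *\<^sub>R z) * norm (profile z)))"
      unfolding sub by (simp only: mult.left_commute)
    also have "\<dots> = (LINT z|lborel. indicator (ball x0 R) (x0 + (1 / r) *\<^sub>R z) * norm (profile z))"
      using r0 by (simp only: integral_mult_right_zero) (simp add: power_divide)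
    finally show ?thesis .
  qed
  show "(LINT x|lborel. indicator (ball 0 R) x * norm (profile x)) \<le> (LINT x|lborel. indicator (ball x0 R) x * norm (inv_fourier (bump c r x0) x))"
    unfolding eq
  proof (rule lborel_integral_mono)
    show "integrable lborel (\<lambda>x. indicator (ball 0 R) x * norm (profile x))"
      by (rule Bochner_Integration.integrable_bound[OF ip]) (auto simp: indicator_def)
    show "integrable lborel (\<lambda>z. indicator (ball x0 R) (x0 + (1 / r) *\<^sub>R z) * norm (profile z))"
      by (rule Bochner_Integration.integrable_bound[OF ip]) (auto simp: indicator_def)
    fix z :: "real^'n"
    have "dist x0 (x0 + (1 / r) *\<^sub>R z) = norm z / r" using r0 by (simp add: dist_norm)
    moreover have "norm z / r \<le> norm z" using r by (simp add: divide_le_eq mult_le_cancel_left1 mult_left_le)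
    ultimately show "indicator (ball 0 R) z * norm (profile z) \<le> indicator (ball x0 R) (x0 + (1 / r) *\<^sub>R z) * norm (profile z)"
      by (intro mult_right_mono) (auto simp: indicator_def)
  qed
qed

lemma jap_powr_near:
  assumes near: "norm (lattice_pt k - lattice_pt l) \<le> R"
  shows "jap l powr \<sigma> \<le> (1 + R) powr \<bar>\<sigma>\<bar> * jap (k :: int^'n) powr \<sigma>"
proof -
  have R: "0 \<le> R" using near norm_ge_zero order_trans by blast
  have J: "0 < jap k" "0 < jap l" by (rule japanese_pos)+
  have "jap l \<le> (1 + norm (lattice_pt l - lattice_pt k)) * jap k" by (rule japanese_le_mult)
  also have "\<dots> \<le> (1 + R) * jap k" using near J by (intro mult_right_mono) (auto simp: norm_minus_commute)
  finally have 1: "jap l \<le> (1 + R) * jap k" .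
  have "jap k \<le> (1 + norm (lattice_pt k - lattice_pt l)) * jap l" by (rule japanese_le_mult)
  also have "\<dots> \<le> (1 + R) * jap l" using near J by (intro mult_right_mono) auto
  finally have 2: "jap k \<le> (1 + R) * jap l" .
  show ?thesis
  proof (cases "0 \<le> \<sigma>")
    case True
    have "jap l powr \<sigma> \<le> ((1 + R) * jap k) powr \<sigma>" using 1 J True by (intro powr_mono2) auto
    then show ?thesis using True R J by (simp add: powr_mult)
  next
    case False
    have "((1 + R) * jap l) powr \<sigma> \<le> jap k powr \<sigma>" using 2 J False by (intro powr_mono2') auto
    then have "(1 + R) powr (- \<sigma>) * ((1 + R) * jap l) powr \<sigma> \<le> (1 + R) powr (- \<sigma>) * jap k powr \<sigma>"
      by (intro mult_left_mono) auto
    moreover have "(1 + R) powr (- \<sigma>) * ((1 + R) * jap l) powr \<sigma> = jap l powr \<sigma>"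
      using R J by (simp add: powr_mult powr_minus)
    ultimately show ?thesis using False by simp
  qed
qed

text \<open>Bumps indexed by a sparse sublattice and translated far apart turn the embedding into an
  inequality between sequence norms: no piece sees two bumps, and
  cancellation costs at most half of the \<open>L\<^sup>1\<close> norm.\<close>

lemma embedding_imp_sequence_inequality:
  assumes emb: "\<forall>u\<in>modulation_space \<eta> s \<alpha> p q. distr_Lp_norm 1 u \<le> ennreal C * modulation_norm \<eta> s \<alpha> p q u"
    and p: "0 < p" and q: "0 < q"
  defines "\<delta> \<equiv> s - real CARD('n) * \<alpha> * (recip p - 1)"
  shows "\<exists>D\<ge>1. \<exists>C1\<ge>0. \<forall>G a V. finite G \<longrightarrow> (\<forall>m\<in>G. 0 \<le> a m) \<longrightarrow> 0 \<le> V \<longrightarrow>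
     (q = \<infinity> \<longrightarrow> (\<forall>m\<in>G. a m * jap (dilate D m) powr (\<delta> / (1 - \<alpha>)) \<le> V)) \<longrightarrow>
     (q \<noteq> \<infinity> \<longrightarrow> (\<Sum>m\<in>G. (a m * jap (dilate D m) powr (\<delta> / (1 - \<alpha>))) powr enn2real q) \<le> V powr enn2real q) \<longrightarrow>
     (\<Sum>m\<in>G. a (m :: int^'n)) \<le> C1 * V"
proof -
  define D where "D = \<lceil>4 * supp_const + 1\<rceil>"
  have D: "1 \<le> D" "4 * supp_const < real_of_int D"
  proof -
    have "4 * supp_const + 1 \<le> real_of_int D" unfolding D_def by simp
    then show "4 * supp_const < real_of_int D" by linarith
    then have "0 < real_of_int D" using supp_const(1) by linarith
    then show "1 \<le> D" by simp
  qed
  define L where "L = (LINT x|lborel. norm (profile x))"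
  have L: "0 < L" using profile_L1_pos by (simp add: L_def)
  obtain R where R: "0 < R" "3 / 4 * L \<le> (LINT x|lborel. indicator (ball 0 R) x * norm (profile x))"
    using profile_concentration unfolding L_def by blast
  define A where "A = (1 + 2 * supp_const) powr (\<alpha> / (1 - \<alpha>))"
  obtain K where K: "0 \<le> K" "\<And>l c r x0 a. 0 < r \<Longrightarrow> r \<le> A * rad l \<Longrightarrow> 0 \<le> a \<Longrightarrow>
     Lp_norm p (inv_fourier (\<lambda>\<xi>. \<eta> l \<xi> * (complex_of_real a * bump c r x0 \<xi>))) \<le> ennreal (K * a * r powr (real CARD('n) * (1 - recip p)))"
    using piece_Lp_norm[OF p, of A] by blast
  define \<sigma> where "\<sigma> = s / (1 - \<alpha>)"
  define J where "J = (1 + 2 * supp_const) powr \<bar>\<sigma>\<bar>"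
  have J: "0 \<le> J" by (simp add: J_def)
  define N where "N = card {d :: int^'n. norm (lattice_pt d) \<le> 2 * supp_const} + 1"
  define C1 where "C1 = 2 / L * (\<bar>C\<bar> * (real N powr recip q * (J * K)))"
  have C1: "0 \<le> C1" using L J K by (simp add: C1_def)
  have "(\<Sum>m\<in>G. a m) \<le> C1 * V"
    if G: "finite G" and a: "\<forall>m\<in>G. 0 \<le> a m" and V: "0 \<le> V"
      and Vinf: "q = \<infinity> \<longrightarrow> (\<forall>m\<in>G. a m * jap (dilate D m) powr (\<delta> / (1 - \<alpha>)) \<le> V)"
      and Vfin: "q \<noteq> \<infinity> \<longrightarrow> (\<Sum>m\<in>G. (a m * jap (dilate D m) powr (\<delta> / (1 - \<alpha>))) powr enn2real q) \<le> V powr enn2real q"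
    for G :: "(int^'n) set" and a V
  proof -
    define x0 where "x0 m = (2 * R) *\<^sub>R lattice_pt (dilate D m)" for m :: "int^'n"
    define h where "h m = bump (cen (dilate D m)) (rad (dilate D m)) (x0 m)" for m
    define b where "b \<xi> = (\<Sum>m\<in>G. complex_of_real (a m) * h m \<xi>)" for \<xi>
    define S where "S m = {l. norm (lattice_pt (dilate D m) - lattice_pt l) \<le> 2 * supp_const}" for m :: "int^'n"
    define v where "v m = J * K * (a m * jap (dilate D m) powr (\<delta> / (1 - \<alpha>)))" for m
    have hs: "h m \<in> schwartz" for m unfolding h_def by (rule bump_schwartz[OF rad_pos])
    have bs: "b \<in> schwartz" unfolding b_def[abs_def] by (intro schwartz_sum G schwartz_cmul hs)
    have inS: "l \<in> S m" if nz: "\<eta> l \<xi> \<noteq> 0" "h m \<xi> \<noteq> 0" for l m \<xi>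
    proof -
      have "norm (\<xi> - cen l) < supp_const * rad l" by (rule eta_support[OF nz(1)])
      moreover have "norm (\<xi> - cen (dilate D m)) < supp_const * rad (dilate D m)"
        using bump_support[OF rad_pos nz(2)[unfolded h_def]] .
      moreover have "norm (cen (dilate D m) - cen l) \<le> norm (\<xi> - cen l) + norm (\<xi> - cen (dilate D m))"
        using norm_triangle_ineq4[of "\<xi> - cen l" "\<xi> - cen (dilate D m)"] by (simp add: algebra_simps)
      ultimately have "norm (cen (dilate D m) - cen l) \<le> supp_const * (rad (dilate D m) + rad l)"
        by (simp add: distrib_left)
      then show ?thesis unfolding S_def
        using alpha_center_near_imp_lattice_near[OF alpha_nonneg alpha_less_1] by blast
    qed
    have uniq: "m = m'" if "l \<in> S m" "l \<in> S m'" for l m m'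
    proof (rule ccontr)
      assume "m \<noteq> m'"
      from dilate_separation[OF D(1) this] have "real_of_int D \<le> norm (lattice_pt (dilate D m) - lattice_pt (dilate D m'))" .
      also have "\<dots> \<le> norm (lattice_pt (dilate D m) - lattice_pt l) + norm (lattice_pt (dilate D m') - lattice_pt l)"
        using norm_triangle_ineq4[of "lattice_pt (dilate D m) - lattice_pt l" "lattice_pt (dilate D m') - lattice_pt l"] by simp
      also have "\<dots> \<le> 4 * supp_const" using that by (simp add: S_def)
      finally show False using D(2) by linarith
    qed
    have prod: "(\<lambda>\<xi>. \<eta> l \<xi> * b \<xi>) = (\<lambda>\<xi>. \<eta> l \<xi> * (complex_of_real (a m) * h m \<xi>))" if m: "m \<in> G" "l \<in> S m" for l m
    proof
      fix \<xi>
      have "\<eta> l \<xi> * b \<xi> = (\<Sum>j\<in>G. \<eta> l \<xi> * (complex_of_real (a j) * h j \<xi>))" by (simp add: b_def sum_distrib_left)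
      also have "\<dots> = \<eta> l \<xi> * (complex_of_real (a m) * h m \<xi>) + (\<Sum>j\<in>G - {m}. \<eta> l \<xi> * (complex_of_real (a j) * h j \<xi>))"
        by (rule sum.remove[OF G m(1)])
      also have "(\<Sum>j\<in>G - {m}. \<eta> l \<xi> * (complex_of_real (a j) * h j \<xi>)) = 0"
      proof (rule sum.neutral, rule ballI)
        fix j assume "j \<in> G - {m}"
        then have "l \<notin> S j" using uniq[of l j m] m(2) by auto
        then have "\<eta> l \<xi> = 0 \<or> h j \<xi> = 0" using inS by blast
        then show "\<eta> l \<xi> * (complex_of_real (a j) * h j \<xi>) = 0" by auto
      qed
      finally show "\<eta> l \<xi> * b \<xi> = \<eta> l \<xi> * (complex_of_real (a m) * h m \<xi>)" by simp
    qed
    have z: "inv_fourier (\<lambda>\<xi>::real^'n. 0) = (\<lambda>x. 0)" by (simp add: inv_fourier_wave fun_eq_iff)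
    let ?c = "\<lambda>l. ennreal (jap l powr (s / (1 - \<alpha>))) * Lp_norm p (inv_fourier (\<lambda>\<xi>. \<eta> l \<xi> * b \<xi>))"
    have "lq_norm q ?c \<le> ennreal (real N powr recip q * (J * K * V))"
    proof (rule lq_norm_le_blocks[where G=G and S=S and v=v, OF q G])
      show "finite (S m) \<and> card (S m) \<le> N" for m
        unfolding S_def N_def using card_lattice_near[of "dilate D m" "2 * supp_const"]
        by (intro conjI finite_lattice_near) linarith
      show "?c l = 0" if "l \<notin> (\<Union>m\<in>G. S m)" for l
      proof -
        have "(\<lambda>\<xi>. \<eta> l \<xi> * b \<xi>) = (\<lambda>\<xi>. 0)"
        proof
          fix \<xi> show "\<eta> l \<xi> * b \<xi> = 0"
            unfolding b_def sum_distrib_left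
          proof (rule sum.neutral, rule ballI)
            fix j assume "j \<in> G"
            then have "l \<notin> S j" using that by blast
            then have "\<eta> l \<xi> = 0 \<or> h j \<xi> = 0" using inS by blast
            then show "\<eta> l \<xi> * (complex_of_real (a j) * h j \<xi>) = 0" by auto
          qed
        qed
        moreover have "Lp_norm p (\<lambda>x::real^'n. 0) = 0"
        proof -
          define r where "r = min 1 (A * rad l)"
          have "0 < A" unfolding A_def using supp_const(1) by simp
          then have "0 < r" "r \<le> A * rad l" using rad_pos[of l] by (auto simp: r_def)
          from K(2)[OF this order_refl, of 0 0] show ?thesis by (simp add: z)
        qed
        ultimately show ?thesis by (simp only: z mult_zero_right)
      qed
      show "?c l \<le> ennreal (v m)" if m: "m \<in> G" "l \<in> S m" for l m
      proof -
        let ?k = "dilate D m"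
        have near: "norm (lattice_pt ?k - lattice_pt l) \<le> 2 * supp_const" using m(2) by (simp add: S_def)
        have am: "0 \<le> a m" using a m(1) by blast
        have "Lp_norm p (inv_fourier (\<lambda>\<xi>. \<eta> l \<xi> * b \<xi>)) \<le> ennreal (K * a m * rad ?k powr (real CARD('n) * (1 - recip p)))"
          unfolding prod[OF m] h_def A_def
          by (intro K(2)[unfolded A_def] rad_pos alpha_radius_le_mult alpha_nonneg alpha_less_1 near am)
        moreover have "jap l powr (s / (1 - \<alpha>)) \<le> J * jap ?k powr \<sigma>"
          unfolding J_def \<sigma>_def[symmetric] by (rule jap_powr_near[OF near])
        ultimately have "?c l \<le> ennreal (J * jap ?k powr \<sigma>) * ennreal (K * a m * rad ?k powr (real CARD('n) * (1 - recip p)))"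
          by (intro mult_mono ennreal_leI) auto
        also have "\<dots> = ennreal ((J * jap ?k powr \<sigma>) * (K * a m * rad ?k powr (real CARD('n) * (1 - recip p))))"
          using J K am by (intro ennreal_mult[symmetric]) auto
        also have "(J * jap ?k powr \<sigma>) * (K * a m * rad ?k powr (real CARD('n) * (1 - recip p))) = v m"
        proof -
          have "rad ?k powr (real CARD('n) * (1 - recip p)) = jap ?k powr (\<alpha> / (1 - \<alpha>) * (real CARD('n) * (1 - recip p)))"
            by (simp add: alpha_radius_def powr_powr)
          moreover have "\<sigma> + \<alpha> / (1 - \<alpha>) * (real CARD('n) * (1 - recip p)) = \<delta> / (1 - \<alpha>)"
            unfolding \<sigma>_def \<delta>_def by (simp add: add_divide_distrib[symmetric] algebra_simps)
          ultimately have "jap ?k powr \<sigma> * rad ?k powr (real CARD('n) * (1 - recip p)) = jap ?k powr (\<delta> / (1 - \<alpha>))"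
            by (simp only: powr_add[symmetric])
          then show ?thesis by (simp add: v_def)
        qed
        finally show ?thesis .
      qed
      show "0 \<le> v m" if "m \<in> G" for m using J K a that by (simp add: v_def)
      show "v m \<le> J * K * V" if "q = \<infinity>" "m \<in> G" for m
        unfolding v_def using Vinf that J K by (intro mult_left_mono) auto
      show "(\<Sum>m\<in>G. v m powr enn2real q) \<le> (J * K * V) powr enn2real q" if "q \<noteq> \<infinity>"
      proof -
        have "(\<Sum>m\<in>G. v m powr enn2real q) = (J * K) powr enn2real q * (\<Sum>m\<in>G. (a m * jap (dilate D m) powr (\<delta> / (1 - \<alpha>))) powr enn2real q)"
          unfolding v_def sum_distrib_left using J K a by (intro sum.cong powr_mult refl)
        also have "\<dots> \<le> (J * K) powr enn2real q * V powr enn2real q"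
          using Vfin that by (intro mult_left_mono) auto
        also have "\<dots> = (J * K * V) powr enn2real q" using J K V by (intro powr_mult[symmetric])
        finally show ?thesis .
      qed
    qed (use J K V in \<open>auto simp: N_def\<close>)
    from embedding_test[OF emb q bs this]
    have "(\<integral>\<^sup>+x. ennreal (norm (inv_fourier b x)) \<partial>lborel) \<le> ennreal C * ennreal (real N powr recip q * (J * K * V))" .
    also have "\<dots> \<le> ennreal \<bar>C\<bar> * ennreal (real N powr recip q * (J * K * V))"
      by (intro mult_right_mono ennreal_leI) auto
    also have "\<dots> = ennreal (\<bar>C\<bar> * (real N powr recip q * (J * K * V)))" using J K V by (simp add: ennreal_mult[symmetric])
    also have "(\<integral>\<^sup>+x. ennreal (norm (inv_fourier b x)) \<partial>lborel) = ennreal (LINT x|lborel. norm (inv_fourier b x))"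
      by (intro nn_integral_eq_integral integrable_norm schwartz_integrable schwartz_inv_fourier bs) auto
    finally have up: "(LINT x|lborel. norm (inv_fourier b x)) \<le> \<bar>C\<bar> * (real N powr recip q * (J * K * V))"
      using J K V by (simp add: ennreal_le_iff)
    have "L / 2 * (\<Sum>m\<in>G. a m) \<le> (LINT x|lborel. norm (\<Sum>m\<in>G. complex_of_real (a m) * inv_fourier (h m) x))"
    proof (rule L1_lower_bound_separated[where Q="\<lambda>m. ball (x0 m) R", OF G])
      show "integrable lborel (inv_fourier (h m))" for m by (intro schwartz_integrable schwartz_inv_fourier hs)
      show "0 \<le> a m" if "m \<in> G" for m using a that by blast
      show "ball (x0 m) R \<inter> ball (x0 m') R = {}" if "m \<noteq> m'" for m m'
      proof (rule disjoint_ballI)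
        have "2 * R * 1 \<le> 2 * R * norm (lattice_pt (dilate D m) - lattice_pt (dilate D m'))"
          using dilate_separation[OF D(1) that] D(1) R(1) by (intro mult_left_mono) auto
        also have "\<dots> = dist (x0 m) (x0 m')" using R(1) by (simp add: x0_def dist_norm scaleR_diff_right[symmetric])
        finally show "R + R \<le> dist (x0 m) (x0 m')" by simp
      qed
      show "(LINT x|lborel. norm (inv_fourier (h m) x)) = L" for m
        unfolding h_def L_def by (rule bump_L1(1)[OF rad_ge_1])
      show "3 / 4 * L \<le> (LINT x|lborel. indicator (ball (x0 m) R) x * norm (inv_fourier (h m) x))" for m
        using R(2) bump_L1(2)[OF rad_ge_1] unfolding h_def by (rule order_trans)
    qed auto
    also have "\<dots> = (LINT x|lborel. norm (inv_fourier b x))"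
      unfolding b_def[abs_def] by (subst inv_fourier_sum[OF G hs]) (rule refl)
    also note up
    finally have "2 / L * (L / 2 * (\<Sum>m\<in>G. a m)) \<le> 2 / L * (\<bar>C\<bar> * (real N powr recip q * (J * K * V)))"
      using L by (intro mult_left_mono) auto
    then show ?thesis using L by (simp add: C1_def mult_ac)
  qed
  then show ?thesis using D(1) C1 by blast
qed


theorem embedding_necessary_s:
  assumes emb: "\<forall>u\<in>modulation_space \<eta> s \<alpha> p q. distr_Lp_norm 1 u \<le> ennreal C * modulation_norm \<eta> s \<alpha> p q u"
    and p: "0 < p" and q: "0 < q"
  defines "\<delta> \<equiv> s - real CARD('n) * \<alpha> * (recip p - 1)"
  shows "q \<le> 1 \<Longrightarrow> 0 \<le> \<delta>"
    and "1 < q \<Longrightarrow> (1 - \<alpha>) * (real CARD('n) * (1 - recip q)) < \<delta>"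
proof -
  have \<alpha>1: "0 < 1 - \<alpha>" using alpha_less_1 by simp
  define \<tau> where "\<tau> = \<delta> / (1 - \<alpha>)"
  obtain D C1 where D: "1 \<le> D" and C1: "0 \<le> C1" and
    key0: "\<forall>G a V. finite G \<longrightarrow> (\<forall>m\<in>G. 0 \<le> a m) \<longrightarrow> 0 \<le> V \<longrightarrow>
     (q = \<infinity> \<longrightarrow> (\<forall>m\<in>G. a m * jap (dilate D m) powr \<tau> \<le> V)) \<longrightarrow>
     (q \<noteq> \<infinity> \<longrightarrow> (\<Sum>m\<in>G. (a m * jap (dilate D m) powr \<tau>) powr enn2real q) \<le> V powr enn2real q) \<longrightarrow>
     (\<Sum>m\<in>G. a (m :: int^'n)) \<le> C1 * V"
    using embedding_imp_sequence_inequality[OF emb p q] unfolding \<tau>_def \<delta>_def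
    by (elim exE conjE)
  have key: "(\<Sum>m\<in>G. a m) \<le> C1 * V" if "finite G" "\<And>m. m \<in> G \<Longrightarrow> 0 \<le> a m" "0 \<le> V"
     "\<And>m. q = \<infinity> \<Longrightarrow> m \<in> G \<Longrightarrow> a m * jap (dilate D m) powr \<tau> \<le> V"
     "q \<noteq> \<infinity> \<Longrightarrow> (\<Sum>m\<in>G. (a m * jap (dilate D m) powr \<tau>) powr enn2real q) \<le> V powr enn2real q"
    for G :: "(int^'n) set" and a V
    by (rule key0[rule_format, of G a V]) (fact that)+
  have J: "0 < jap (dilate D m)" "1 \<le> jap (dilate D m)" for m :: "int^'n" by (rule japanese_pos japanese_ge_1)+
  \<comment> \<open>one bump, far out in frequency\<close>
  show "0 \<le> \<delta>" if q1: "q \<le> 1"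
  proof (rule ccontr)
    assume "\<not> 0 \<le> \<delta>"
    then have \<tau>: "\<tau> < 0" using \<alpha>1 by (simp add: \<tau>_def divide_neg_pos)
    have qf: "q \<noteq> \<infinity>" using q1 by (auto simp: infinity_ennreal_def top_unique)
    have b: "jap (dilate D m) powr (- \<tau>) \<le> C1" for m :: "int^'n"
    proof -
      have "(\<Sum>m\<in>{m}. jap (dilate D m) powr (- \<tau>)) \<le> C1 * 1"
        by (rule key) (use J(1) qf in \<open>auto simp: powr_add[symmetric] less_imp_neq[symmetric]\<close>)
      then show ?thesis by simp
    qed
    obtain m :: "int^'n" where m: "(C1 + 1) powr (1 / - \<tau>) \<le> jap m" using lattice_unbounded by blast
    have "jap m \<le> jap (dilate D m)"
    proof -
      have "lattice_pt (dilate D m) = real_of_int D *\<^sub>R lattice_pt m" by (simp add: lattice_pt_def dilate_def vec_eq_iff)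
      then have "norm (lattice_pt m) \<le> norm (lattice_pt (dilate D m))"
        using D mult_right_mono[of 1 "real_of_int D" "norm (lattice_pt m)"] by simp
      then show ?thesis by (simp add: japanese_def power_mono)
    qed
    then have "((C1 + 1) powr (1 / - \<tau>)) powr (- \<tau>) \<le> jap (dilate D m) powr (- \<tau>)"
      using m \<tau> by (intro powr_mono2) auto
    moreover have "((C1 + 1) powr (1 / - \<tau>)) powr (- \<tau>) = C1 + 1" using C1 \<tau> by (simp add: powr_powr)
    ultimately show False using b[of m] by simp
  qed
  \<comment> \<open>the sequence \<open>a = w powr q'\<close> extremal in Hoelder's inequality, with \<open>w = jap powr (- \<tau>)\<close>\<close>
  show "(1 - \<alpha>) * (real CARD('n) * (1 - recip q)) < \<delta>" if q1: "1 < q"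
  proof (rule ccontr)
    assume neg: "\<not> (1 - \<alpha>) * (real CARD('n) * (1 - recip q)) < \<delta>"
    have rq: "recip q < 1" using recip_ge_1_iff[OF q] q1 by auto
    define q' where "q' = 1 / (1 - recip q)"
    have q'0: "0 < q'" using rq by (simp add: q'_def)
    have T: "\<tau> * q' \<le> real CARD('n)"
    proof -
      have "\<delta> \<le> real CARD('n) * ((1 - \<alpha>) * (1 - recip q))" using neg by (simp add: mult_ac)
      then show ?thesis using \<alpha>1 rq by (simp add: \<tau>_def q'_def pos_divide_le_eq)
    qed
    define a where "a m = jap (dilate D m) powr (- (\<tau> * q'))" for m :: "int^'n"
    have large: "\<exists>G. finite G \<and> K \<le> (\<Sum>m\<in>G. a m)" for K
      using lattice_sum_diverges[OF T D, of K] by (simp add: a_def dilate_def)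
    show False
    proof (cases "q = \<infinity>")
      case True
      then have "q' = 1" by (simp add: q'_def recip_infinity)
      have "(\<Sum>m\<in>G. a m) \<le> C1 * 1" if "finite G" for G
        by (rule key[OF that]) (use J(1) True \<open>q' = 1\<close> in \<open>auto simp: a_def powr_add[symmetric] less_imp_neq[symmetric]\<close>)
      moreover obtain G where "finite G" "C1 + 1 \<le> (\<Sum>m\<in>G. a m)" using large by blast
      ultimately show False by force
    next
      case False
      define r where "r = enn2real q"
      have r: "0 < r" "recip q = 1 / r" using enn2real_pos_of_finite[OF q False] recip_eq[OF q False] by (auto simp: r_def)
      have r1: "1 < r" using rq r by (simp add: divide_less_eq)
      have q'r: "(1 - q') * r = - q'" using r1 unfolding q'_def r(2) by (simp add: field_simps)
      have bound: "(\<Sum>m\<in>G. a m) \<le> C1 * (\<Sum>m\<in>G. a m) powr (1 / r)" if G: "finite G" for G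
      proof (rule key[OF G])
        have nn: "0 \<le> (\<Sum>m\<in>G. a m)" by (intro sum_nonneg) (simp add: a_def)
        have "(a m * jap (dilate D m) powr \<tau>) powr enn2real q = a m" for m
        proof -
          have "(a m * jap (dilate D m) powr \<tau>) powr r = jap (dilate D m) powr ((- (\<tau> * q') + \<tau>) * r)"
            by (simp add: a_def powr_add[symmetric] powr_powr)
          also have "(- (\<tau> * q') + \<tau>) * r = \<tau> * ((1 - q') * r)" by (simp add: algebra_simps)
          also have "\<dots> = - (\<tau> * q')" unfolding q'r by simp
          finally show ?thesis by (simp add: a_def r_def)
        qed
        then show "(\<Sum>m\<in>G. (a m * jap (dilate D m) powr \<tau>) powr enn2real q) \<le> ((\<Sum>m\<in>G. a m) powr (1 / r)) powr enn2real q"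
          using nn r by (simp add: powr_powr r_def[symmetric])
      qed (use False in \<open>auto simp: a_def\<close>)
      have "(\<Sum>m\<in>G. a m) \<le> C1 powr q'" if G: "finite G" for G
      proof (cases "(\<Sum>m\<in>G. a m) = 0")
        case nz: False
        let ?S = "\<Sum>m\<in>G. a m"
        have S: "0 < ?S" using nz sum_nonneg[of G a] by (simp add: a_def less_le)
        have "?S powr (1 / r) * ?S powr (1 / q') \<le> ?S powr (1 / r) * C1"
        proof -
          have "1 / r + 1 / q' = 1" using r1 unfolding q'_def r(2) by simp
          then have "?S powr (1 / r) * ?S powr (1 / q') = ?S" using S by (simp add: powr_add[symmetric])
          then show ?thesis using bound[OF G] by (simp add: mult.commute)
        qed
        then have "?S powr (1 / q') \<le> C1" using S by simp
        then have "(?S powr (1 / q')) powr q' \<le> C1 powr q'" using q'0 by (intro powr_mono2) auto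
        moreover have "(?S powr (1 / q')) powr q' = ?S" using S q'0 by (simp add: powr_powr)
        ultimately show ?thesis by simp
      qed simp
      moreover obtain G where "finite G" "C1 powr q' + 1 \<le> (\<Sum>m\<in>G. a m)" using large by blast
      ultimately show False by force
    qed
  qed
qed

end

theorem theorem1p4:
  fixes \<eta> :: "int^'n::finite \<Rightarrow> real^'n \<Rightarrow> complex"
    and \<alpha> s :: real and p q :: ennreal
  assumes "0 \<le> \<alpha>" "\<alpha> < 1"
    and "0 < p" "0 < q"
    and "alpha_decomposition \<alpha> \<eta>"
  shows "embedded (modulation_space \<eta> s \<alpha> p q) (modulation_norm \<eta> s \<alpha> p q)
                  (L1_space :: 'n distr set) (distr_Lp_norm 1)
     \<longleftrightarrow> recip p \<ge> 1 \<and>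
         s \<ge> real CARD('n) * \<alpha> * (recip p - 1) + (1 - \<alpha>) * B_index CARD('n) 1 q \<and>
         (q > 1 \<longrightarrow>
           s > real CARD('n) * \<alpha> * (recip p - 1) + (1 - \<alpha>) * B_index CARD('n) 1 q)"
    (is "?emb \<longleftrightarrow> ?cond")
proof -
  interpret alpha_partition \<eta> \<alpha> using assms by unfold_locales
  show ?thesis
  proof
    assume ?emb
    then obtain C where emb: "\<forall>u\<in>modulation_space \<eta> s \<alpha> p q. distr_Lp_norm 1 u \<le> ennreal C * modulation_norm \<eta> s \<alpha> p q u"
      unfolding embedded_def by blast
    have "1 \<le> recip p" by (rule necessary_p_le_1[OF emb assms(3,4)])
    moreover have "s \<ge> real CARD('n) * \<alpha> * (recip p - 1)" if "q \<le> 1"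
      using embedding_necessary_s(1)[OF emb assms(3,4) that] by simp
    moreover have "s > real CARD('n) * \<alpha> * (recip p - 1) + (1 - \<alpha>) * (real CARD('n) * (1 - recip q))" if "1 < q"
      using embedding_necessary_s(2)[OF emb assms(3,4) that] by simp
    ultimately show ?cond by (auto simp: B_index_one[OF assms(4)] not_le intro: less_imp_le)
  next
    assume ?cond
    then show ?emb by (intro embedding_sufficient assms(3,4)) auto
  qed
qed

end
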